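(* Let $(\rho_0,B_0,P_0)$ be a steady state of one of the four types (1)-(4) described in the context. For $k\in\mathbb{N}$ let $\lambda_k^2$ be the supremum, and let $\Lambda^2$ be the supremum, defined in the context for that type. Then $$\lim_{k\to\infty}\lambda_k^{2}=\Lambda^{2}.$$
   Context: Domain: $D=\{0\le x\le 2\pi,\ 0\le y\le 2\pi\}$, with periodic boundary conditions for velocity fields; the Sobolev spaces $H^m(0,2\pi)$, $H^m(D)$ of test functions are understood accordingly ($H^0=L^2$). $g$ is a constant (the gravitational field is $(g,0,0)$). Steady state (with zero velocity) of the ideal magnetohydrodynamic equations: smooth density $\rho_0(x)$ with $\min\rho_0\ge c>0$, magnetic field $B_0$ and pressure $P_0=p_0(x)$ with $\frac{d}{dx}\left(P_0+\frac12|B_0|^2\right)=\rho_0 g$; in the compressible case $P_0=C_*\rho_0^\gamma$ with a constant $C_*>0$ and adiabatic index $\gamma>0$. In all types, $$\Lambda^{2}=\sup_{v}\frac{\iint_{D}H(v,v_{x})\,dx\,dy}{\iint_D\rho_0v^2\,dx\,dy},$$ supremum over nonzero scalar $v\in H^{\kappa-1}(D)$ (when $H$ depends on its first argument only, $H(v,v_x)$ means $H(v)$). In the incompressible types, $$\lambda_k^2=\sup_{u\in H^{\kappa}(0,2\pi),\,u\ne0}\frac{\int_0^{2\pi}\left[-F\left(-\frac{u_{xx}}{k}\right)+H(u,u_x)\right]dx}{\int_0^{2\pi}\rho_0\left[u^2+\frac{u_x^2}{k^2}\right]dx}.$$ In the compressible types, $$\lambda_k^2=\sup_{(u_1,u_2)\in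 H^{\kappa}(0,2\pi)\times H^{\kappa-1}(0,2\pi),\,(u_1,u_2)\neq0}\frac{\int_0^{2\pi}\left[-F(u_{2x})-G_k+H(u_1,u_{1x})\right]dx}{\int_0^{2\pi}\rho_0\left[u_1^2+u_2^2\right]dx}.$$ The types are: (1) Incompressible, $B_0=(0,0,B_0(x))$: $\kappa=1$, $F=0$, $H(u)=-g\rho_{0x}u^2$. (2) Compressible, $B_0=(0,0,B_0(x))$: $\kappa=1$, $F=0$, $G_k=(\gamma p_0+B_0^2)\left(u_{1x}+ku_2+\frac{g\rho_0}{\gamma p_0+B_0^2}u_1\right)^2$, $H(u)=\left(\frac{g^2\rho_0^2}{\gamma p_0+B_0^2}-g\rho_{0x}\right)u^2$. (3) Incompressible, $B_0=(B_0,0,0)$ with $B_0$ constant: $\kappa=2$, $F(w)=B_0^2w^2$, $H(u,u_x)=-g\rho_{0x}u^2-B_0^2u_x^2$. (4) Compressible, $B_0=(B_0,0,0)$ with $B_0$ constant: $\kappa=2$, $F(w)=B_0^2w^2$, $G_k=(\gamma p_0+B_0^2)\left[\frac{\gamma p_0}{\gamma p_0+B_0^2}u_{1x}+\frac{g\rho_0u_1}{\gamma p_0+B_0^2}+ku_2\right]^2$, $H(u,u_x)=\frac{1}{\gamma p_0+B_0^2}\left(g\rho_0u-B_0^2u_x\right)^2-g\rho_{0x}u^2-B_0^2u_x^2$.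
   Formalization: The formal theorem additionally assumes Λ² ≥ 0 in types (1), (2), and (3) with B₀ = 0, where the claim fails whenever Λ² < 0 (e.g. type (1), ρ₀ = eˣ, g = 1: Λ² = −1 but λ_k² = 0 for all k). *)

theory Defs
  imports "HOL-Analysis.Analysis"
begin

section \<open>Square-integrable functions and periodic Sobolev spaces\<close>

definition I_meas :: "real measure" where
  "I_meas = restrict_space lborel {0..2 * pi}"

definition D_meas :: "(real \<times> real) measure" where
  "D_meas = I_meas \<Otimes>\<^sub>M I_meas"

definition L2 :: "'a measure \<Rightarrow> ('a \<Rightarrow> real) set" where
  "L2 M = {u \<in> borel_measurable M. integrable M (\<lambda>x. (u x)\<^sup>2)}"

text \<open>
  Weak derivatives are taken against periodic \<open>C\<^sup>1\<close> functions (smooth periodic functions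
  give the same notion).  As these need not vanish at the end points, the periodic boundary
  condition on \<open>u\<close> is part of the existence of a weak derivative.
\<close>

definition test_fun :: "(real \<Rightarrow> real) \<Rightarrow> (real \<Rightarrow> real) \<Rightarrow> bool" where
  "test_fun \<phi> \<phi>' \<longleftrightarrow>
     (\<forall>x. (\<phi> has_real_derivative \<phi>' x) (at x)) \<and> continuous_on UNIV \<phi>' \<and>
     (\<forall>x. \<phi> (x + 2 * pi) = \<phi> x)"

definition weak_deriv :: "(real \<Rightarrow> real) \<Rightarrow> (real \<Rightarrow> real) \<Rightarrow> bool" where
  "weak_deriv u w \<longleftrightarrow>
     (\<forall>\<phi> \<phi>'. test_fun \<phi> \<phi>' \<longrightarrow>
        (\<integral>x. u x * \<phi>' x \<partial>I_meas) = - (\<integral>x. w x * \<phi> x \<partial>I_meas))"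

text \<open>The space \<open>H\<^sup>m(0,2\<pi>)\<close>, whose elements are represented by functions rather than by
  classes of functions modulo null sets.\<close>

primrec HI :: "nat \<Rightarrow> (real \<Rightarrow> real) set" where
  "HI 0 = L2 I_meas"
| "HI (Suc m) = {u \<in> L2 I_meas. \<exists>w \<in> HI m. weak_deriv u w}"

text \<open>A representative of the weak derivative; it is unique up to a null set, so integrals
  do not depend on the choice.\<close>

definition wd :: "(real \<Rightarrow> real) \<Rightarrow> real \<Rightarrow> real" where
  "wd u = (SOME w. w \<in> L2 I_meas \<and> weak_deriv u w)"

definition test_fun2 ::
  "(real \<times> real \<Rightarrow> real) \<Rightarrow> (real \<times> real \<Rightarrow> real) \<Rightarrow> (real \<times> real \<Rightarrow> real) \<Rightarrow> bool" where
  "test_fun2 \<phi> \<phi>x \<phi>y \<longleftrightarrow>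
     (\<forall>x y. ((\<lambda>s. \<phi> (s, y)) has_real_derivative \<phi>x (x, y)) (at x)) \<and>
     (\<forall>x y. ((\<lambda>t. \<phi> (x, t)) has_real_derivative \<phi>y (x, y)) (at y)) \<and>
     continuous_on UNIV \<phi>x \<and> continuous_on UNIV \<phi>y \<and>
     (\<forall>x y. \<phi> (x + 2 * pi, y) = \<phi> (x, y)) \<and> (\<forall>x y. \<phi> (x, y + 2 * pi) = \<phi> (x, y))"

definition weak_dx :: "(real \<times> real \<Rightarrow> real) \<Rightarrow> (real \<times> real \<Rightarrow> real) \<Rightarrow> bool" where
  "weak_dx v w \<longleftrightarrow>
     (\<forall>\<phi> \<phi>x \<phi>y. test_fun2 \<phi> \<phi>x \<phi>y \<longrightarrow>
        (\<integral>z. v z * \<phi>x z \<partial>D_meas) = - (\<integral>z. w z * \<phi> z \<partial>D_meas))"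

definition weak_dy :: "(real \<times> real \<Rightarrow> real) \<Rightarrow> (real \<times> real \<Rightarrow> real) \<Rightarrow> bool" where
  "weak_dy v w \<longleftrightarrow>
     (\<forall>\<phi> \<phi>x \<phi>y. test_fun2 \<phi> \<phi>x \<phi>y \<longrightarrow>
        (\<integral>z. v z * \<phi>y z \<partial>D_meas) = - (\<integral>z. w z * \<phi> z \<partial>D_meas))"

primrec HD :: "nat \<Rightarrow> (real \<times> real \<Rightarrow> real) set" where
  "HD 0 = L2 D_meas"
| "HD (Suc m) = {v \<in> L2 D_meas. (\<exists>w \<in> HD m. weak_dx v w) \<and> (\<exists>w \<in> HD m. weak_dy v w)}"

definition wdx :: "(real \<times> real \<Rightarrow> real) \<Rightarrow> real \<times> real \<Rightarrow> real" where
  "wdx v = (SOME w. w \<in> L2 D_meas \<and> weak_dx v w)"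


section \<open>Steady states\<close>

text \<open>Transverse: \<open>B\<^sub>0 = (0, 0, B\<^sub>0(x))\<close>.  Parallel (to gravity): \<open>B\<^sub>0 = (B\<^sub>0, 0, 0)\<close>, constant.\<close>

datatype mhd_type =
  Incompressible_Transverse | Compressible_Transverse |
  Incompressible_Parallel | Compressible_Parallel

definition compressible :: "mhd_type \<Rightarrow> bool" where
  "compressible \<tau> \<longleftrightarrow> \<tau> \<in> {Compressible_Transverse, Compressible_Parallel}"

definition parallel :: "mhd_type \<Rightarrow> bool" where
  "parallel \<tau> \<longleftrightarrow> \<tau> \<in> {Incompressible_Parallel, Compressible_Parallel}"

text \<open>Density \<open>\<rho>\<^sub>0\<close>, the scalar component \<open>B\<^sub>0\<close> of the magnetic field, pressure \<open>p\<^sub>0\<close>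
  (only their values on \<open>[0,2\<pi>]\<close> matter), gravity \<open>g\<close> and adiabatic index \<open>\<gamma>\<close>
  (only used in the compressible types).\<close>

record mhd_state =
  rho :: "real \<Rightarrow> real"
  bmag :: "real \<Rightarrow> real"
  press :: "real \<Rightarrow> real"
  grav :: real
  adiab :: real

definition magnetic_field :: "mhd_type \<Rightarrow> mhd_state \<Rightarrow> real \<Rightarrow> real ^ 3" where
  "magnetic_field \<tau> S x =
     (if parallel \<tau> then vector [bmag S x, 0, 0] else vector [0, 0, bmag S x])"

text \<open>Smoothness up to the end points, with one-sided derivatives there.  The steady state
  itself is not required to be periodic.\<close>

definition smooth_on_I :: "(real \<Rightarrow> real) \<Rightarrow> bool" where
  "smooth_on_I f \<longleftrightarrow>
     (\<exists>d :: nat \<Rightarrow> real \<Rightarrow> real. d 0 = f \<and>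
        (\<forall>n. \<forall>x \<in> {0..2 * pi}.
           (d n has_real_derivative d (Suc n) x) (at x within {0..2 * pi})))"

definition steady_state :: "mhd_type \<Rightarrow> mhd_state \<Rightarrow> bool" where
  "steady_state \<tau> S \<longleftrightarrow>
     smooth_on_I (rho S) \<and>
     (\<exists>c > 0. \<forall>x \<in> {0..2 * pi}. c \<le> rho S x) \<and>
     (\<forall>x \<in> {0..2 * pi}.
        ((\<lambda>x. press S x + (norm (magnetic_field \<tau> S x))\<^sup>2 / 2)
           has_real_derivative rho S x * grav S) (at x within {0..2 * pi})) \<and>
     (parallel \<tau> \<longrightarrow> (\<exists>b. \<forall>x \<in> {0..2 * pi}. bmag S x = b)) \<and>
     (compressible \<tau> \<longrightarrow>
        adiab S > 0 \<and> (\<exists>C > 0. \<forall>x \<in> {0..2 * pi}. press S x = C * rho S x powr adiab S))"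

definition rho_x :: "mhd_state \<Rightarrow> real \<Rightarrow> real" where
  "rho_x S x = vector_derivative (rho S) (at x within {0..2 * pi})"


section \<open>The variational problems\<close>

fun kappa :: "mhd_type \<Rightarrow> nat" where
  "kappa Incompressible_Transverse = 1"
| "kappa Compressible_Transverse = 1"
| "kappa Incompressible_Parallel = 2"
| "kappa Compressible_Parallel = 2"

fun F_fun :: "mhd_type \<Rightarrow> mhd_state \<Rightarrow> real \<Rightarrow> real \<Rightarrow> real" where
  "F_fun Incompressible_Transverse S x w = 0"
| "F_fun Compressible_Transverse S x w = 0"
| "F_fun Incompressible_Parallel S x w = (bmag S x)\<^sup>2 * w\<^sup>2"
| "F_fun Compressible_Parallel S x w = (bmag S x)\<^sup>2 * w\<^sup>2"

definition stiffness :: "mhd_state \<Rightarrow> real \<Rightarrow> real" where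
  "stiffness S x = adiab S * press S x + (bmag S x)\<^sup>2"

text \<open>The arguments \<open>u1\<close>, \<open>u1x\<close>, \<open>u2\<close> stand for the values at \<open>x\<close> of the functions and of the
  derivative.  There is no \<open>G\<^sub>k\<close> in the incompressible types; \<open>G_fun\<close> is never used there.\<close>

fun G_fun :: "mhd_type \<Rightarrow> mhd_state \<Rightarrow> nat \<Rightarrow> real \<Rightarrow> real \<Rightarrow> real \<Rightarrow> real \<Rightarrow> real" where
  "G_fun Compressible_Transverse S k x u1 u1x u2 =
     stiffness S x * (u1x + real k * u2 + grav S * rho S x / stiffness S x * u1)\<^sup>2"
| "G_fun Compressible_Parallel S k x u1 u1x u2 =
     stiffness S x *
       (adiab S * press S x / stiffness S x * u1x
          + grav S * rho S x * u1 / stiffness S x + real k * u2)\<^sup>2"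
| "G_fun Incompressible_Transverse S k x u1 u1x u2 = 0"
| "G_fun Incompressible_Parallel S k x u1 u1x u2 = 0"

fun H_fun :: "mhd_type \<Rightarrow> mhd_state \<Rightarrow> real \<Rightarrow> real \<Rightarrow> real \<Rightarrow> real" where
  "H_fun Incompressible_Transverse S x u ux = - grav S * rho_x S x * u\<^sup>2"
| "H_fun Compressible_Transverse S x u ux =
     ((grav S)\<^sup>2 * (rho S x)\<^sup>2 / stiffness S x - grav S * rho_x S x) * u\<^sup>2"
| "H_fun Incompressible_Parallel S x u ux =
     - grav S * rho_x S x * u\<^sup>2 - (bmag S x)\<^sup>2 * ux\<^sup>2"
| "H_fun Compressible_Parallel S x u ux =
     1 / stiffness S x * (grav S * rho S x * u - (bmag S x)\<^sup>2 * ux)\<^sup>2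
       - grav S * rho_x S x * u\<^sup>2 - (bmag S x)\<^sup>2 * ux\<^sup>2"

text \<open>\<open>\<Lambda>\<^sup>2\<close> and \<open>\<lambda>\<^sub>k\<^sup>2\<close> as real suprema; for steady states and \<open>k \<ge> 1\<close> the quotients are bounded
  above, since the coefficients are bounded, \<open>F\<close> and \<open>G\<^sub>k\<close> are nonnegative and the coefficient
  of \<open>u\<^sub>x\<^sup>2\<close> in \<open>H\<close> is at most zero (in the compressible parallel case it is
  \<open>- B\<^sub>0\<^sup>2 \<gamma> p\<^sub>0 / (\<gamma> p\<^sub>0 + B\<^sub>0\<^sup>2)\<close>, negative unless \<open>B\<^sub>0 = 0\<close>, when the term linear in \<open>u\<^sub>x\<close>
  vanishes as well).\<close>

definition Lambda_sq :: "mhd_type \<Rightarrow> mhd_state \<Rightarrow> real" where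
  "Lambda_sq \<tau> S =
     (SUP v \<in> {v \<in> HD (kappa \<tau> - 1). \<not> (AE z in D_meas. v z = 0)}.
        (\<integral>z. H_fun \<tau> S (fst z) (v z) (wdx v z) \<partial>D_meas) /
        (\<integral>z. rho S (fst z) * (v z)\<^sup>2 \<partial>D_meas))"

definition lambda_sq_incompressible :: "mhd_type \<Rightarrow> mhd_state \<Rightarrow> nat \<Rightarrow> real" where
  "lambda_sq_incompressible \<tau> S k =
     (SUP u \<in> {u \<in> HI (kappa \<tau>). \<not> (AE x in I_meas. u x = 0)}.
        (\<integral>x. - F_fun \<tau> S x (- (wd (wd u) x / real k)) + H_fun \<tau> S x (u x) (wd u x) \<partial>I_meas) /
        (\<integral>x. rho S x * ((u x)\<^sup>2 + (wd u x)\<^sup>2 / (real k)\<^sup>2) \<partial>I_meas))"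

definition lambda_sq_compressible :: "mhd_type \<Rightarrow> mhd_state \<Rightarrow> nat \<Rightarrow> real" where
  "lambda_sq_compressible \<tau> S k =
     (SUP (u1, u2) \<in> {(u1, u2). u1 \<in> HI (kappa \<tau>) \<and> u2 \<in> HI (kappa \<tau> - 1) \<and>
                        \<not> (AE x in I_meas. u1 x = 0 \<and> u2 x = 0)}.
        (\<integral>x. - F_fun \<tau> S x (wd u2 x) - G_fun \<tau> S k x (u1 x) (wd u1 x) (u2 x)
              + H_fun \<tau> S x (u1 x) (wd u1 x) \<partial>I_meas) /
        (\<integral>x. rho S x * ((u1 x)\<^sup>2 + (u2 x)\<^sup>2) \<partial>I_meas))"

definition lambda_sq :: "mhd_type \<Rightarrow> mhd_state \<Rightarrow> nat \<Rightarrow> real" where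
  "lambda_sq \<tau> S k =
     (if compressible \<tau> then lambda_sq_compressible \<tau> S k else lambda_sq_incompressible \<tau> S k)"

end

theory Submission
  imports Defs
begin

text \<open>
Neither \<open>H\<close> nor \<open>\<rho>\<^sub>0\<close> depends on \<open>y\<close>, so the supremum over the square equals the supremum of
\<open>\<integral>H(u,u\<^sub>x) / \<integral>\<rho>\<^sub>0u\<^sup>2\<close> over functions of \<open>x\<close> alone.  A function of \<open>x\<close> is a competitor on the square
(\<open>form_le_Lam\<close>); conversely a competitor on the square that beats \<open>\<Lambda>\<^sup>2 - \<epsilon>\<close> must do so on the line
through some \<open>y\<close>, by Fubini, and density of \<open>H\<^sup>\<kappa>\<close> in \<open>H\<^bsup>\<kappa>-1\<^esup>\<close> makes its restriction smoother
(\<open>near_maximiser\<close>).  It remains to compare this one-dimensional quotient with the one for \<open>\<lambda>\<^sub>k\<^sup>2\<close>,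
which differs by the nonnegative terms \<open>F\<close> and \<open>G\<^sub>k\<close> in the numerator and by additional mass in
the denominator.

\<^bold>\<open>Lower bound.\<close>  Fix a near-maximiser \<open>u\<close> in \<open>H\<^sup>\<kappa>\<close>.  In the incompressible types all additional terms
are \<open>O(k\<^bsup>-2\<^esup>)\<close>.  In the compressible types \<open>u\<^sub>2\<close> is at our disposal.  Making \<open>G\<^sub>k\<close> vanish would need
\<open>k u\<^sub>2 = - (\<alpha> u\<^sub>x + \<beta> u)\<close>, which in the parallel type need not be in \<open>H\<^sup>1\<close>,
because the coefficients need not be periodic.  But
\<open>k u\<^sub>2 = - s\<close> with \<open>s\<close> in \<open>H\<^sup>1\<close> close in \<open>L\<^sup>2\<close> to \<open>\<alpha> u\<^sub>x + \<beta> u\<close> makes \<open>\<integral>G\<^sub>k\<close> small uniformly in \<open>k\<close>, while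
\<open>\<integral>F\<close> and the mass of \<open>u\<^sub>2\<close> are again \<open>O(k\<^bsup>-2\<^esup>)\<close>.

\<^bold>\<open>Upper bound.\<close>  The numerator is at most \<open>\<Lambda>\<^sup>2 \<integral>\<rho>\<^sub>0u\<^sup>2\<close>.  If \<open>\<Lambda>\<^sup>2 \<ge> 0\<close>, more mass in the denominator
only helps.  If \<open>\<Lambda>\<^sup>2 < 0\<close>, it hurts, and has to be absorbed: the additional mass is at most
\<open>C k\<^bsup>-2\<^esup> (\<integral>\<rho>\<^sub>0u\<^sup>2 + \<integral>u\<^sub>x\<^sup>2 + \<integral>G\<^sub>k)\<close>, and where \<open>H \<le> K \<rho>\<^sub>0u\<^sup>2 - c\<^sub>1u\<^sub>x\<^sup>2\<close> with \<open>c\<^sub>1 > 0\<close> a small multiple of this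
second bound pays for it (\<open>quotient_deficit\<close>).  Such a \<open>c\<^sub>1\<close> exists exactly where the magnetic field is
parallel to gravity and does not vanish.  In the compressible parallel type the hydrostatic balance gives
\<open>g\<rho>\<^sub>0\<^sub>x = g\<^sup>2\<rho>\<^sub>0\<^sup>2 / (\<gamma>p\<^sub>0)\<close>, and with it \<open>H\<close> becomes minus a square,
\<open>- B\<^sub>0\<^sup>2 (g\<rho>\<^sub>0u + \<gamma>p\<^sub>0u\<^sub>x)\<^sup>2 / ((\<gamma>p\<^sub>0 + B\<^sub>0\<^sup>2) \<gamma>p\<^sub>0)\<close>, which shows \<open>c\<^sub>1 > 0\<close> if \<open>B\<^sub>0 \<noteq> 0\<close> and \<open>\<Lambda>\<^sup>2 = 0\<close> if \<open>B\<^sub>0 = 0\<close>.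

\<^bold>\<open>Slices.\<close>  That a weak \<open>x\<close>-derivative on the square restricts to a weak derivative on almost every line
needs one null set of \<open>y\<close> for all test functions.  A countable family of test functions
suffices (\<open>weak_deriv_representation\<close>): it already forces \<open>u = c + \<integral>\<^sub>0\<^sup>x w\<close>, which is a weak
derivative against every test function by an integration by parts.
\<close>

section \<open>The interval and the square as measure spaces\<close>

lemma space_I [simp]: "space I_meas = {0..2 * pi}"
  by (simp add: I_meas_def space_restrict_space)

lemma measurable_I_of_borel: "f \<in> borel_measurable borel \<Longrightarrow> f \<in> borel_measurable I_meas"
  unfolding I_meas_def by (intro measurable_restrict_space1) simp

lemma ident_measurable_I [measurable]: "(\<lambda>x. x) \<in> borel_measurable I_meas"
  by (rule measurable_I_of_borel) simp

lemma continuous_measurable_I: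
  "continuous_on {0..2 * pi} f \<Longrightarrow> f \<in> borel_measurable I_meas" for f :: "real \<Rightarrow> real"
  using borel_measurable_continuous_on_restrict[of "{0..2 * pi}" f]
  by (simp add: I_meas_def cong: measurable_cong_sets sets_restrict_space_cong)

lemma finite_measure_I: "finite_measure I_meas"
  unfolding I_meas_def
  by (intro finite_measureI) (simp add: emeasure_restrict_space space_restrict_space)

interpretation I: finite_measure I_meas by (rule finite_measure_I)
interpretation II: pair_sigma_finite I_meas I_meas ..

lemma measure_I: "measure I_meas {0..2 * pi} = 2 * pi"
  unfolding I_meas_def by (subst measure_restrict_space) auto

lemma space_D [simp]: "space D_meas = {0..2 * pi} \<times> {0..2 * pi}"
  by (simp add: D_meas_def space_pair_measure)

lemma finite_measure_D: "finite_measure D_meas"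
  unfolding D_meas_def by (intro finite_measure_pair_measure I.finite_measure_axioms)

interpretation D: finite_measure D_meas by (rule finite_measure_D)

lemma fst_borel_D [measurable]: "fst \<in> borel_measurable D_meas"
  using measurable_compose[OF measurable_fst ident_measurable_I] unfolding D_meas_def by simp

lemma snd_borel_D [measurable]: "snd \<in> borel_measurable D_meas"
  using measurable_compose[OF measurable_snd ident_measurable_I] unfolding D_meas_def by simp

lemma measurable_D_fst: "f \<in> borel_measurable I_meas \<Longrightarrow> (\<lambda>z. f (fst z)) \<in> borel_measurable D_meas"
  unfolding D_meas_def by (rule measurable_compose[OF measurable_fst])

lemma measurable_D_snd: "f \<in> borel_measurable I_meas \<Longrightarrow> (\<lambda>z. f (snd z)) \<in> borel_measurable D_meas"
  unfolding D_meas_def by (rule measurable_compose[OF measurable_snd])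

lemma measurable_D_of_borel:
  fixes f :: "real \<times> real \<Rightarrow> real"
  assumes "f \<in> borel_measurable borel" shows "f \<in> borel_measurable D_meas"
proof -
  have "(\<lambda>z. (fst z, snd z)) \<in> borel_measurable D_meas" by (intro borel_measurable_Pair) auto
  then show ?thesis using measurable_compose[OF _ assms] by simp
qed

lemma AE_I_lborel: "(AE x in I_meas. P x) \<longleftrightarrow> (AE x in lborel. x \<in> {0..2 * pi} \<longrightarrow> P x)"
  unfolding I_meas_def by (rule AE_restrict_space_iff) simp

lemma integral_I_lborel:
  "(\<integral>x. f x \<partial>I_meas) = (\<integral>x. indicator {0..2 * pi} x * f x \<partial>lborel)" for f :: "real \<Rightarrow> real"
  unfolding I_meas_def by (subst integral_restrict_space) auto

section \<open>Bounded coefficients and square-integrable functions\<close>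

definition bdd_meas :: "'a measure \<Rightarrow> ('a \<Rightarrow> real) \<Rightarrow> bool" where
  "bdd_meas M e \<longleftrightarrow> e \<in> borel_measurable M \<and> (\<exists>C. \<forall>x \<in> space M. \<bar>e x\<bar> \<le> C)"

lemma bdd_measI: "e \<in> borel_measurable M \<Longrightarrow> (\<And>x. x \<in> space M \<Longrightarrow> \<bar>e x\<bar> \<le> C) \<Longrightarrow> bdd_meas M e"
  unfolding bdd_meas_def by blast

lemma bdd_meas_measurable: "bdd_meas M e \<Longrightarrow> e \<in> borel_measurable M"
  unfolding bdd_meas_def by blast

lemma bdd_measE: assumes "bdd_meas M e" obtains C where "0 < C" "\<And>x. x \<in> space M \<Longrightarrow> \<bar>e x\<bar> \<le> C"
proof -
  obtain C where "\<forall>x \<in> space M. \<bar>e x\<bar> \<le> C" using assms unfolding bdd_meas_def by blast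
  then have "0 < \<bar>C\<bar> + 1" "\<And>x. x \<in> space M \<Longrightarrow> \<bar>e x\<bar> \<le> \<bar>C\<bar> + 1" by fastforce+
  then show ?thesis using that by blast
qed

lemma bdd_meas_const: "bdd_meas M (\<lambda>_. k)" by (rule bdd_measI[of _ _ "\<bar>k\<bar>"]) auto

lemma bdd_meas_mult: assumes "bdd_meas M e" "bdd_meas M f" shows "bdd_meas M (\<lambda>x. e x * f x)"
proof -
  obtain C where C: "0 < C" "\<And>x. x \<in> space M \<Longrightarrow> \<bar>e x\<bar> \<le> C" using bdd_measE[OF assms(1)] by blast
  obtain C' where C': "0 < C'" "\<And>x. x \<in> space M \<Longrightarrow> \<bar>f x\<bar> \<le> C'" using bdd_measE[OF assms(2)] by blast
  have "\<bar>e x * f x\<bar> \<le> C * C'" if "x \<in> space M" for x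
    unfolding abs_mult using C C' that by (intro mult_mono) auto
  then show ?thesis using assms[THEN bdd_meas_measurable] by (intro bdd_measI) auto
qed

lemma bdd_meas_add: assumes "bdd_meas M e" "bdd_meas M f" shows "bdd_meas M (\<lambda>x. e x + f x)"
proof -
  obtain C where C: "0 < C" "\<And>x. x \<in> space M \<Longrightarrow> \<bar>e x\<bar> \<le> C" using bdd_measE[OF assms(1)] by blast
  obtain C' where C': "0 < C'" "\<And>x. x \<in> space M \<Longrightarrow> \<bar>f x\<bar> \<le> C'" using bdd_measE[OF assms(2)] by blast
  have "\<bar>e x + f x\<bar> \<le> C + C'" if "x \<in> space M" for x using C(2)[OF that] C'(2)[OF that] by linarith
  then show ?thesis using assms[THEN bdd_meas_measurable] by (intro bdd_measI) auto
qed

lemma bdd_meas_continuous: fixes f :: "real \<Rightarrow> real" assumes "continuous_on {0..2 * pi} f" shows "bdd_meas I_meas f"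
proof -
  have "bounded (f ` {0..2 * pi})"
    by (intro compact_imp_bounded compact_continuous_image assms) simp
  then obtain C where "\<forall>y \<in> f ` {0..2 * pi}. \<bar>y\<bar> \<le> C" unfolding bounded_iff by auto
  then show ?thesis by (intro bdd_measI[of _ _ C] continuous_measurable_I assms) auto
qed

lemma bdd_meas_fst: "bdd_meas I_meas e \<Longrightarrow> bdd_meas D_meas (\<lambda>z. e (fst z))"
  unfolding bdd_meas_def using measurable_D_fst by fastforce

lemma bdd_meas_snd: "bdd_meas I_meas e \<Longrightarrow> bdd_meas D_meas (\<lambda>z. e (snd z))"
  unfolding bdd_meas_def using measurable_D_snd by fastforce

lemma L2_meas: "u \<in> L2 M \<Longrightarrow> u \<in> borel_measurable M" by (simp add: L2_def)
lemma L2_sq: "u \<in> L2 M \<Longrightarrow> integrable M (\<lambda>x. (u x)\<^sup>2)" by (simp add: L2_def)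

lemma integrable_bdd_meas_mult:
  assumes e: "bdd_meas M e" and f: "integrable M f" shows "integrable M (\<lambda>x. e x * f x :: real)"
proof -
  obtain C where C: "0 < C" "\<And>x. x \<in> space M \<Longrightarrow> \<bar>e x\<bar> \<le> C" using bdd_measE[OF e] by blast
  have "integrable M (\<lambda>x. C * \<bar>f x\<bar>)" using f by auto
  then show ?thesis
    using C bdd_meas_measurable[OF e] borel_measurable_integrable[OF f]
    by (elim Bochner_Integration.integrable_bound) (auto simp: abs_mult intro!: mult_right_mono)
qed

lemma L2_mult: assumes "u \<in> L2 M" "w \<in> L2 M" shows "integrable M (\<lambda>x. u x * w x)"
proof -
  have "\<bar>u x * w x\<bar> \<le> (u x)\<^sup>2 + (w x)\<^sup>2" for x
  proof -
    have "0 \<le> \<bar>u x\<bar> * \<bar>w x\<bar>" by simp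
    then show ?thesis using sum_squares_bound[of "\<bar>u x\<bar>" "\<bar>w x\<bar>"] unfolding abs_mult power2_abs by linarith
  qed
  then show ?thesis using assms[THEN L2_meas]
    by (intro Bochner_Integration.integrable_bound[OF Bochner_Integration.integrable_add[OF assms[THEN L2_sq]]]) auto
qed

lemma L2_form: "bdd_meas M e \<Longrightarrow> u \<in> L2 M \<Longrightarrow> w \<in> L2 M \<Longrightarrow> integrable M (\<lambda>x. e x * (u x * w x))"
  by (intro integrable_bdd_meas_mult L2_mult)

lemma L2_add: assumes "u \<in> L2 M" "w \<in> L2 M" shows "(\<lambda>x. u x + w x) \<in> L2 M"
proof -
  have "integrable M (\<lambda>x. (u x)\<^sup>2 + (w x)\<^sup>2 + 2 * (u x * w x))"
    using assms by (intro Bochner_Integration.integrable_add L2_sq integrable_mult_right L2_mult)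
  moreover have "(\<lambda>x. (u x + w x)\<^sup>2) = (\<lambda>x. (u x)\<^sup>2 + (w x)\<^sup>2 + 2 * (u x * w x))"
    by (auto simp: power2_sum)
  ultimately show ?thesis using assms by (auto simp: L2_def)
qed

lemma L2_bdd_meas_mult: assumes "bdd_meas M e" "u \<in> L2 M" shows "(\<lambda>x. e x * u x) \<in> L2 M"
  using integrable_bdd_meas_mult[OF bdd_meas_mult[OF assms(1,1)] L2_sq[OF assms(2)]] bdd_meas_measurable[OF assms(1)]
    L2_meas[OF assms(2)]
  by (auto simp: L2_def power_mult_distrib power2_eq_square mult_ac)

lemma L2_cmult: "u \<in> L2 M \<Longrightarrow> (\<lambda>x. k * u x) \<in> L2 M" by (intro L2_bdd_meas_mult bdd_meas_const)

lemma L2_diff: assumes "u \<in> L2 M" "w \<in> L2 M" shows "(\<lambda>x. u x - w x) \<in> L2 M"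
  using L2_add[OF assms(1) L2_cmult[OF assms(2), of "-1"]] by simp

lemma bdd_meas_L2: assumes "finite_measure M" "bdd_meas M e" shows "e \<in> L2 M"
proof -
  interpret finite_measure M by fact
  have "integrable M (\<lambda>_. 1 :: real)" by simp
  from integrable_bdd_meas_mult[OF bdd_meas_mult[OF assms(2,2)] this]
  show ?thesis using bdd_meas_measurable[OF assms(2)] by (auto simp: L2_def power2_eq_square)
qed

lemmas bdd_meas_L2_I = bdd_meas_L2[OF finite_measure_I] and bdd_meas_L2_D = bdd_meas_L2[OF finite_measure_D]

lemma L2_integrable_I: "u \<in> L2 I_meas \<Longrightarrow> integrable I_meas u"
  using L2_mult[OF bdd_meas_L2_I[OF bdd_meas_const[of _ 1]]] by simp

lemma L2_integrable_D: "u \<in> L2 D_meas \<Longrightarrow> integrable D_meas u"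
  using L2_mult[OF bdd_meas_L2_D[OF bdd_meas_const[of _ 1]]] by simp

text \<open>
The quadratic polynomial \<open>t \<mapsto> \<integral>(t u - w)\<^sup>2\<close> is nonnegative, so its discriminant is not positive.
\<close>

lemma Cauchy_Schwarz_integral:
  assumes u: "u \<in> L2 M" and w: "w \<in> L2 M"
  shows "(\<integral>x. u x * w x \<partial>M)\<^sup>2 \<le> (\<integral>x. (u x)\<^sup>2 \<partial>M) * (\<integral>x. (w x)\<^sup>2 \<partial>M)"
proof -
  define A B J where "A = (\<integral>x. (u x)\<^sup>2 \<partial>M)" and "B = (\<integral>x. (w x)\<^sup>2 \<partial>M)" and "J = (\<integral>x. u x * w x \<partial>M)"
  have quad: "0 \<le> t\<^sup>2 * A - 2 * t * J + B" for t
  proof -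
    have "0 \<le> (\<integral>x. (t * u x - w x)\<^sup>2 \<partial>M)" by simp
    also have "\<dots> = (\<integral>x. t\<^sup>2 * (u x)\<^sup>2 - 2 * t * (u x * w x) + (w x)\<^sup>2 \<partial>M)"
      by (intro Bochner_Integration.integral_cong) (auto simp: power2_eq_square algebra_simps)
    also have "\<dots> = t\<^sup>2 * A - 2 * t * J + B"
      using L2_sq[OF u] L2_sq[OF w] L2_mult[OF u w] by (simp add: A_def B_def J_def)
    finally show ?thesis .
  qed
  have "0 \<le> A" unfolding A_def by simp
  have "J\<^sup>2 \<le> A * B"
  proof (cases "A = 0")
    case True
    have "J = 0"
    proof (rule ccontr)
      assume "J \<noteq> 0" then show False using quad[of "(B + 1) / (2 * J)"] True by (simp add: field_simps)
    qed
    then show ?thesis using True by simp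
  next
    case False
    then have "0 \<le> A * ((J / A)\<^sup>2 * A - 2 * (J / A) * J + B)"
      using quad[of "J / A"] \<open>0 \<le> A\<close> by (intro mult_nonneg_nonneg) auto
    also have "\<dots> = A * B - J\<^sup>2" using False by (simp add: field_simps power2_eq_square)
    finally show ?thesis by simp
  qed
  then show ?thesis by (simp add: A_def B_def J_def)
qed

definition L2_lim :: "'a measure \<Rightarrow> (nat \<Rightarrow> 'a \<Rightarrow> real) \<Rightarrow> ('a \<Rightarrow> real) \<Rightarrow> bool" where
  "L2_lim M f g \<longleftrightarrow> (\<lambda>n. \<integral>x. (f n x - g x)\<^sup>2 \<partial>M) \<longlonglongrightarrow> 0"

lemma L2_null_mult:
  assumes h: "\<And>n. h n \<in> L2 M" and k: "\<And>n. k n \<in> L2 M"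
    and "(\<lambda>n. \<integral>x. (h n x)\<^sup>2 \<partial>M) \<longlonglongrightarrow> 0" and "(\<lambda>n. \<integral>x. (k n x)\<^sup>2 \<partial>M) \<longlonglongrightarrow> l"
  shows "(\<lambda>n. \<integral>x. h n x * k n x \<partial>M) \<longlonglongrightarrow> 0"
proof -
  have "(\<lambda>n. (\<integral>x. (h n x)\<^sup>2 \<partial>M) * (\<integral>x. (k n x)\<^sup>2 \<partial>M)) \<longlonglongrightarrow> 0"
    using tendsto_mult[OF assms(3,4)] by simp
  then have "(\<lambda>n. (\<integral>x. h n x * k n x \<partial>M)\<^sup>2) \<longlonglongrightarrow> 0"
  proof (rule tendsto_sandwich[OF _ _ tendsto_const, rotated 2])
    show "\<forall>\<^sub>F n in sequentially. (\<integral>x. h n x * k n x \<partial>M)\<^sup>2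
        \<le> (\<integral>x. (h n x)\<^sup>2 \<partial>M) * (\<integral>x. (k n x)\<^sup>2 \<partial>M)"
      using Cauchy_Schwarz_integral[OF h k] by simp
  qed simp_all
  from tendsto_real_sqrt[OF this] show ?thesis by (simp add: tendsto_rabs_zero_iff)
qed

text \<open>
Quadratic forms with bounded coefficients are continuous on \<open>L\<^sup>2\<close>.  This carries all later passages
from rough to smooth competitors.
\<close>

lemma L2_lim_form:
  assumes e: "bdd_meas M e" and f: "\<And>n. f n \<in> L2 M" and g: "\<And>n. g n \<in> L2 M"
    and f0: "f0 \<in> L2 M" and g0: "g0 \<in> L2 M" and "L2_lim M f f0" "L2_lim M g g0"
  shows "(\<lambda>n. \<integral>x. e x * (f n x * g n x) \<partial>M) \<longlonglongrightarrow> (\<integral>x. e x * (f0 x * g0 x) \<partial>M)"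
proof -
  note d = L2_diff[OF f f0] L2_diff[OF g g0]
  have e2: "u \<in> L2 M \<Longrightarrow> (\<lambda>x. e x * u x) \<in> L2 M" for u using L2_bdd_meas_mult[OF e] .
  obtain C where C: "0 < C" "\<And>x. x \<in> space M \<Longrightarrow> \<bar>e x\<bar> \<le> C" using bdd_measE[OF e] by blast
  have "(\<lambda>n. \<integral>x. (e x * (g n x - g0 x))\<^sup>2 \<partial>M) \<longlonglongrightarrow> 0"
  proof (rule tendsto_sandwich[OF _ _ tendsto_const])
    show "(\<lambda>n. C\<^sup>2 * (\<integral>x. (g n x - g0 x)\<^sup>2 \<partial>M)) \<longlonglongrightarrow> 0"
      using tendsto_mult_right_zero assms(7) unfolding L2_lim_def by blast
    show "\<forall>\<^sub>F n in sequentially. (\<integral>x. (e x * (g n x - g0 x))\<^sup>2 \<partial>M) \<le> C\<^sup>2 * (\<integral>x. (g n x - g0 x)\<^sup>2 \<partial>M)"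
    proof (intro always_eventually allI)
      fix n
      have "(\<integral>x. (e x * (g n x - g0 x))\<^sup>2 \<partial>M) \<le> (\<integral>x. C\<^sup>2 * (g n x - g0 x)\<^sup>2 \<partial>M)"
      proof (intro integral_mono L2_sq e2 d integrable_mult_right)
        fix x assume "x \<in> space M"
        then have "(e x)\<^sup>2 \<le> C\<^sup>2" using C by (simp add: abs_le_square_iff[symmetric])
        then show "(e x * (g n x - g0 x))\<^sup>2 \<le> C\<^sup>2 * (g n x - g0 x)\<^sup>2"
          unfolding power_mult_distrib by (intro mult_right_mono) auto
      qed
      then show "(\<integral>x. (e x * (g n x - g0 x))\<^sup>2 \<partial>M) \<le> C\<^sup>2 * (\<integral>x. (g n x - g0 x)\<^sup>2 \<partial>M)" by simp
    qed
  qed auto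
  note eg = this
  have f': "(\<lambda>n. \<integral>x. (f n x - f0 x)\<^sup>2 \<partial>M) \<longlonglongrightarrow> 0" using assms(6) unfolding L2_lim_def .
  have 1: "(\<lambda>n. \<integral>x. (e x * (g n x - g0 x)) * (f n x - f0 x) \<partial>M) \<longlonglongrightarrow> 0"
    by (rule L2_null_mult[OF e2[OF d(2)] d(1) eg f'])
  have 2: "(\<lambda>n. \<integral>x. (e x * (g n x - g0 x)) * f0 x \<partial>M) \<longlonglongrightarrow> 0"
    by (rule L2_null_mult[OF e2[OF d(2)] f0 eg tendsto_const])
  have 3: "(\<lambda>n. \<integral>x. (f n x - f0 x) * (e x * g0 x) \<partial>M) \<longlonglongrightarrow> 0"
    by (rule L2_null_mult[OF d(1) e2[OF g0] f' tendsto_const])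
  have "(\<integral>x. e x * (f n x * g n x) \<partial>M) = (\<integral>x. (e x * (g n x - g0 x)) * (f n x - f0 x) \<partial>M)
    + (\<integral>x. (e x * (g n x - g0 x)) * f0 x \<partial>M) + (\<integral>x. (f n x - f0 x) * (e x * g0 x) \<partial>M)
    + (\<integral>x. e x * (f0 x * g0 x) \<partial>M)" (is "_ = ?r") for n
  proof -
    have "(\<integral>x. e x * (f n x * g n x) \<partial>M) = (\<integral>x. ((e x * (g n x - g0 x)) * (f n x - f0 x)
      + (e x * (g n x - g0 x)) * f0 x) + (f n x - f0 x) * (e x * g0 x) + e x * (f0 x * g0 x) \<partial>M)"
      by (intro Bochner_Integration.integral_cong) (auto simp: algebra_simps)
    also have "\<dots> = ?r"
    proof -
      note i = L2_mult[OF e2[OF d(2)] d(1)] L2_mult[OF e2[OF d(2)] f0] L2_mult[OF d(1) e2[OF g0]]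
        L2_form[OF e f0 g0]
      show ?thesis
        unfolding Bochner_Integration.integral_add[OF Bochner_Integration.integrable_add[OF
            Bochner_Integration.integrable_add[OF i(1,2)] i(3)] i(4)]
          Bochner_Integration.integral_add[OF Bochner_Integration.integrable_add[OF i(1,2)] i(3)]
          Bochner_Integration.integral_add[OF i(1,2)] ..
    qed
    finally show ?thesis .
  qed
  then show ?thesis using tendsto_add[OF tendsto_add[OF tendsto_add[OF 1 2] 3] tendsto_const] by simp
qed

section \<open>Integration by parts for indefinite integrals\<close>

lemma FTC_I:
  fixes f f' :: "real \<Rightarrow> real"
  assumes "\<And>x. x \<in> {0..2 * pi} \<Longrightarrow> (f has_real_derivative f' x) (at x within {0..2 * pi})"
    and "continuous_on {0..2 * pi} f'"
  shows "(\<integral>x. f' x \<partial>I_meas) = f (2 * pi) - f 0"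
  unfolding integral_I_lborel
  using integral_FTC_Icc[of 0 "2 * pi" f f'] assms
  by (simp add: has_real_derivative_iff_has_vector_derivative)

text \<open>
The inner integral when the order of integration is exchanged in \<open>prim_by_parts\<close>.
\<close>

lemma FTC_I_tail:
  fixes f f' :: "real \<Rightarrow> real"
  assumes d: "\<And>x. x \<in> {0..2 * pi} \<Longrightarrow> (f has_real_derivative f' x) (at x within {0..2 * pi})"
    and c: "continuous_on {0..2 * pi} f'" and s: "s \<in> {0..2 * pi}"
  shows "(\<integral>x. (if s < x then f' x else 0) \<partial>I_meas) = f (2 * pi) - f s"
proof -
  have "AE x in lborel. x \<noteq> s" by (rule AE_lborel_singleton)
  then have "(\<integral>x. (if s < x then f' x else 0) \<partial>I_meas) = (\<integral>x. indicator {s..2 * pi} x *\<^sub>R f' x \<partial>lborel)"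
    unfolding integral_I_lborel using s
  proof (intro integral_cong_AE)
    have "f' \<in> borel_measurable I_meas" by (rule continuous_measurable_I[OF c])
    then have 1: "(\<lambda>x. indicator {0..2 * pi} x *\<^sub>R f' x) \<in> borel_measurable lborel"
      unfolding I_meas_def by (subst (asm) borel_measurable_restrict_space_iff) auto
    show "(\<lambda>x. indicator {0..2 * pi} x * (if s < x then f' x else 0)) \<in> borel_measurable lborel"
      using borel_measurable_times[OF 1, of "indicator {s<..}"]
      by (auto simp: indicator_def if_distrib cong: if_cong elim!: measurable_cong[THEN iffD1, rotated])
    show "(\<lambda>x. indicator {s..2 * pi} x *\<^sub>R f' x) \<in> borel_measurable lborel"
      using borel_measurable_times[OF 1, of "indicator {s..2 * pi}"] s
      by (auto simp: indicator_def elim!: measurable_cong[THEN iffD1, rotated])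
  qed (auto simp: indicator_def elim!: eventually_mono)
  also have "\<dots> = f (2 * pi) - f s"
    using s d c
    by (intro integral_FTC_Icc)
       (auto simp flip: has_real_derivative_iff_has_vector_derivative
          intro: has_field_derivative_subset[OF d] continuous_on_subset)
  finally show ?thesis .
qed

definition prim :: "(real \<Rightarrow> real) \<Rightarrow> real \<Rightarrow> real" where
  "prim w x = (\<integral>s. (if s < x then w s else 0) \<partial>I_meas)"

lemma integrable_cut_I: "integrable I_meas w \<Longrightarrow> integrable I_meas (\<lambda>s. if s < x then w s else 0)"
  for w :: "real \<Rightarrow> real"
proof -
  assume w: "integrable I_meas w"
  have [measurable]: "w \<in> borel_measurable I_meas" using w by auto
  show ?thesis by (rule Bochner_Integration.integrable_bound[OF w]) auto
qed

lemma prim_bound: assumes w: "integrable I_meas w" shows "\<bar>prim w x\<bar> \<le> (\<integral>s. \<bar>w s\<bar> \<partial>I_meas)"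
proof -
  have "\<bar>prim w x\<bar> \<le> (\<integral>s. \<bar>if s < x then w s else 0\<bar> \<partial>I_meas)"
    unfolding prim_def by (rule integral_abs_bound)
  also have "\<dots> \<le> (\<integral>s. \<bar>w s\<bar> \<partial>I_meas)"
    by (intro integral_mono integrable_abs integrable_cut_I w) auto
  finally show ?thesis .
qed

lemma prim_measurable: assumes w: "integrable I_meas w" shows "prim w \<in> borel_measurable I_meas"
proof -
  have [measurable]: "w \<in> borel_measurable I_meas" using w by auto
  have "(\<lambda>(x, s). if s < x then w s else 0) \<in> borel_measurable (I_meas \<Otimes>\<^sub>M I_meas)" by measurable
  from I.borel_measurable_lebesgue_integral[OF this] show ?thesis unfolding prim_def .
qed

lemma bdd_meas_prim: "integrable I_meas w \<Longrightarrow> bdd_meas I_meas (prim w)"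
  by (rule bdd_measI[OF prim_measurable prim_bound])

lemma prim_diff: "integrable I_meas w \<Longrightarrow> integrable I_meas v \<Longrightarrow>
  prim (\<lambda>x. w x - v x) x = prim w x - prim v x"
  unfolding prim_def
  by (subst Bochner_Integration.integral_diff[symmetric])
     (auto intro!: integrable_cut_I Bochner_Integration.integral_cong)

text \<open>
An indefinite integral of an integrable function is in general not differentiable, so the formula comes from
Fubini on the triangle \<open>s < x\<close> instead of the product rule.
\<close>

lemma prim_by_parts:
  fixes \<phi> \<phi>' :: "real \<Rightarrow> real"
  assumes w: "integrable I_meas w"
    and d: "\<And>x. x \<in> {0..2 * pi} \<Longrightarrow> (\<phi> has_real_derivative \<phi>' x) (at x within {0..2 * pi})"
    and c: "continuous_on {0..2 * pi} \<phi>'"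
  shows "(\<integral>x. prim w x * \<phi>' x \<partial>I_meas) = \<phi> (2 * pi) * (\<integral>s. w s \<partial>I_meas) - (\<integral>s. w s * \<phi> s \<partial>I_meas)"
proof -
  have [measurable]: "w \<in> borel_measurable I_meas" "\<phi>' \<in> borel_measurable I_meas"
    using w continuous_measurable_I[OF c] by auto
  have B: "bdd_meas I_meas \<phi>'" by (rule bdd_meas_continuous[OF c])
  have Bf: "bdd_meas I_meas \<phi>"
    by (rule bdd_meas_continuous[OF DERIV_continuous_on[OF d]])
  let ?F = "\<lambda>x s. (if s < x then w s else 0) * \<phi>' x"
  have int: "integrable (I_meas \<Otimes>\<^sub>M I_meas) (\<lambda>(x, s). ?F x s)"
  proof (rule II.Fubini_integrable)
    show "(\<lambda>(x, s). ?F x s) \<in> borel_measurable (I_meas \<Otimes>\<^sub>M I_meas)" by measurable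
    show "AE x in I_meas. integrable I_meas (\<lambda>s. case (x, s) of (x, s) \<Rightarrow> ?F x s)"
      using integrable_cut_I[OF w] by auto
    have "(\<integral>s. norm (?F x s) \<partial>I_meas) = prim (\<lambda>s. \<bar>w s\<bar>) x * \<bar>\<phi>' x\<bar>" for x
      unfolding prim_def by (subst integral_mult_left_zero[symmetric])
        (auto simp: abs_mult intro!: Bochner_Integration.integral_cong)
    moreover have "bdd_meas I_meas (\<lambda>x. \<bar>\<phi>' x\<bar>)" using B unfolding bdd_meas_def by auto
    ultimately show "integrable I_meas (\<lambda>x. \<integral>s. norm (case (x, s) of (x, s) \<Rightarrow> ?F x s) \<partial>I_meas)"
      using bdd_meas_mult[OF bdd_meas_prim[OF integrable_abs[OF w]]] L2_integrable_I[OF bdd_meas_L2_I] by auto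
  qed
  have "(\<integral>x. prim w x * \<phi>' x \<partial>I_meas) = (\<integral>x. (\<integral>s. ?F x s \<partial>I_meas) \<partial>I_meas)"
    unfolding prim_def by simp
  also have "\<dots> = (\<integral>s. (\<integral>x. ?F x s \<partial>I_meas) \<partial>I_meas)"
    using II.Fubini_integral[OF int] by simp
  also have "\<dots> = (\<integral>s. w s * (\<phi> (2 * pi) - \<phi> s) \<partial>I_meas)"
  proof (intro Bochner_Integration.integral_cong refl)
    fix s assume "s \<in> space I_meas"
    have "(\<integral>x. ?F x s \<partial>I_meas) = (\<integral>x. w s * (if s < x then \<phi>' x else 0) \<partial>I_meas)"
      by (intro Bochner_Integration.integral_cong) auto
    also have "\<dots> = w s * (\<phi> (2 * pi) - \<phi> s)"
      using FTC_I_tail[OF d c, of s] \<open>s \<in> space I_meas\<close> by simp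
    finally show "(\<integral>x. ?F x s \<partial>I_meas) = w s * (\<phi> (2 * pi) - \<phi> s)" .
  qed
  also have "\<dots> = \<phi> (2 * pi) * (\<integral>s. w s \<partial>I_meas) - (\<integral>s. w s * \<phi> s \<partial>I_meas)"
    using w integrable_bdd_meas_mult[OF Bf w] by (simp add: right_diff_distrib mult.commute)
  finally show ?thesis .
qed

lemma test_fun_within:
  assumes "test_fun \<phi> \<phi>'"
  shows "x \<in> {0..2 * pi} \<Longrightarrow> (\<phi> has_real_derivative \<phi>' x) (at x within {0..2 * pi})"
    and "continuous_on {0..2 * pi} \<phi>'" "continuous_on {0..2 * pi} \<phi>" "\<phi> (2 * pi) = \<phi> 0"
proof -
  have D: "\<And>x. (\<phi> has_real_derivative \<phi>' x) (at x)" and c: "continuous_on UNIV \<phi>'"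
    and p: "\<phi> (0 + 2 * pi) = \<phi> 0"
    using assms unfolding test_fun_def by blast+
  show "x \<in> {0..2 * pi} \<Longrightarrow> (\<phi> has_real_derivative \<phi>' x) (at x within {0..2 * pi})"
    using D has_field_derivative_at_within by blast
  show "continuous_on {0..2 * pi} \<phi>'" using c continuous_on_subset by blast
  show "continuous_on {0..2 * pi} \<phi>" using D DERIV_continuous_on has_field_derivative_at_within by metis
  show "\<phi> (2 * pi) = \<phi> 0" using p by simp
qed

lemma test_fun_bdd_meas: assumes "test_fun \<phi> \<phi>'" shows "bdd_meas I_meas \<phi>" "bdd_meas I_meas \<phi>'"
  using test_fun_within[OF assms] bdd_meas_continuous by auto

lemma weak_deriv_prim:
  assumes w: "integrable I_meas w" and "(\<integral>x. w x \<partial>I_meas) = 0"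
  shows "weak_deriv (\<lambda>x. c + prim w x) w"
  unfolding weak_deriv_def
proof (intro allI impI)
  fix \<phi> \<phi>' assume t: "test_fun \<phi> \<phi>'"
  have "integrable I_meas (\<lambda>x. prim w x * \<phi>' x)"
    using L2_integrable_I[OF bdd_meas_L2_I[OF bdd_meas_mult[OF bdd_meas_prim[OF w] test_fun_bdd_meas(2)[OF t]]]] .
  moreover have "integrable I_meas \<phi>'"
    using L2_integrable_I[OF bdd_meas_L2_I[OF test_fun_bdd_meas(2)[OF t]]] .
  ultimately have "(\<integral>x. (c + prim w x) * \<phi>' x \<partial>I_meas)
      = c * (\<integral>x. \<phi>' x \<partial>I_meas) + (\<integral>x. prim w x * \<phi>' x \<partial>I_meas)"
    by (simp add: distrib_right)
  also have "\<dots> = - (\<integral>x. w x * \<phi> x \<partial>I_meas)"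
    using FTC_I[OF test_fun_within(1,2)[OF t]] prim_by_parts[OF w test_fun_within(1,2)[OF t]]
      test_fun_within(4)[OF t] assms(2) by simp
  finally show "(\<integral>x. (c + prim w x) * \<phi>' x \<partial>I_meas) = - (\<integral>x. w x * \<phi> x \<partial>I_meas)" .
qed

lemma weak_deriv_C1:
  fixes q q' :: "real \<Rightarrow> real"
  assumes d: "\<And>x. x \<in> {0..2 * pi} \<Longrightarrow> (q has_real_derivative q' x) (at x within {0..2 * pi})"
    and c: "continuous_on {0..2 * pi} q'" and e: "q 0 = q (2 * pi)"
  shows "weak_deriv q q'"
  unfolding weak_deriv_def
proof (intro allI impI)
  fix \<phi> \<phi>' assume t: "test_fun \<phi> \<phi>'"
  have cq: "continuous_on {0..2 * pi} q" using d DERIV_continuous_on by blast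
  note t' = test_fun_within[OF t]
  have i: "integrable I_meas (\<lambda>x. q x * \<phi>' x)" "integrable I_meas (\<lambda>x. q' x * \<phi> x)"
    by (intro L2_integrable_I bdd_meas_L2_I bdd_meas_continuous continuous_on_mult cq c t')+
  have "(\<integral>x. q x * \<phi>' x + q' x * \<phi> x \<partial>I_meas) = q (2 * pi) * \<phi> (2 * pi) - q 0 * \<phi> 0"
    by (rule FTC_I) (auto intro!: derivative_eq_intros continuous_intros cq c t' d)
  then show "(\<integral>x. q x * \<phi>' x \<partial>I_meas) = - (\<integral>x. q' x * \<phi> x \<partial>I_meas)"
    using i t' e by simp
qed

section \<open>Almost everywhere approximation by smooth functions\<close>

text \<open>
A measurable function is almost everywhere a limit of continuous functions.  Clamping these to \<open>[-M, M]\<close>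
keeps them dominated, polynomials approximate them uniformly on the compact interval, and the factors
\<open>n t\<^sup>2 / (1 + n t\<^sup>2)\<close> with \<open>t = x (2\<pi> - x)\<close> increase to one inside the interval but vanish at its ends, which
makes the approximants periodic.
\<close>

lemma bounded_approx_C1:
  fixes f :: "real \<Rightarrow> real"
  assumes f: "f \<in> borel_measurable I_meas" and b: "\<And>x. x \<in> {0..2 * pi} \<Longrightarrow> \<bar>f x\<bar> \<le> M"
  obtains q q' :: "nat \<Rightarrow> real \<Rightarrow> real" where
    "\<And>n x. (q n has_real_derivative q' n x) (at x within {0..2 * pi})"
    "\<And>n. continuous_on {0..2 * pi} (q' n)"
    "\<And>n. q n 0 = 0" "\<And>n. q n (2 * pi) = 0"
    "\<And>n x. x \<in> {0..2 * pi} \<Longrightarrow> \<bar>q n x\<bar> \<le> M + 1"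
    "AE x in I_meas. (\<lambda>n. q n x) \<longlonglongrightarrow> f x"
proof -
  let ?f = "\<lambda>x. indicator {0..2 * pi} x *\<^sub>R f x"
  have "?f \<in> borel_measurable lborel"
    using f unfolding I_meas_def by (subst (asm) borel_measurable_restrict_space_iff) auto
  then have "?f \<in> borel_measurable lebesgue" by (simp add: measurable_completion)
  then have "?f measurable_on UNIV" by (intro lebesgue_measurable_imp_measurable_on) auto
  then obtain N g where N: "negligible N" and g: "\<And>n. continuous_on UNIV (g n)"
    and lim: "\<And>x. x \<notin> N \<Longrightarrow> (\<lambda>n. g n x) \<longlonglongrightarrow> ?f x"
    unfolding measurable_on_def by auto
  define h where "h n x = max (- M) (min M (g n x))" for n x
  have h: "continuous_on {0..2 * pi} (h n)" for n
    unfolding h_def by (intro continuous_intros continuous_on_subset[OF g]) auto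
  have "\<exists>p. real_polynomial_function p \<and> (\<forall>x \<in> {0..2 * pi}. \<bar>h n x - p x\<bar> < 1 / real (Suc n))" for n
    using Stone_Weierstrass_real_polynomial_function[OF _ h, of "1 / real (Suc n)" n] by (metis compact_Icc of_nat_0_less_iff zero_less_Suc zero_less_divide_1_iff)
  then obtain p where p: "\<And>n. real_polynomial_function (p n)"
    and ph: "\<And>n x. x \<in> {0..2 * pi} \<Longrightarrow> \<bar>h n x - p n x\<bar> < 1 / real (Suc n)" by metis
  obtain p' where p': "\<And>n. real_polynomial_function (p' n)"
    and pd: "\<And>n x. (p n has_real_derivative p' n x) (at x)"
    using has_real_derivative_polynomial_function[OF p] by metis
  have pc: "continuous_on A (p n)" "continuous_on A (p' n)" for n A
    using p p' continuous_on_polymonial_function real_polynomial_function_eq by blast+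
  define t where "t x = x * (2 * pi - x)" for x :: real
  have t0: "0 \<le> t x" if "x \<in> {0..2 * pi}" for x using that unfolding t_def by auto
  define cut where "cut n x = real n * (t x)\<^sup>2 / (1 + real n * (t x)\<^sup>2)" for n x
  define cut' where "cut' n x = real n * 2 * t x * (2 * pi - 2 * x) / (1 + real n * (t x)\<^sup>2)\<^sup>2" for n x
  have pos: "0 < 1 + real n * (t x)\<^sup>2" for n x by (simp add: add_pos_nonneg)
  have td: "(t has_real_derivative (2 * pi - 2 * x)) (at x)" for x
    unfolding t_def by (auto intro!: derivative_eq_intros)
  have cutd: "(cut n has_real_derivative cut' n x) (at x)" for n x
    unfolding cut_def cut'_def using pos[of n x]
    by (auto intro!: derivative_eq_intros td simp: field_simps power2_eq_square)
  have tc: "continuous_on A t" for A unfolding t_def by (intro continuous_intros)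
  have cutc: "continuous_on A (cut' n)" "continuous_on A (cut n)" for n A
    unfolding cut'_def cut_def using pos by (auto intro!: continuous_intros tc simp: less_imp_neq[symmetric])
  have cutb: "0 \<le> cut n x" "cut n x \<le> 1" for n x unfolding cut_def using pos[of n x] by (auto simp: field_simps)
  define q where "q n x = p n x * cut n x" for n x
  define q' where "q' n x = p' n x * cut n x + p n x * cut' n x" for n x
  show ?thesis
  proof (rule that)
    show "(q n has_real_derivative q' n x) (at x within {0..2 * pi})" for n x
      unfolding q_def q'_def
      by (rule has_field_derivative_at_within) (auto intro!: derivative_eq_intros pd cutd)
    show "continuous_on {0..2 * pi} (q' n)" for n
      unfolding q'_def by (intro continuous_intros pc cutc)
    show "q n 0 = 0" "q n (2 * pi) = 0" for n unfolding q_def cut_def t_def by simp_all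
    show "\<bar>q n x\<bar> \<le> M + 1" if x: "x \<in> {0..2 * pi}" for n x
    proof -
      have "0 \<le> M" using b[OF x] by simp
      then have "\<bar>h n x\<bar> \<le> M" unfolding h_def by auto
      moreover have "1 / real (Suc n) \<le> 1" by simp
      ultimately have "\<bar>p n x\<bar> \<le> M + 1" using ph[OF x, of n] by linarith
      then have "\<bar>p n x\<bar> * \<bar>cut n x\<bar> \<le> (M + 1) * 1" using cutb \<open>0 \<le> M\<close> by (intro mult_mono) auto
      then show ?thesis unfolding q_def abs_mult by simp
    qed
    have "AE x in lborel. x \<notin> N" 
      using N AE_completion[of "\<lambda>x. x \<notin> N" lborel] AE_not_in negligible_iff_null_sets
      by (metis AE_completion_iff)
    moreover have "AE x in lborel. x \<noteq> 0" "AE x in lborel. x \<noteq> 2 * pi" by (auto intro: AE_lborel_singleton)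
    ultimately show "AE x in I_meas. (\<lambda>n. q n x) \<longlonglongrightarrow> f x"
      unfolding AE_I_lborel
    proof eventually_elim
      case (elim x)
      show ?case
      proof
        assume x: "x \<in> {0..2 * pi}"
        then have "0 < t x" using elim unfolding t_def by auto
        have "(\<lambda>n. max (- M) (min M (g n x))) \<longlonglongrightarrow> max (- M) (min M (?f x))"
          by (intro tendsto_intros lim elim)
        then have h: "(\<lambda>n. h n x) \<longlonglongrightarrow> f x" unfolding h_def using b[OF x] x by simp
        have "(\<lambda>n. h n x - p n x) \<longlonglongrightarrow> 0"
        proof (rule Lim_null_comparison)
          show "\<forall>\<^sub>F n in sequentially. norm (h n x - p n x) \<le> inverse (real (Suc n))"
            using ph[OF x] by (auto intro!: always_eventually less_imp_le simp: inverse_eq_divide)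
        qed (rule LIMSEQ_inverse_real_of_nat)
        from tendsto_diff[OF h this] have pl: "(\<lambda>n. p n x) \<longlonglongrightarrow> f x" by simp
        have "(\<lambda>n. 1 - 1 / (1 + real n * (t x)\<^sup>2)) \<longlonglongrightarrow> 1 - 0"
          by (intro tendsto_diff tendsto_const tendsto_divide_0[OF tendsto_const]
              filterlim_at_top_imp_at_infinity filterlim_tendsto_add_at_top[OF tendsto_const]
              filterlim_at_top_mult_tendsto_pos[OF tendsto_const] filterlim_real_sequentially)
             (use \<open>0 < t x\<close> in auto)
        moreover have "1 - 1 / (1 + real n * (t x)\<^sup>2) = cut n x" for n
          unfolding cut_def using pos[of n x] by (simp add: field_simps)
        ultimately have "(\<lambda>n. cut n x) \<longlonglongrightarrow> 1" by simp
        from tendsto_mult[OF pl this] show "(\<lambda>n. q n x) \<longlonglongrightarrow> f x" unfolding q_def by simp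
      qed
    qed
  qed
qed

section \<open>A countable family of test functions\<close>

text \<open>
Approximate the sign of \<open>g\<close> by smooth \<open>q\<close>: integration by parts turns \<open>\<integral>g q\<close> into an integral of the
vanishing primitive, and in the limit \<open>\<integral>g q\<close> becomes \<open>\<integral>\<bar>g\<bar>\<close>.
\<close>

lemma AE_zero_of_prim_zero:
  assumes g: "integrable I_meas g" and p: "\<And>x. x \<in> {0..2 * pi} \<Longrightarrow> prim g x = 0"
  shows "AE x in I_meas. g x = 0"
proof -
  have gm [measurable]: "g \<in> borel_measurable I_meas" using g by auto
  obtain q q' :: "nat \<Rightarrow> real \<Rightarrow> real" where
    q: "\<And>n x. (q n has_real_derivative q' n x) (at x within {0..2 * pi})"
      "\<And>n. continuous_on {0..2 * pi} (q' n)"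
    and q0: "\<And>n. q n (2 * pi) = 0"
    and qb: "\<And>n x. x \<in> {0..2 * pi} \<Longrightarrow> \<bar>q n x\<bar> \<le> 1 + 1"
    and ql: "AE x in I_meas. (\<lambda>n. q n x) \<longlonglongrightarrow> sgn (g x)"
    by (rule bounded_approx_C1[of "\<lambda>x. sgn (g x)" 1]) (auto simp: sgn_if)
  have z: "(\<integral>x. g x * q n x \<partial>I_meas) = 0" for n
  proof -
    have "(\<integral>x. prim g x * q' n x \<partial>I_meas) = 0"
      using p by (subst Bochner_Integration.integral_cong[where g = "\<lambda>_. 0"]) auto
    then show ?thesis using prim_by_parts[OF g q] q0 by simp
  qed
  have [measurable]: "q n \<in> borel_measurable I_meas" for n
    by (rule continuous_measurable_I[OF DERIV_continuous_on[OF q(1)]])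
  have "(\<lambda>n. \<integral>x. g x * q n x \<partial>I_meas) \<longlonglongrightarrow> (\<integral>x. g x * sgn (g x) \<partial>I_meas)"
  proof (rule integral_dominated_convergence)
    show "integrable I_meas (\<lambda>x. \<bar>g x\<bar> * 2)" using g by auto
    show "AE x in I_meas. norm (g x * q n x) \<le> \<bar>g x\<bar> * 2" for n
      using qb by (intro AE_I2) (auto simp: abs_mult intro!: mult_left_mono)
    show "AE x in I_meas. (\<lambda>n. g x * q n x) \<longlonglongrightarrow> g x * sgn (g x)"
      using ql by eventually_elim (rule tendsto_mult[OF tendsto_const])
  qed auto
  then have "(\<integral>x. \<bar>g x\<bar> \<partial>I_meas) = 0"
    unfolding z by (simp add: LIMSEQ_const_iff linordered_idom_class.abs_sgn[symmetric])
  then show ?thesis using integral_nonneg_eq_0_iff_AE[of I_meas "\<lambda>x. \<bar>g x\<bar>"] g by simp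
qed

text \<open>
On \<open>[0, 2\<pi>]\<close> the difference of cosines equals \<open>2 sin (x/2) sin ((a - x)/2)\<close>, which is positive exactly
on \<open>(0, a)\<close>; it is moreover \<open>2\<pi>\<close>-periodic on the whole line.  Its square is \<open>C\<^sup>1\<close>, so the functions \<open>bump a n\<close> are
\<open>C\<^sup>1\<close> periodic test functions that converge, as \<open>n\<close> grows, to the indicator of \<open>(0, a)\<close>.
\<close>

definition arc :: "real \<Rightarrow> real \<Rightarrow> real" where
  "arc a x = max 0 (cos (x - a / 2) - cos (a / 2))"

definition bump :: "real \<Rightarrow> nat \<Rightarrow> real \<Rightarrow> real" where
  "bump a n x = real n * (arc a x)\<^sup>2 / (1 + real n * (arc a x)\<^sup>2)"

definition bump' :: "real \<Rightarrow> nat \<Rightarrow> real \<Rightarrow> real" where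
  "bump' a n x = real n * (2 * arc a x * - sin (x - a / 2)) / (1 + real n * (arc a x)\<^sup>2)\<^sup>2"

lemma bump_denominator_pos: "0 < 1 + real n * (arc a x)\<^sup>2" by (simp add: add_pos_nonneg)

lemma max_0_sq_deriv: "((\<lambda>t. (max 0 t)\<^sup>2) has_real_derivative 2 * max 0 t) (at t)" for t :: real
proof (cases "t = 0")
  case False
  show ?thesis
  proof (cases "t > 0")
    case True
    have "((\<lambda>t. t\<^sup>2) has_real_derivative 2 * max 0 t) (at t)"
      using True by (auto intro!: derivative_eq_intros)
    moreover have "\<forall>\<^sub>F s in nhds t. s\<^sup>2 = (max 0 s)\<^sup>2"
      by (rule eventually_mono[OF eventually_nhds_in_open[of "{0<..}" t]]) (use True in auto)
    ultimately show ?thesis by (simp only: DERIV_cong_ev[OF refl _ refl])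
  next
    case nonpos: False
    have "((\<lambda>t. 0) has_real_derivative 2 * max 0 t) (at t)" using nonpos by auto
    moreover have "\<forall>\<^sub>F s in nhds t. 0 = (max 0 s)\<^sup>2"
      by (rule eventually_mono[OF eventually_nhds_in_open[of "{..<0}" t]]) (use False nonpos in auto)
    ultimately show ?thesis by (simp only: DERIV_cong_ev[OF refl _ refl])
  qed
next
  case True
  have "((\<lambda>h. (max 0 h)\<^sup>2 / h) \<longlongrightarrow> 0) (at (0 :: real))"
  proof (rule Lim_null_comparison)
    show "\<forall>\<^sub>F h in at (0 :: real). norm ((max 0 h)\<^sup>2 / h) \<le> \<bar>h\<bar>"
      by (auto simp: max_def power2_eq_square intro!: always_eventually)
    show "((\<lambda>h. \<bar>h\<bar>) \<longlongrightarrow> 0) (at (0 :: real))" by (rule tendsto_rabs_zero) (rule tendsto_ident_at)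
  qed
  then show ?thesis using True by (simp add: DERIV_def)
qed

lemma arc_sq_deriv:
  "((\<lambda>x. (arc a x)\<^sup>2) has_real_derivative 2 * arc a x * - sin (x - a / 2)) (at x)"
proof -
  have "((\<lambda>x. cos (x - a / 2) - cos (a / 2)) has_real_derivative - sin (x - a / 2)) (at x)"
    by (auto intro!: derivative_eq_intros)
  from DERIV_chain2[OF max_0_sq_deriv this] show ?thesis unfolding arc_def .
qed

lemma continuous_arc: "continuous_on A (arc a)"
  unfolding arc_def by (intro continuous_intros)

lemma continuous_bump: "continuous_on A (bump a n)"
  unfolding bump_def using bump_denominator_pos
  by (auto intro!: continuous_intros continuous_arc simp: less_imp_neq[symmetric])

lemma continuous_bump': "continuous_on A (bump' a n)"
  unfolding bump'_def using bump_denominator_pos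
  by (auto intro!: continuous_intros continuous_arc simp: less_imp_neq[symmetric])

lemma bump_bounds: "0 \<le> bump a n x" "bump a n x \<le> 1"
  unfolding bump_def using bump_denominator_pos[of n a x] by (auto simp: field_simps)

lemma bump_periodic: "bump a n (x + 2 * pi) = bump a n x"
proof -
  have "cos (x + 2 * pi - a / 2) = cos (x - a / 2)"
    using cos_periodic[of "x - a / 2"] by (simp add: algebra_simps)
  then show ?thesis unfolding bump_def arc_def by simp
qed

lemma saturate_deriv:
  fixes h :: "real \<Rightarrow> real"
  assumes "(h has_real_derivative d) (at x)" and "0 < 1 + c * h x"
  shows "((\<lambda>x. c * h x / (1 + c * h x)) has_real_derivative c * d / (1 + c * h x)\<^sup>2) (at x)"
  using assms by (auto intro!: derivative_eq_intros simp: power2_eq_square algebra_simps)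

lemma test_fun_bump: "test_fun (bump a n) (bump' a n)"
  unfolding test_fun_def
proof (intro conjI allI)
  show "(bump a n has_real_derivative bump' a n x) (at x)" for x
    unfolding bump_def bump'_def by (rule saturate_deriv[OF arc_sq_deriv bump_denominator_pos])
qed (auto simp: bump_periodic continuous_bump')

lemma arc_pos_iff:
  assumes a: "0 < a" "a < 2 * pi" and x: "x \<in> {0<..<2 * pi}"
  shows "0 < arc a x \<longleftrightarrow> x < a"
proof -
  have "cos (x - a / 2) - cos (a / 2) = 2 * sin (x / 2) * sin ((a - x) / 2)"
  proof -
    have "(x - a / 2 + a / 2) / 2 = x / 2" "(a / 2 - (x - a / 2)) / 2 = (a - x) / 2"
      by (simp_all add: field_simps)
    then show ?thesis using cos_diff_cos[of "x - a / 2" "a / 2"] by simp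
  qed
  moreover have "0 < sin (x / 2)" using x by (intro sin_gt_zero) auto
  moreover have "0 < sin ((a - x) / 2) \<longleftrightarrow> x < a"
  proof
    assume "x < a" then show "0 < sin ((a - x) / 2)" using a x by (intro sin_gt_zero) auto
  next
    assume s: "0 < sin ((a - x) / 2)"
    show "x < a"
    proof (rule ccontr)
      assume "\<not> x < a"
      then have "0 \<le> sin ((x - a) / 2)" using a x by (intro sin_ge_zero) auto
      moreover have "sin ((x - a) / 2) = - sin ((a - x) / 2)"
        using sin_minus[of "(a - x) / 2"] by (simp add: minus_divide_left)
      ultimately show False using s by simp
    qed
  qed
  ultimately show ?thesis unfolding arc_def by (auto simp: zero_less_mult_iff less_max_iff_disj)
qed

lemma bump_tendsto:
  assumes a: "0 < a" "a < 2 * pi" and x: "x \<in> {0<..<2 * pi}"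
  shows "(\<lambda>n. bump a n x) \<longlonglongrightarrow> (if x < a then 1 else 0)"
proof (cases "x < a")
  case True
  then have t: "0 < arc a x" using arc_pos_iff[OF assms] by simp
  have "(\<lambda>n. 1 - 1 / (1 + real n * (arc a x)\<^sup>2)) \<longlonglongrightarrow> 1 - 0"
    by (intro tendsto_diff tendsto_const tendsto_divide_0[OF tendsto_const]
        filterlim_at_top_imp_at_infinity filterlim_tendsto_add_at_top[OF tendsto_const]
        filterlim_at_top_mult_tendsto_pos[OF tendsto_const] filterlim_real_sequentially)
       (use t in auto)
  moreover have "1 - 1 / (1 + real n * (arc a x)\<^sup>2) = bump a n x" for n
    unfolding bump_def using bump_denominator_pos[of n a x] by (simp add: field_simps)
  ultimately show ?thesis using True by simp
next
  case False
  then have "arc a x = 0" using arc_pos_iff[OF assms] unfolding arc_def by auto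
  then show ?thesis using False unfolding bump_def by simp
qed

lemma AE_I_interior: "AE x in I_meas. x \<in> {0<..<2 * pi}"
proof -
  have "AE x in lborel. x \<noteq> 0" "AE x in lborel. x \<noteq> 2 * pi" by (auto intro: AE_lborel_singleton)
  then show ?thesis unfolding AE_I_lborel by eventually_elim auto
qed

lemma prim_of_bump:
  assumes g: "integrable I_meas g" and a: "0 < a" "a < 2 * pi"
    and z: "\<And>n. (\<integral>x. g x * bump a n x \<partial>I_meas) = 0"
  shows "prim g a = 0"
proof -
  have gm [measurable]: "g \<in> borel_measurable I_meas" using g by auto
  have [measurable]: "bump a n \<in> borel_measurable I_meas" for n
    by (rule continuous_measurable_I[OF continuous_bump])
  have "(\<lambda>n. \<integral>x. g x * bump a n x \<partial>I_meas) \<longlonglongrightarrow> (\<integral>x. (if x < a then g x else 0) \<partial>I_meas)"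
  proof (rule integral_dominated_convergence)
    show "integrable I_meas (\<lambda>x. \<bar>g x\<bar>)" using g by auto
    show "AE x in I_meas. norm (g x * bump a n x) \<le> \<bar>g x\<bar>" for n
      using bump_bounds[of a n] by (intro AE_I2) (auto simp: abs_mult intro!: mult_left_le)
    show "AE x in I_meas. (\<lambda>n. g x * bump a n x) \<longlonglongrightarrow> (if x < a then g x else 0)"
      using AE_I_interior
    proof eventually_elim
      case (elim x)
      from tendsto_mult[OF tendsto_const[of "g x"] bump_tendsto[OF a elim]] show ?case
        by (cases "x < a") auto
    qed
  qed auto
  then show ?thesis unfolding z prim_def by (simp add: LIMSEQ_const_iff)
qed

lemma prim_tendsto_left:
  assumes g: "integrable I_meas g" and s: "\<And>n. s n < x" "s \<longlonglongrightarrow> x"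
  shows "(\<lambda>n. prim g (s n)) \<longlonglongrightarrow> prim g x"
  unfolding prim_def
proof (rule integral_dominated_convergence)
  have gm [measurable]: "g \<in> borel_measurable I_meas" using g by auto
  show "integrable I_meas (\<lambda>x. \<bar>g x\<bar>)" using g by auto
  show "(\<lambda>t. if t < s n then g t else 0) \<in> borel_measurable I_meas" for n by measurable
  show "(\<lambda>t. if t < x then g t else 0) \<in> borel_measurable I_meas" by measurable
  show "AE t in I_meas. (\<lambda>n. if t < s n then g t else 0) \<longlonglongrightarrow> (if t < x then g t else 0)"
  proof (intro AE_I2)
    fix t
    show "(\<lambda>n. if t < s n then g t else 0) \<longlonglongrightarrow> (if t < x then g t else 0)"
    proof (cases "t < x")
      case True
      have "\<forall>\<^sub>F n in sequentially. t < s n" using order_tendstoD(1)[OF s(2) True] .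
      then show ?thesis by (intro tendsto_eventually) (elim eventually_mono, simp add: True)
    next
      case False
      then have "\<not> t < s n" for n using s(1)[of n] by simp
      then show ?thesis using False by simp
    qed
  qed
qed auto

text \<open>
The bumps give \<open>\<integral>\<^sub>0\<^sup>a g = 0\<close> for rational \<open>a\<close>, and the primitive is left-continuous.
\<close>

lemma AE_zero_of_bumps:
  assumes g: "integrable I_meas g"
    and z: "\<And>a n. a \<in> \<rat> \<Longrightarrow> 0 < a \<Longrightarrow> a < 2 * pi \<Longrightarrow> (\<integral>x. g x * bump a n x \<partial>I_meas) = 0"
  shows "AE x in I_meas. g x = 0"
proof (rule AE_zero_of_prim_zero[OF g])
  fix x :: real assume x: "x \<in> {0..2 * pi}"
  show "prim g x = 0"
  proof (cases "x = 0")
    case True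
    then show ?thesis unfolding prim_def
      by (subst Bochner_Integration.integral_cong[where g = "\<lambda>_. 0"]) auto
  next
    case False
    have "\<exists>r \<in> \<rat>. max 0 (x - 1 / real (Suc n)) < r \<and> r < x" for n
      using x False by (intro Rats_dense_in_real) auto
    then obtain s where s: "\<And>n. s n \<in> \<rat>" "\<And>n. max 0 (x - 1 / real (Suc n)) < s n" "\<And>n. s n < x"
      by metis
    have "s \<longlonglongrightarrow> x"
    proof (rule tendsto_sandwich)
      show "\<forall>\<^sub>F n in sequentially. x - inverse (real (Suc n)) \<le> s n" "\<forall>\<^sub>F n in sequentially. s n \<le> x"
        using s(2,3) by (auto intro!: always_eventually less_imp_le simp: inverse_eq_divide)
      show "(\<lambda>n. x - inverse (real (Suc n))) \<longlonglongrightarrow> x"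
        using tendsto_diff[OF tendsto_const LIMSEQ_inverse_real_of_nat, of x] by simp
    qed auto
    from prim_tendsto_left[OF g s(3) this] have "(\<lambda>n. prim g (s n)) \<longlonglongrightarrow> prim g x" .
    moreover have "prim g (s n) = 0" for n
    proof (rule prim_of_bump[OF g])
      show "0 < s n" "s n < 2 * pi" using s(2,3)[of n] x by auto
      then show "(\<integral>x. g x * bump (s n) m x \<partial>I_meas) = 0" for m using z s(1) by auto
    qed
    ultimately show ?thesis by (simp add: LIMSEQ_const_iff)
  qed
qed

lemma AE_zero_of_test_funs:
  assumes "integrable I_meas g"
    and "\<And>\<phi> \<phi>'. test_fun \<phi> \<phi>' \<Longrightarrow> (\<integral>x. g x * \<phi> x \<partial>I_meas) = 0"
  shows "AE x in I_meas. g x = 0"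
  using assms test_fun_bump by (intro AE_zero_of_bumps) auto

lemma integrable_test:
  assumes "integrable I_meas u" "test_fun \<phi> \<phi>'"
  shows "integrable I_meas (\<lambda>x. u x * \<phi> x)" "integrable I_meas (\<lambda>x. u x * \<phi>' x)"
  using integrable_bdd_meas_mult[OF test_fun_bdd_meas(1)[OF assms(2)] assms(1)]
    integrable_bdd_meas_mult[OF test_fun_bdd_meas(2)[OF assms(2)] assms(1)] by (simp_all add: mult.commute)

lemma weak_deriv_unique:
  assumes "weak_deriv u w" "weak_deriv u v" and w: "integrable I_meas w" and v: "integrable I_meas v"
  shows "AE x in I_meas. w x = v x"
proof -
  have "AE x in I_meas. w x - v x = 0"
  proof (rule AE_zero_of_test_funs)
    fix \<phi> \<phi>' assume t: "test_fun \<phi> \<phi>'"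
    then have "(\<integral>x. w x * \<phi> x \<partial>I_meas) = (\<integral>x. v x * \<phi> x \<partial>I_meas)"
      using assms(1,2) unfolding weak_deriv_def by fastforce
    then show "(\<integral>x. (w x - v x) * \<phi> x \<partial>I_meas) = 0"
      using integrable_test(1)[OF w t] integrable_test(1)[OF v t] by (simp add: left_diff_distrib)
  qed (use w v in auto)
  then show ?thesis by eventually_elim simp
qed

lemma weak_deriv_cong_AE:
  assumes "weak_deriv u w" "AE x in I_meas. u x = u' x" "AE x in I_meas. w x = w' x"
    and [measurable]: "u \<in> borel_measurable I_meas" "u' \<in> borel_measurable I_meas"
      "w \<in> borel_measurable I_meas" "w' \<in> borel_measurable I_meas"
  shows "weak_deriv u' w'"
  unfolding weak_deriv_def
proof (intro allI impI)
  fix \<phi> \<phi>' assume t: "test_fun \<phi> \<phi>'"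
  note [measurable] = test_fun_bdd_meas[OF t, THEN bdd_meas_measurable]
  have "(\<integral>x. u' x * \<phi>' x \<partial>I_meas) = (\<integral>x. u x * \<phi>' x \<partial>I_meas)"
    by (rule integral_cong_AE) (use assms(2) in \<open>auto elim!: eventually_mono\<close>)
  moreover have "(\<integral>x. w' x * \<phi> x \<partial>I_meas) = (\<integral>x. w x * \<phi> x \<partial>I_meas)"
    by (rule integral_cong_AE) (use assms(3) in \<open>auto elim!: eventually_mono\<close>)
  ultimately show "(\<integral>x. u' x * \<phi>' x \<partial>I_meas) = - (\<integral>x. w' x * \<phi> x \<partial>I_meas)"
    using assms(1) t unfolding weak_deriv_def by simp
qed

lemma test_fun_const: "test_fun (\<lambda>_. k) (\<lambda>_. 0)"
  unfolding test_fun_def by auto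

lemma weak_deriv_mean_zero: "weak_deriv u w \<Longrightarrow> (\<integral>x. w x \<partial>I_meas) = 0"
  using test_fun_const[of 1] unfolding weak_deriv_def by fastforce

lemma periodic_antiderivative:
  fixes f :: "real \<Rightarrow> real"
  assumes c: "continuous_on UNIV f" and p: "\<And>x. f (x + 2 * pi) = f x" and z: "(\<integral>x. f x \<partial>I_meas) = 0"
  shows "\<exists>\<phi>. test_fun \<phi> f"
proof -
  have "\<exists>F. \<forall>x. - \<infinity> < ereal x \<longrightarrow> ereal x < \<infinity> \<longrightarrow> (F has_vector_derivative f x) (at x)"
    using c by (intro einterval_antiderivative) (auto simp: continuous_on_eq_continuous_at)
  then obtain F where F: "\<And>x. (F has_real_derivative f x) (at x)"
    by (auto simp: has_real_derivative_iff_has_vector_derivative)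
  have "((\<lambda>x. F (x + 2 * pi) - F x) has_real_derivative 0) (at x)" for x
  proof -
    have "((\<lambda>x. F (x + 2 * pi)) has_real_derivative f (x + 2 * pi)) (at x)"
      using F[of "x + 2 * pi"] by (simp add: DERIV_shift)
    from DERIV_diff[OF this F] show ?thesis by (simp add: p)
  qed
  then have "F (x + 2 * pi) - F x = F (0 + 2 * pi) - F 0" for x
    using DERIV_isconst_all[of "\<lambda>x. F (x + 2 * pi) - F x" x 0] by auto
  moreover have "F (2 * pi) - F 0 = 0"
    using FTC_I[OF has_field_derivative_at_within[OF F] continuous_on_subset[OF c]] z by simp
  ultimately have "F (x + 2 * pi) = F x" for x by simp
  then show ?thesis using F c unfolding test_fun_def by blast
qed

text \<open>
A function is the derivative of a periodic one only if its mean vanishes, so the mean of a bump has to be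
subtracted before it is integrated.
\<close>

definition bump_mean :: "real \<Rightarrow> nat \<Rightarrow> real" where
  "bump_mean a n = (\<integral>x. bump a n x \<partial>I_meas) / (2 * pi)"

definition bump_prim :: "real \<Rightarrow> nat \<Rightarrow> real \<Rightarrow> real" where
  "bump_prim a n = (SOME \<phi>. test_fun \<phi> (\<lambda>x. bump a n x - bump_mean a n))"

lemma test_fun_bump_prim: "test_fun (bump_prim a n) (\<lambda>x. bump a n x - bump_mean a n)"
proof -
  have "integrable I_meas (bump a n)"
    by (intro L2_integrable_I bdd_meas_L2_I bdd_meas_continuous continuous_bump)
  then have "(\<integral>x. bump a n x - bump_mean a n \<partial>I_meas) = 0"
    using measure_I by (simp add: bump_mean_def)
  then have "\<exists>\<phi>. test_fun \<phi> (\<lambda>x. bump a n x - bump_mean a n)"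
    by (intro periodic_antiderivative) (auto intro!: continuous_intros continuous_bump simp: bump_periodic)
  from someI_ex[OF this] show ?thesis unfolding bump_prim_def .
qed

text \<open>
By parts, \<open>u\<close> and the primitive of \<open>w\<close> agree against every bump up to its mean, so their difference minus
its own mean is orthogonal to all bumps.  Only countably many test functions are involved.
\<close>

lemma weak_deriv_representation:
  assumes u: "integrable I_meas u" and w: "integrable I_meas w" and w0: "(\<integral>x. w x \<partial>I_meas) = 0"
    and t: "\<And>a n. a \<in> \<rat> \<Longrightarrow> 0 < a \<Longrightarrow> a < 2 * pi \<Longrightarrow>
      (\<integral>x. u x * (bump a n x - bump_mean a n) \<partial>I_meas) = - (\<integral>x. w x * bump_prim a n x \<partial>I_meas)"
  obtains c where "AE x in I_meas. u x = c + prim w x"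
proof -
  have p: "integrable I_meas (prim w)" by (intro L2_integrable_I bdd_meas_L2_I bdd_meas_prim w)
  define c where "c = (\<integral>x. u x - prim w x \<partial>I_meas) / (2 * pi)"
  have i: "integrable I_meas (\<lambda>x. u x - prim w x)" using u p by simp
  have "AE x in I_meas. u x - prim w x - c = 0"
  proof (rule AE_zero_of_bumps)
    fix a :: real and n assume a: "a \<in> \<rat>" "0 < a" "a < 2 * pi"
    note T = test_fun_bump_prim[of a n]
    have "(\<integral>x. prim w x * (bump a n x - bump_mean a n) \<partial>I_meas) = - (\<integral>x. w x * bump_prim a n x \<partial>I_meas)"
      using weak_deriv_prim[OF w w0, of 0] T unfolding weak_deriv_def by simp
    then have e: "(\<integral>x. (u x - prim w x) * (bump a n x - bump_mean a n) \<partial>I_meas) = 0"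
      using t[OF a, of n] integrable_test(2)[OF u T] integrable_test(2)[OF p T]
      by (simp add: left_diff_distrib)
    have b: "integrable I_meas (bump a n)"
      by (intro L2_integrable_I bdd_meas_L2_I bdd_meas_continuous continuous_bump)
    have "(\<integral>x. (u x - prim w x - c) * bump a n x \<partial>I_meas)
      = (\<integral>x. (u x - prim w x) * (bump a n x - bump_mean a n) + bump_mean a n * (u x - prim w x) - c * bump a n x \<partial>I_meas)"
      by (intro Bochner_Integration.integral_cong) (auto simp: algebra_simps)
    also have "\<dots> = bump_mean a n * (\<integral>x. u x - prim w x \<partial>I_meas) - c * (\<integral>x. bump a n x \<partial>I_meas)"
      using Bochner_Integration.integral_add[OF integrable_test(2)[OF i T]
          integrable_mult_right[OF i, of "bump_mean a n"]] e
        Bochner_Integration.integral_diff[OF Bochner_Integration.integrable_add[OF integrable_test(2)[OF i T]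
          integrable_mult_right[OF i, of "bump_mean a n"]] integrable_mult_right[OF b, of c]]
      by (simp only: integral_mult_right_zero add_0)
    also have "\<dots> = 0" unfolding c_def bump_mean_def by simp
    finally show "(\<integral>x. (u x - prim w x - c) * bump a n x \<partial>I_meas) = 0" .
  qed (use i in auto)
  then have "AE x in I_meas. u x = c + prim w x" by eventually_elim simp
  then show ?thesis by (rule that)
qed

section \<open>Weak derivatives on horizontal lines\<close>

lemma L2_D_slice:
  assumes "v \<in> L2 D_meas"
  shows "AE y in I_meas. (\<lambda>x. v (x, y)) \<in> L2 I_meas"
proof -
  have m: "v \<in> borel_measurable (I_meas \<Otimes>\<^sub>M I_meas)" using L2_meas[OF assms] by (simp add: D_meas_def)
  have "integrable (I_meas \<Otimes>\<^sub>M I_meas) (\<lambda>(x, y). (v (x, y))\<^sup>2)"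
    using L2_sq[OF assms] by (simp add: D_meas_def split_def)
  from II.AE_integrable_snd[OF this] show ?thesis using AE_space
  proof eventually_elim
    case (elim y)
    have "(\<lambda>x. v (x, y)) \<in> borel_measurable I_meas"
      by (rule measurable_compose[OF measurable_Pair2'[OF elim(2)] m])
    then show ?case using elim(1) by (simp add: L2_def)
  qed
qed

lemma integral_D_slices:
  fixes f :: "real \<times> real \<Rightarrow> real"
  assumes "integrable D_meas f"
  shows "(\<integral>y. (\<integral>x. f (x, y) \<partial>I_meas) \<partial>I_meas) = (\<integral>z. f z \<partial>D_meas)"
    and "integrable I_meas (\<lambda>y. \<integral>x. f (x, y) \<partial>I_meas)"
    and "AE y in I_meas. integrable I_meas (\<lambda>x. f (x, y))"
  using II.integral_snd[of "\<lambda>x y. f (x, y)"] II.integrable_snd[of "\<lambda>x y. f (x, y)"]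
    II.AE_integrable_snd[of "\<lambda>x y. f (x, y)"] assms by (simp_all add: D_meas_def)

lemma integral_D_slices_y:
  fixes f :: "real \<times> real \<Rightarrow> real"
  assumes "integrable D_meas f"
  shows "(\<integral>x. (\<integral>y. f (x, y) \<partial>I_meas) \<partial>I_meas) = (\<integral>z. f z \<partial>D_meas)"
  using II.integral_fst[of "\<lambda>x y. f (x, y)"] assms by (simp_all add: D_meas_def)

lemma test_fun2_product:
  assumes "test_fun \<phi> \<phi>'" "test_fun \<psi> \<psi>'"
  shows "test_fun2 (\<lambda>z. \<phi> (fst z) * \<psi> (snd z)) (\<lambda>z. \<phi>' (fst z) * \<psi> (snd z)) (\<lambda>z. \<phi> (fst z) * \<psi>' (snd z))"
proof -
  have D: "(\<phi> has_real_derivative \<phi>' x) (at x)" "(\<psi> has_real_derivative \<psi>' x) (at x)" for x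
    using assms unfolding test_fun_def by auto
  have c: "continuous_on UNIV \<phi>'" "continuous_on UNIV \<psi>'" using assms unfolding test_fun_def by auto
  have c': "continuous_on UNIV \<phi>" "continuous_on UNIV \<psi>"
    by (auto intro: DERIV_continuous_on[OF has_field_derivative_at_within[OF D(1)]]
        DERIV_continuous_on[OF has_field_derivative_at_within[OF D(2)]])
  have p: "\<phi> (x + 2 * pi) = \<phi> x" "\<psi> (x + 2 * pi) = \<psi> x" for x using assms unfolding test_fun_def by auto
  show ?thesis
    unfolding test_fun2_def
    by (auto simp: p intro!: derivative_eq_intros D continuous_intros continuous_on_compose2[OF c(1)]
        continuous_on_compose2[OF c(2)] continuous_on_compose2[OF c'(1)] continuous_on_compose2[OF c'(2)])
qed

text \<open>
Test with products \<open>\<phi>(x) \<psi>(y)\<close>: the defect of the identity on the line through \<open>y\<close> is orthogonal to all \<open>\<psi>\<close>.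
The exceptional null set depends on \<open>\<phi>\<close>.
\<close>

lemma weak_dx_slice_test:
  assumes v: "v \<in> L2 D_meas" and w: "w \<in> L2 D_meas" and d: "weak_dx v w" and t: "test_fun \<phi> \<phi>'"
  shows "AE y in I_meas. (\<integral>x. v (x, y) * \<phi>' x \<partial>I_meas) = - (\<integral>x. w (x, y) * \<phi> x \<partial>I_meas)"
proof -
  have i: "integrable D_meas (\<lambda>z. v z * \<phi>' (fst z))" "integrable D_meas (\<lambda>z. w z * \<phi> (fst z))"
    using integrable_bdd_meas_mult[OF bdd_meas_fst[OF test_fun_bdd_meas(2)[OF t]] L2_integrable_D[OF v]]
      integrable_bdd_meas_mult[OF bdd_meas_fst[OF test_fun_bdd_meas(1)[OF t]] L2_integrable_D[OF w]]
    by (simp_all add: mult.commute)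
  let ?f = "\<lambda>z. v z * \<phi>' (fst z) + w z * \<phi> (fst z)"
  have f: "integrable D_meas ?f" using i by simp
  let ?g = "\<lambda>y. \<integral>x. ?f (x, y) \<partial>I_meas"
  have "AE y in I_meas. ?g y = 0"
  proof (rule AE_zero_of_test_funs[OF integral_D_slices(2)[OF f]])
    fix \<psi> \<psi>' assume s: "test_fun \<psi> \<psi>'"
    have B: "bdd_meas D_meas (\<lambda>z. \<psi> (snd z))" by (rule bdd_meas_snd[OF test_fun_bdd_meas(1)[OF s]])
    have "(\<integral>y. ?g y * \<psi> y \<partial>I_meas) = (\<integral>y. (\<integral>x. \<psi> y * ?f (x, y) \<partial>I_meas) \<partial>I_meas)"
      by (simp add: mult.commute)
    also have "\<dots> = (\<integral>z. \<psi> (snd z) * ?f z \<partial>D_meas)"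
      using integral_D_slices(1)[OF integrable_bdd_meas_mult[OF B f]] by simp
    also have "\<dots> = (\<integral>z. \<psi> (snd z) * (v z * \<phi>' (fst z)) \<partial>D_meas) + (\<integral>z. \<psi> (snd z) * (w z * \<phi> (fst z)) \<partial>D_meas)"
      using integrable_bdd_meas_mult[OF B i(1)] integrable_bdd_meas_mult[OF B i(2)] by (simp add: distrib_left)
    also have "\<dots> = 0"
      using d test_fun2_product[OF t s] unfolding weak_dx_def by (fastforce simp: mult_ac)
    finally show "(\<integral>y. ?g y * \<psi> y \<partial>I_meas) = 0" .
  qed
  then show ?thesis using integral_D_slices(3)[OF i(1)] integral_D_slices(3)[OF i(2)]
    by eventually_elim auto
qed

text \<open>
The exceptional null sets of countably many test functions together are still null, and these test
functions determine \<open>v\<close> on a line as \<open>c + \<integral>\<^sub>0\<^sup>x w\<close>, whence the identity for all test functions.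
\<close>

lemma weak_dx_slice:
  assumes v: "v \<in> L2 D_meas" and w: "w \<in> L2 D_meas" and d: "weak_dx v w"
  shows "AE y in I_meas. weak_deriv (\<lambda>x. v (x, y)) (\<lambda>x. w (x, y))"
proof -
  have "AE y in I_meas. \<forall>a \<in> \<rat>. \<forall>n. (\<integral>x. v (x, y) * (bump a n x - bump_mean a n) \<partial>I_meas)
      = - (\<integral>x. w (x, y) * bump_prim a n x \<partial>I_meas)"
    unfolding AE_ball_countable[OF countable_rat] AE_all_countable
    using weak_dx_slice_test[OF v w d test_fun_bump_prim] by blast
  then show ?thesis
    using L2_D_slice[OF v] L2_D_slice[OF w] weak_dx_slice_test[OF v w d test_fun_const[of 1]]
  proof eventually_elim
    case (elim y)
    have w0: "(\<integral>x. w (x, y) \<partial>I_meas) = 0" using elim(4) by simp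
    note iw = L2_integrable_I[OF elim(3)]
    obtain c where "AE x in I_meas. v (x, y) = c + prim (\<lambda>x. w (x, y)) x"
      by (rule weak_deriv_representation[OF L2_integrable_I[OF elim(2)] iw w0]) (use elim(1) in auto)
    then have "AE x in I_meas. c + prim (\<lambda>x. w (x, y)) x = v (x, y)" by eventually_elim simp
    then show ?case
      by (rule weak_deriv_cong_AE[OF weak_deriv_prim[OF iw w0]])
         (use prim_measurable[OF iw] L2_meas[OF elim(2)] L2_meas[OF elim(3)] in auto)
  qed
qed

text \<open>
Uniqueness on almost every line; it makes integrals involving \<open>wdx\<close> independent of the choice made in
its definition.
\<close>

lemma weak_dx_unique:
  assumes "weak_dx v w1" "weak_dx v w2" and v: "v \<in> L2 D_meas" and w: "w1 \<in> L2 D_meas" "w2 \<in> L2 D_meas"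
  shows "AE z in D_meas. w1 z = w2 z"
proof -
  have "AE y in I_meas. AE x in I_meas. w1 (x, y) = w2 (x, y)"
    using weak_dx_slice[OF v w(1) assms(1)] weak_dx_slice[OF v w(2) assms(2)] L2_D_slice[OF w(1)] L2_D_slice[OF w(2)]
    by eventually_elim (rule weak_deriv_unique, auto intro: L2_integrable_I)
  moreover have "{z \<in> space (I_meas \<Otimes>\<^sub>M I_meas). w1 (fst z, snd z) = w2 (fst z, snd z)} \<in> sets (I_meas \<Otimes>\<^sub>M I_meas)"
    using w[THEN L2_meas] unfolding D_meas_def by measurable
  ultimately show ?thesis
    using II.AE_commute[of "\<lambda>x y. w1 (x, y) = w2 (x, y)"] II.AE_pair_iff[of "\<lambda>x y. w1 (x, y) = w2 (x, y)"]
    unfolding D_meas_def by simp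
qed

text \<open>
Test functions on the square are only given with continuous partial derivatives; continuity, hence
measurability and boundedness, follows from total differentiability.
\<close>

lemma test_fun2_continuous:
  assumes "test_fun2 \<phi> \<phi>x \<phi>y"
  shows "continuous_on UNIV \<phi>"
proof -
  have D: "((\<lambda>s. \<phi> (s, y)) has_real_derivative \<phi>x (x, y)) (at x)"
    "((\<lambda>t. \<phi> (x, t)) has_real_derivative \<phi>y (x, y)) (at y)" for x y
    using assms unfolding test_fun2_def by auto
  have c: "continuous_on UNIV \<phi>y" using assms unfolding test_fun2_def by auto
  have "((\<lambda>(x, y). \<phi> (x, y)) has_derivative (\<lambda>(tx, ty). \<phi>x (x, y) * tx + blinfun_apply (blinfun_mult_right (\<phi>y (x, y))) ty))
      (at (x, y) within UNIV \<times> UNIV)" for x y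
  proof (rule has_derivative_partialsI)
    show "((\<lambda>x. \<phi> (x, y)) has_derivative (*) (\<phi>x (x, y))) (at x within UNIV)"
      using D(1) unfolding has_field_derivative_def by simp
    show "((\<lambda>y. \<phi> (x, y)) has_derivative blinfun_apply (blinfun_mult_right (\<phi>y (x, y)))) (at y within UNIV)" for x y
      using D(2)[of x y] unfolding has_field_derivative_def by simp
    have "isCont (\<lambda>z. blinfun_mult_right (\<phi>y z)) (x, y)"
      using c by (intro bounded_linear.isCont[OF bounded_linear_blinfun_mult_right])
        (simp add: continuous_on_eq_continuous_at)
    then show "continuous (at (x, y) within UNIV \<times> UNIV) (\<lambda>(x, y). blinfun_mult_right (\<phi>y (x, y)))"
      by (simp add: split_def)
  qed auto
  from has_derivative_continuous[OF this] have "isCont \<phi> (x, y)" for x y by (simp add: split_def)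
  then show ?thesis by (simp add: continuous_on_eq_continuous_at)
qed

lemma bdd_meas_D_continuous: fixes f :: "real \<times> real \<Rightarrow> real" assumes "continuous_on UNIV f" shows "bdd_meas D_meas f"
proof -
  have "bounded (f ` ({0..2 * pi} \<times> {0..2 * pi}))"
    by (intro compact_imp_bounded compact_continuous_image continuous_on_subset[OF assms] compact_Times) auto
  then obtain C where "\<forall>y \<in> f ` ({0..2 * pi} \<times> {0..2 * pi}). \<bar>y\<bar> \<le> C" unfolding bounded_iff by auto
  then show ?thesis
    by (intro bdd_measI[of _ _ C] measurable_D_of_borel borel_measurable_continuous_onI assms) auto
qed

lemma integrable_D_fst:
  fixes f :: "real \<Rightarrow> real" assumes f: "integrable I_meas f" shows "integrable D_meas (\<lambda>z. f (fst z))"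
  unfolding D_meas_def
proof (rule II.Fubini_integrable)
  show "(\<lambda>z. f (fst z)) \<in> borel_measurable (I_meas \<Otimes>\<^sub>M I_meas)"
    using measurable_D_fst[of f] f by (auto simp: D_meas_def)
qed (use f in auto)

lemma integral_D_fst:
  fixes f :: "real \<Rightarrow> real" assumes f: "integrable I_meas f"
  shows "(\<integral>z. f (fst z) \<partial>D_meas) = 2 * pi * (\<integral>x. f x \<partial>I_meas)"
  using integral_D_slices(1)[OF integrable_D_fst[OF f]] measure_I by simp

lemma L2_D_fst: "u \<in> L2 I_meas \<Longrightarrow> (\<lambda>z. u (fst z)) \<in> L2 D_meas"
  unfolding L2_def using measurable_D_fst integrable_D_fst[of "\<lambda>x. (u x)\<^sup>2"] by auto

lemma weak_dx_fst:
  assumes u: "u \<in> L2 I_meas" and w: "w \<in> L2 I_meas" and d: "weak_deriv u w"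
  shows "weak_dx (\<lambda>z. u (fst z)) (\<lambda>z. w (fst z))"
  unfolding weak_dx_def
proof (intro allI impI)
  fix \<phi> \<phi>x \<phi>y assume t: "test_fun2 \<phi> \<phi>x \<phi>y"
  have B: "bdd_meas D_meas \<phi>" "bdd_meas D_meas \<phi>x"
    using test_fun2_continuous[OF t] t by (auto intro: bdd_meas_D_continuous simp: test_fun2_def)
  have i: "integrable D_meas (\<lambda>z. u (fst z) * \<phi>x z)" "integrable D_meas (\<lambda>z. w (fst z) * \<phi> z)"
    by (intro L2_mult L2_D_fst u w bdd_meas_L2_D[OF B(2)] bdd_meas_L2_D[OF B(1)])+
  have "test_fun (\<lambda>x. \<phi> (x, y)) (\<lambda>x. \<phi>x (x, y))" for y
    using t unfolding test_fun_def test_fun2_def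
    by (auto intro!: continuous_on_compose2[of UNIV \<phi>x] continuous_intros)
  then have "(\<integral>x. u x * \<phi>x (x, y) \<partial>I_meas) = - (\<integral>x. w x * \<phi> (x, y) \<partial>I_meas)" for y
    using d unfolding weak_deriv_def by blast
  then show "(\<integral>z. u (fst z) * \<phi>x z \<partial>D_meas) = - (\<integral>z. w (fst z) * \<phi> z \<partial>D_meas)"
    using integral_D_slices(1)[OF i(1)] integral_D_slices(1)[OF i(2)] by simp
qed

lemma weak_dy_fst:
  assumes u: "u \<in> L2 I_meas"
  shows "weak_dy (\<lambda>z. u (fst z)) (\<lambda>z. 0)"
  unfolding weak_dy_def
proof (intro allI impI)
  fix \<phi> \<phi>x \<phi>y assume t: "test_fun2 \<phi> \<phi>x \<phi>y"
  have B: "bdd_meas D_meas \<phi>y" using t by (auto intro: bdd_meas_D_continuous simp: test_fun2_def)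
  have i: "integrable D_meas (\<lambda>z. u (fst z) * \<phi>y z)"
    by (intro L2_mult L2_D_fst u bdd_meas_L2_D[OF B])
  have T: "test_fun (\<lambda>y. \<phi> (x, y)) (\<lambda>y. \<phi>y (x, y))" for x
    using t unfolding test_fun_def test_fun2_def
    by (auto intro!: continuous_on_compose2[of UNIV \<phi>y] continuous_intros)
  have "(\<integral>y. \<phi>y (x, y) \<partial>I_meas) = 0" for x
    using FTC_I[OF test_fun_within(1,2)[OF T]] test_fun_within(4)[OF T] by simp
  then show "(\<integral>z. u (fst z) * \<phi>y z \<partial>D_meas) = - (\<integral>z. 0 * \<phi> z \<partial>D_meas)"
    using integral_D_slices_y[OF i] by simp
qed

section \<open>The periodic Sobolev spaces\<close>

lemma wd_props:
  assumes "w \<in> L2 I_meas" "weak_deriv u w"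
  shows "wd u \<in> L2 I_meas" "weak_deriv u (wd u)" "AE x in I_meas. wd u x = w x"
proof -
  have "wd u \<in> L2 I_meas \<and> weak_deriv u (wd u)" unfolding wd_def
    by (rule someI[of "\<lambda>w. w \<in> L2 I_meas \<and> weak_deriv u w" w]) (use assms in blast)
  then show 1: "wd u \<in> L2 I_meas" "weak_deriv u (wd u)" by auto
  show "AE x in I_meas. wd u x = w x"
    by (rule weak_deriv_unique[OF 1(2) assms(2)]) (use 1 assms in \<open>auto intro: L2_integrable_I\<close>)
qed

lemma wdx_props:
  assumes "w \<in> L2 D_meas" "weak_dx v w"
  shows "wdx v \<in> L2 D_meas" "weak_dx v (wdx v)"
proof -
  have "wdx v \<in> L2 D_meas \<and> weak_dx v (wdx v)" unfolding wdx_def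
    by (rule someI[of "\<lambda>w. w \<in> L2 D_meas \<and> weak_dx v w" w]) (use assms in blast)
  then show "wdx v \<in> L2 D_meas" "weak_dx v (wdx v)" by auto
qed

lemma HI_L2: "u \<in> HI m \<Longrightarrow> u \<in> L2 I_meas" by (cases m) auto
lemma HD_L2: "v \<in> HD m \<Longrightarrow> v \<in> L2 D_meas" by (cases m) auto

lemma HI_Suc_wd: assumes "u \<in> HI (Suc m)" shows "wd u \<in> L2 I_meas" "weak_deriv u (wd u)"
proof -
  obtain w where "w \<in> HI m" "weak_deriv u w" using assms by auto
  then show "wd u \<in> L2 I_meas" "weak_deriv u (wd u)" using wd_props HI_L2 by blast+
qed

lemma HI_Suc_I: "u \<in> L2 I_meas \<Longrightarrow> w \<in> HI m \<Longrightarrow> weak_deriv u w \<Longrightarrow> u \<in> HI (Suc m)" by auto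

lemma HI_cong_AE:
  assumes "u \<in> HI m" "AE x in I_meas. u x = u' x" "u' \<in> L2 I_meas"
  shows "u' \<in> HI m"
proof (cases m)
  case (Suc k)
  then obtain w where w: "w \<in> HI k" "weak_deriv u w" using assms(1) by auto
  have "weak_deriv u' w"
    by (rule weak_deriv_cong_AE[OF w(2) assms(2)])
       (use L2_meas HI_L2 assms w in auto)
  then show ?thesis using Suc w assms(3) by auto
qed (use assms in auto)

lemma HI_wd: assumes "u \<in> HI (Suc m)" shows "wd u \<in> HI m"
proof -
  obtain w where w: "w \<in> HI m" "weak_deriv u w" using assms by auto
  have "AE x in I_meas. w x = wd u x" using wd_props(3)[OF HI_L2[OF w(1)] w(2)] by eventually_elim simp
  then show ?thesis by (rule HI_cong_AE[OF w(1)]) (rule HI_Suc_wd(1)[OF assms])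
qed

lemma HI_antimono: "HI (Suc m) \<subseteq> HI m"
proof (induction m)
  case (Suc m)
  show ?case
  proof
    fix u assume "u \<in> HI (Suc (Suc m))"
    then obtain w where "u \<in> L2 I_meas" "w \<in> HI (Suc m)" "weak_deriv u w" by auto
    with Suc show "u \<in> HI (Suc m)" by (intro HI_Suc_I[of _ w]) auto
  qed
qed auto

lemma weak_deriv_cmult: "weak_deriv u w \<Longrightarrow> weak_deriv (\<lambda>x. k * u x) (\<lambda>x. k * w x)"
  unfolding weak_deriv_def by (simp add: mult.assoc)

lemma HI_cmult: "u \<in> HI m \<Longrightarrow> (\<lambda>x. k * u x) \<in> HI m"
proof (induction m arbitrary: u)
  case (Suc m)
  then obtain w where w: "u \<in> L2 I_meas" "w \<in> HI m" "weak_deriv u w" by auto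
  then show ?case
    by (intro HI_Suc_I[OF L2_cmult[OF w(1)] Suc.IH[OF w(2)] weak_deriv_cmult[OF w(3)]])
qed (auto intro: L2_cmult)

lemma wd_cmult:
  assumes "u \<in> HI (Suc m)" shows "AE x in I_meas. wd (\<lambda>x. k * u x) x = k * wd u x"
  using wd_props(3)[OF L2_cmult[OF HI_Suc_wd(1)[OF assms]] weak_deriv_cmult[OF HI_Suc_wd(2)[OF assms]]] .

lemma weak_deriv_eq_prim:
  assumes u: "u \<in> L2 I_meas" and w: "w \<in> L2 I_meas" and d: "weak_deriv u w"
  obtains c where "AE x in I_meas. u x = c + prim w x"
  using weak_deriv_representation[OF L2_integrable_I[OF u] L2_integrable_I[OF w] weak_deriv_mean_zero[OF d]]
    d test_fun_bump_prim unfolding weak_deriv_def by blast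

section \<open>Density of the Sobolev spaces\<close>

text \<open>
Truncate, then approximate the truncation by smooth functions with dominated convergence.
\<close>

lemma L2_approx_HI1:
  assumes f: "f \<in> L2 I_meas"
  obtains s where "\<And>n. s n \<in> HI 1" "L2_lim I_meas s f"
proof -
  have fm [measurable]: "f \<in> borel_measurable I_meas" by (rule L2_meas[OF f])
  define T where "T n x = max (- real n) (min (real n) (f x))" for n x
  have Tm [measurable]: "T n \<in> borel_measurable I_meas" for n unfolding T_def by measurable
  have Tl: "(\<lambda>n. \<integral>x. (T n x - f x)\<^sup>2 \<partial>I_meas) \<longlonglongrightarrow> (\<integral>x. 0 \<partial>I_meas)"
  proof (rule integral_dominated_convergence)
    show "integrable I_meas (\<lambda>x. (f x)\<^sup>2)" by (rule L2_sq[OF f])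
    show "AE x in I_meas. norm ((T n x - f x)\<^sup>2) \<le> (f x)\<^sup>2" for n
      by (intro AE_I2) (auto simp: T_def abs_le_square_iff[symmetric])
    show "AE x in I_meas. (\<lambda>n. (T n x - f x)\<^sup>2) \<longlonglongrightarrow> 0"
    proof (intro AE_I2)
      fix x
      obtain N where "\<bar>f x\<bar> \<le> real N" using real_arch_simple by blast
      then have "\<forall>\<^sub>F n in sequentially. (T n x - f x)\<^sup>2 = 0"
        unfolding eventually_sequentially T_def by (intro exI[of _ N]) auto
      then show "(\<lambda>n. (T n x - f x)\<^sup>2) \<longlonglongrightarrow> 0" by (rule tendsto_eventually)
    qed
  qed auto
  have ex: "\<exists>q. q \<in> HI 1 \<and> (\<integral>x. (q x - T n x)\<^sup>2 \<partial>I_meas) < 1 / real (Suc n)" for n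
  proof -
    obtain q q' :: "nat \<Rightarrow> real \<Rightarrow> real" where
      q: "\<And>n x. (q n has_real_derivative q' n x) (at x within {0..2 * pi})"
        "\<And>n. continuous_on {0..2 * pi} (q' n)"
      and q0: "\<And>n. q n 0 = 0" "\<And>n. q n (2 * pi) = 0"
      and qb: "\<And>m x. x \<in> {0..2 * pi} \<Longrightarrow> \<bar>q m x\<bar> \<le> real n + 1"
      and ql: "AE x in I_meas. (\<lambda>m. q m x) \<longlonglongrightarrow> T n x"
      by (rule bounded_approx_C1[of "T n" "real n"]) (auto simp: T_def)
    have Bq: "bdd_meas I_meas (q m)" for m by (rule bdd_meas_continuous[OF DERIV_continuous_on[OF q(1)]])
    note [measurable] = bdd_meas_measurable[OF Bq]
    have "(\<lambda>m. \<integral>x. (q m x - T n x)\<^sup>2 \<partial>I_meas) \<longlonglongrightarrow> (\<integral>x. 0 \<partial>I_meas)"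
    proof (rule integral_dominated_convergence)
      show "integrable I_meas (\<lambda>x. (2 * real n + 1)\<^sup>2)" by simp
      show "AE x in I_meas. norm ((q m x - T n x)\<^sup>2) \<le> (2 * real n + 1)\<^sup>2" for m
      proof (intro AE_I2)
        fix x assume "x \<in> space I_meas"
        then have "\<bar>q m x\<bar> \<le> real n + 1" using qb by simp
        moreover have "\<bar>T n x\<bar> \<le> real n" by (auto simp: T_def)
        ultimately have "\<bar>q m x - T n x\<bar> \<le> \<bar>2 * real n + 1\<bar>" by linarith
        then show "norm ((q m x - T n x)\<^sup>2) \<le> (2 * real n + 1)\<^sup>2"
          unfolding abs_le_square_iff by simp
      qed
      show "AE x in I_meas. (\<lambda>m. (q m x - T n x)\<^sup>2) \<longlonglongrightarrow> 0"
        using ql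
      proof eventually_elim
        case (elim x)
        from tendsto_power[OF tendsto_diff[OF elim tendsto_const[of "T n x"]], of 2] show ?case by simp
      qed
    qed auto
    then have "\<forall>\<^sub>F m in sequentially. (\<integral>x. (q m x - T n x)\<^sup>2 \<partial>I_meas) < 1 / real (Suc n)"
      by (intro order_tendstoD(2)) auto
    then obtain m where m: "(\<integral>x. (q m x - T n x)\<^sup>2 \<partial>I_meas) < 1 / real (Suc n)"
      using eventually_happens' sequentially_bot by blast
    have "q m \<in> HI (Suc 0)"
    proof (rule HI_Suc_I[of _ "q' m"])
      show "q' m \<in> HI 0" using bdd_meas_L2_I[OF bdd_meas_continuous[OF q(2)]] by simp
      show "weak_deriv (q m) (q' m)" using weak_deriv_C1[OF q] q0 by simp
    qed (rule bdd_meas_L2_I[OF Bq])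
    then show ?thesis using m by auto
  qed
  then obtain s where s: "\<And>n. s n \<in> HI 1" "\<And>n. (\<integral>x. (s n x - T n x)\<^sup>2 \<partial>I_meas) < 1 / real (Suc n)"
    by metis
  have TL: "T n \<in> L2 I_meas" for n
    by (intro bdd_meas_L2_I bdd_measI[of _ _ "real n"] Tm) (auto simp: T_def)
  have sL: "s n \<in> L2 I_meas" for n using HI_L2 s(1) by blast
  have "L2_lim I_meas s f"
    unfolding L2_lim_def
  proof (rule tendsto_sandwich[OF _ _ tendsto_const])
    show "\<forall>\<^sub>F n in sequentially. (\<integral>x. (s n x - f x)\<^sup>2 \<partial>I_meas)
        \<le> 2 * inverse (real (Suc n)) + 2 * (\<integral>x. (T n x - f x)\<^sup>2 \<partial>I_meas)"
    proof (intro always_eventually allI)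
      fix n
      have "(\<integral>x. (s n x - f x)\<^sup>2 \<partial>I_meas) \<le> (\<integral>x. 2 * (s n x - T n x)\<^sup>2 + 2 * (T n x - f x)\<^sup>2 \<partial>I_meas)"
      proof (intro integral_mono Bochner_Integration.integrable_add integrable_mult_right L2_sq L2_diff sL TL f)
        fix x
        show "(s n x - f x)\<^sup>2 \<le> 2 * (s n x - T n x)\<^sup>2 + 2 * (T n x - f x)\<^sup>2"
          using sum_squares_bound[of "s n x - T n x" "T n x - f x"]
            power2_sum[of "s n x - T n x" "T n x - f x"] by simp
      qed
      also have "\<dots> = 2 * (\<integral>x. (s n x - T n x)\<^sup>2 \<partial>I_meas) + 2 * (\<integral>x. (T n x - f x)\<^sup>2 \<partial>I_meas)"
        using L2_sq[OF L2_diff[OF sL TL]] L2_sq[OF L2_diff[OF TL f]] by simp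
      finally show "(\<integral>x. (s n x - f x)\<^sup>2 \<partial>I_meas)
          \<le> 2 * inverse (real (Suc n)) + 2 * (\<integral>x. (T n x - f x)\<^sup>2 \<partial>I_meas)"
        using s(2)[of n] by (simp add: inverse_eq_divide)
    qed
    show "(\<lambda>n. 2 * inverse (real (Suc n)) + 2 * (\<integral>x. (T n x - f x)\<^sup>2 \<partial>I_meas)) \<longlonglongrightarrow> 0"
      using tendsto_add[OF tendsto_mult_right_zero[OF LIMSEQ_inverse_real_of_nat, of 2] tendsto_mult_right_zero[of _ _ 2]] Tl
      by simp
  qed auto
  with s(1) show ?thesis by (rule that)
qed

text \<open>
Approximate the derivative \<open>w\<close> by functions in \<open>H\<^sup>1\<close>, subtract their means so that the indefinite
integrals are periodic, and integrate.  As \<open>w\<close> itself has mean zero, the subtracted means tend to zero; convergence of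
the derivatives in \<open>L\<^sup>2\<close> gives uniform convergence of the integrals.
\<close>

lemma HI1_approx_HI2:
  assumes u: "u \<in> L2 I_meas" and w: "w \<in> L2 I_meas" and d: "weak_deriv u w"
  obtains r s where "\<And>n. r n \<in> HI 2" "\<And>n. s n \<in> HI 1" "\<And>n. weak_deriv (r n) (s n)"
    "L2_lim I_meas r u" "L2_lim I_meas s w"
proof -
  obtain t where t: "\<And>n. t n \<in> HI 1" "L2_lim I_meas t w" using L2_approx_HI1[OF w] by blast
  have tL: "t n \<in> L2 I_meas" for n using HI_L2 t(1) by blast
  have iw: "integrable I_meas w" and it: "integrable I_meas (t n)" for n
    using L2_integrable_I w tL by blast+
  define m where "m n = (\<integral>x. t n x \<partial>I_meas) / (2 * pi)" for n
  define s where "s n x = t n x - m n" for n x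
  have m_diff: "m n = (\<integral>x. t n x - w x \<partial>I_meas) / (2 * pi)" for n
    using it iw weak_deriv_mean_zero[OF d] by (simp add: m_def)
  have one: "(\<lambda>_. 1) \<in> L2 I_meas" by (rule bdd_meas_L2_I[OF bdd_meas_const])
  have sq: "(\<integral>x. v x \<partial>I_meas)\<^sup>2 \<le> 2 * pi * (\<integral>x. (v x)\<^sup>2 \<partial>I_meas)" if "v \<in> L2 I_meas" for v
    using Cauchy_Schwarz_integral[OF that one] measure_I by (simp add: mult.commute)
  have sL: "s n \<in> L2 I_meas" for n
    unfolding s_def by (intro L2_diff tL bdd_meas_L2_I bdd_meas_const)
  have is': "integrable I_meas (s n)" for n using L2_integrable_I[OF sL] .
  have s0: "(\<integral>x. s n x \<partial>I_meas) = 0" for n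
    using it measure_I by (simp add: s_def m_def)
  have sH: "s n \<in> HI 1" for n
  proof -
    have wt: "wd (t n) \<in> L2 I_meas" "weak_deriv (t n) (wd (t n))" using HI_Suc_wd[of "t n" 0] t(1) by auto
    have "weak_deriv (s n) (wd (t n))"
      unfolding weak_deriv_def
    proof (intro allI impI)
      fix \<phi> \<phi>' assume T: "test_fun \<phi> \<phi>'"
      have "integrable I_meas \<phi>'" using L2_integrable_I[OF bdd_meas_L2_I[OF test_fun_bdd_meas(2)[OF T]]] .
      then show "(\<integral>x. s n x * \<phi>' x \<partial>I_meas) = - (\<integral>x. wd (t n) x * \<phi> x \<partial>I_meas)"
        using integrable_test(2)[OF it T] wt(2) T FTC_I[OF test_fun_within(1,2)[OF T]] test_fun_within(4)[OF T]
        unfolding weak_deriv_def s_def by (simp add: left_diff_distrib)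
    qed
    then show ?thesis using HI_Suc_I[of "s n" "wd (t n)" 0] sL wt(1) by simp
  qed
  have sw: "(\<integral>x. (s n x - w x)\<^sup>2 \<partial>I_meas) \<le> 4 * (\<integral>x. (t n x - w x)\<^sup>2 \<partial>I_meas)" for n
  proof -
    have L: "(\<lambda>x. t n x - w x) \<in> L2 I_meas" by (rule L2_diff[OF tL w])
    have "(\<integral>x. (s n x - w x)\<^sup>2 \<partial>I_meas) \<le> (\<integral>x. 2 * (t n x - w x)\<^sup>2 + 2 * (m n)\<^sup>2 \<partial>I_meas)"
    proof (intro integral_mono Bochner_Integration.integrable_add integrable_mult_right L2_sq[OF L2_diff[OF sL w]] L2_sq[OF L])
      fix x
      show "(s n x - w x)\<^sup>2 \<le> 2 * (t n x - w x)\<^sup>2 + 2 * (m n)\<^sup>2"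
        using sum_squares_bound[of "t n x - w x" "- m n"]
            power2_sum[of "t n x - w x" "- m n"] by (simp add: s_def algebra_simps)
    qed auto
    also have "\<dots> = 2 * (\<integral>x. (t n x - w x)\<^sup>2 \<partial>I_meas) + 4 * pi * (m n)\<^sup>2"
      using L2_sq[OF L] measure_I by simp
    also have "4 * pi * (m n)\<^sup>2 \<le> 2 * (\<integral>x. (t n x - w x)\<^sup>2 \<partial>I_meas)"
      using sq[OF L] unfolding m_diff by (simp add: power_divide power2_eq_square field_simps)
    finally show ?thesis by simp
  qed
  have lim_s: "L2_lim I_meas s w"
    unfolding L2_lim_def
  proof (rule tendsto_sandwich[OF _ _ tendsto_const])
    show "(\<lambda>n. 4 * (\<integral>x. (t n x - w x)\<^sup>2 \<partial>I_meas)) \<longlonglongrightarrow> 0"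
      using t(2) unfolding L2_lim_def by (rule tendsto_mult_right_zero)
  qed (use sw in auto)
  obtain c where c: "AE x in I_meas. u x = c + prim w x" using weak_deriv_eq_prim[OF u w d] .
  define r where "r n x = c + prim (s n) x" for n x
  have rL: "r n \<in> L2 I_meas" for n
    unfolding r_def by (intro bdd_meas_L2_I bdd_meas_add bdd_meas_const bdd_meas_prim is')
  have rd: "weak_deriv (r n) (s n)" for n
    unfolding r_def by (rule weak_deriv_prim[OF is' s0])
  have rH: "r n \<in> HI 2" for n
    using HI_Suc_I[of "r n" "s n" 1] rL rd sH by (simp add: numeral_2_eq_2)
  have ru: "(\<integral>x. (r n x - u x)\<^sup>2 \<partial>I_meas) \<le> (2 * pi)\<^sup>2 * (\<integral>x. (s n x - w x)\<^sup>2 \<partial>I_meas)" for n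
  proof -
    have L: "(\<lambda>x. s n x - w x) \<in> L2 I_meas" by (rule L2_diff[OF sL w])
    have La: "(\<lambda>x. \<bar>s n x - w x\<bar>) \<in> L2 I_meas" using L by (auto simp: L2_def)
    have "(\<integral>x. (r n x - u x)\<^sup>2 \<partial>I_meas) \<le> (\<integral>x. 2 * pi * (\<integral>x. (s n x - w x)\<^sup>2 \<partial>I_meas) \<partial>I_meas)"
    proof (rule integral_mono_AE[OF L2_sq[OF L2_diff[OF rL u]]])
      show "AE x in I_meas. (r n x - u x)\<^sup>2 \<le> 2 * pi * (\<integral>x. (s n x - w x)\<^sup>2 \<partial>I_meas)"
        using c
      proof eventually_elim
        case (elim x)
        have "r n x - u x = prim (\<lambda>x. s n x - w x) x"
          using prim_diff[OF is' iw] elim by (simp add: r_def)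
        then have "\<bar>r n x - u x\<bar> \<le> (\<integral>x. \<bar>s n x - w x\<bar> \<partial>I_meas)"
          using prim_bound[OF L2_integrable_I[OF L]] by simp
        then have "(r n x - u x)\<^sup>2 \<le> (\<integral>x. \<bar>s n x - w x\<bar> \<partial>I_meas)\<^sup>2"
          using power_mono[of "\<bar>r n x - u x\<bar>" _ 2] by simp
        also have "\<dots> \<le> 2 * pi * (\<integral>x. (s n x - w x)\<^sup>2 \<partial>I_meas)" using sq[OF La] by simp
        finally show ?case .
      qed
    qed simp
    then show ?thesis using measure_I by (simp add: power2_eq_square)
  qed
  have lim_r: "L2_lim I_meas r u"
    unfolding L2_lim_def
  proof (rule tendsto_sandwich[OF _ _ tendsto_const])
    show "(\<lambda>n. (2 * pi)\<^sup>2 * (\<integral>x. (s n x - w x)\<^sup>2 \<partial>I_meas)) \<longlonglongrightarrow> 0"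
      using lim_s unfolding L2_lim_def by (rule tendsto_mult_right_zero)
  qed (use ru in auto)
  show ?thesis by (rule that[OF rH sH rd lim_r lim_s])
qed

section \<open>Suprema of quotients\<close>

text \<open>
The real supremum of an unbounded set carries no information; the first hypothesis provides boundedness along
with the upper estimate.
\<close>

lemma SUP_tendsto:
  fixes R :: "nat \<Rightarrow> 'a \<Rightarrow> real"
  assumes upper: "\<And>\<epsilon>. 0 < \<epsilon> \<Longrightarrow> \<forall>\<^sub>F k in sequentially. \<forall>u \<in> A. R k u \<le> L + \<epsilon>"
    and lower: "\<And>\<epsilon>. 0 < \<epsilon> \<Longrightarrow> \<forall>\<^sub>F k in sequentially. \<exists>u \<in> A. L - \<epsilon> < R k u"
  shows "(\<lambda>k. SUP u \<in> A. R k u) \<longlonglongrightarrow> L"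
proof (rule tendstoI)
  fix e :: real assume "0 < e"
  then have "0 < e / 2" by simp
  from upper[OF this] lower[OF this]
  show "\<forall>\<^sub>F k in sequentially. dist (SUP u \<in> A. R k u) L < e"
  proof eventually_elim
    case (elim k)
    then obtain u where u: "u \<in> A" "L - e / 2 < R k u" by blast
    have "bdd_above (R k ` A)" using elim(1) by (auto intro!: bdd_aboveI2)
    then have "R k u \<le> (SUP u \<in> A. R k u)" using u(1) by (intro cSUP_upper)
    moreover have "(SUP u \<in> A. R k u) \<le> L + e / 2" using u(1) elim(1) by (intro cSUP_least) auto
    ultimately show ?case using u(2) \<open>0 < e\<close> by (simp add: dist_real_def)
  qed
qed

text \<open>
Here \<open>D\<close> is the mass \<open>\<integral>\<rho>\<^sub>0u\<^sup>2\<close>, \<open>E = \<integral>u\<^sub>x\<^sup>2\<close>, \<open>G = \<integral>G\<^sub>k\<close>, \<open>T\<close> the additional mass and \<open>N\<close> the numerator.  When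
\<open>L + \<epsilon> < 0\<close>, the term \<open>(L + \<epsilon>) T\<close> is negative and must be paid for.  Mixing the two bounds on \<open>N\<close> with a small weight
\<open>t\<close> on the second costs at most \<open>\<epsilon>/2\<close> in the coefficient of \<open>D\<close> and gains \<open>t c\<^sub>1 E\<close>; for large \<open>k\<close> the additional mass is
smaller than what was gained.
\<close>

lemma quotient_deficit:
  fixes L K c1 C \<epsilon> :: real
  assumes "0 < \<epsilon>" "0 \<le> C" and L: "0 \<le> L \<or> 0 < c1"
  shows "\<forall>\<^sub>F k in sequentially. \<forall>D E G T N :: real.
    0 \<le> D \<and> 0 \<le> E \<and> 0 \<le> G \<and> 0 \<le> T \<and> N \<le> L * D - G \<and> N \<le> K * D - c1 * E - G \<and>
    (real k)\<^sup>2 * T \<le> C * (D + E + G) \<longrightarrow> N \<le> (L + \<epsilon>) * (D + T)"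
proof (cases "0 \<le> L + \<epsilon>")
  case True
  have "N \<le> (L + \<epsilon>) * (D + T)" if "0 \<le> D" "0 \<le> G" "0 \<le> T" "N \<le> L * D - G" for D G T N :: real
  proof -
    have "N \<le> L * D" using that by simp
    also have "\<dots> \<le> (L + \<epsilon>) * D" using that assms(1) by (simp add: mult_right_mono)
    also have "\<dots> \<le> (L + \<epsilon>) * (D + T)" using that True by (intro mult_left_mono) auto
    finally show ?thesis .
  qed
  then show ?thesis by (intro always_eventually) blast
next
  case False
  define M where "M = - (L + \<epsilon>)"
  have M: "0 < M" and c1: "0 < c1" using False L assms(1) by (auto simp: M_def)
  define t where "t = min 1 (\<epsilon> / (2 * (\<bar>K - L\<bar> + 1)))"
  have "0 < \<bar>K - L\<bar> + 1" by linarith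
  then have "0 < \<epsilon> / (2 * (\<bar>K - L\<bar> + 1))" using assms(1) by simp
  then have t: "0 < t" "t \<le> 1" by (auto simp: t_def)
  have "t * (K - L) \<le> \<epsilon> / (2 * (\<bar>K - L\<bar> + 1)) * (\<bar>K - L\<bar> + 1)"
    using t by (intro order_trans[OF mult_left_mono[of _ "\<bar>K - L\<bar> + 1"] mult_right_mono]) (auto simp: t_def)
  also have "\<dots> = \<epsilon> / 2"
  proof -
    have "\<epsilon> / (2 * X) * X = \<epsilon> / 2" if "0 < X" for X :: real using that by simp
    then show ?thesis using \<open>0 < \<bar>K - L\<bar> + 1\<close> by blast
  qed
  finally have tK: "t * (K - L) \<le> \<epsilon> / 2" .
  have "filterlim (\<lambda>k. (real k)\<^sup>2) at_top sequentially"
    by (intro filterlim_pow_at_top filterlim_real_sequentially) simp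
  then have "\<forall>\<^sub>F k in sequentially. M * C / min 1 (min (\<epsilon> / 2) (t * c1)) \<le> (real k)\<^sup>2"
    by (simp add: filterlim_at_top)
  moreover have "\<forall>\<^sub>F k in sequentially. 0 < k" by (rule eventually_gt_at_top)
  ultimately show ?thesis
  proof eventually_elim
    case (elim k)
    \<comment> \<open>\<open>\<delta>\<close> is the fraction of \<open>D + E + G\<close> that the additional mass may cost.\<close>
    define \<delta> where "\<delta> = M * C / (real k)\<^sup>2"
    have mpos: "0 < min 1 (min (\<epsilon> / 2) (t * c1))" using assms(1) t c1 by auto
    have k: "0 < (real k)\<^sup>2" using elim(2) by simp
    have "M * C \<le> (real k)\<^sup>2 * min 1 (min (\<epsilon> / 2) (t * c1))"
      using elim(1) mpos by (simp add: pos_divide_le_eq)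
    then have "\<delta> \<le> min 1 (min (\<epsilon> / 2) (t * c1))"
      unfolding \<delta>_def pos_divide_le_eq[OF k] by (simp only: mult.commute)
    then have \<delta>: "\<delta> \<le> 1" "\<delta> \<le> \<epsilon> / 2" "\<delta> \<le> t * c1" by auto
    show ?case
    proof (intro allI impI, elim conjE)
      fix D E G T N :: real
      assume nn: "0 \<le> D" "0 \<le> E" "0 \<le> G" "0 \<le> T" and N1: "N \<le> L * D - G" and N2: "N \<le> K * D - c1 * E - G"
        and T: "(real k)\<^sup>2 * T \<le> C * (D + E + G)"
      have "M * T = M * ((real k)\<^sup>2 * T) / (real k)\<^sup>2" using k by simp
      also have "\<dots> \<le> M * (C * (D + E + G)) / (real k)\<^sup>2"
        using T M k by (intro divide_right_mono mult_left_mono) auto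
      finally have MT: "M * T \<le> \<delta> * D + \<delta> * E + \<delta> * G" by (simp add: \<delta>_def algebra_simps add_divide_distrib)
      have "(1 - t) * N + t * N \<le> (1 - t) * (L * D - G) + t * (K * D - c1 * E - G)"
        using N1 N2 t by (intro add_mono mult_left_mono) auto
      then have "N \<le> L * D + t * (K - L) * D - t * c1 * E - G" by (simp add: algebra_simps)
      moreover have "t * (K - L) * D \<le> \<epsilon> / 2 * D" "\<delta> * D \<le> \<epsilon> / 2 * D" "\<delta> * E \<le> t * c1 * E" "\<delta> * G \<le> 1 * G"
        using tK \<delta> nn by (intro mult_right_mono; simp)+
      ultimately have "N + M * T \<le> L * D + \<epsilon> * D" using MT by simp
      then show "N \<le> (L + \<epsilon>) * (D + T)" by (simp add: M_def algebra_simps)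
    qed
  qed
qed

section \<open>The form on the square and on the interval\<close>

text \<open>
The form \<open>a u\<^sup>2 + b u u\<^sub>x + c u\<^sub>x\<^sup>2\<close> stands for \<open>H\<close>, the weight \<open>f\<close> for the coefficient in \<open>F\<close>, and \<open>m = \<kappa> - 1\<close>
is the order of the Sobolev space on the square.  In order zero there is no derivative, so \<open>b\<close>, \<open>c\<close> and \<open>f\<close>
must vanish identically.
\<close>

locale variational_form =
  fixes m :: nat and \<rho> a b c f :: "real \<Rightarrow> real" and r0 K c1 :: real
  assumes m01: "m = 0 \<or> m = 1"
    and order_zero: "m = 0 \<Longrightarrow> b = (\<lambda>_. 0) \<and> c = (\<lambda>_. 0) \<and> f = (\<lambda>_. 0)"
    and bdd_meas_coeff: "bdd_meas I_meas \<rho>" "bdd_meas I_meas a" "bdd_meas I_meas b" "bdd_meas I_meas c" "bdd_meas I_meas f"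
    and r0: "0 < r0" and rho_ge: "\<And>x. x \<in> {0..2 * pi} \<Longrightarrow> r0 \<le> \<rho> x"
    and f_nonneg: "\<And>x. x \<in> {0..2 * pi} \<Longrightarrow> 0 \<le> f x"
    and c1_nonneg: "0 \<le> c1"
    and Q_le: "\<And>x u w. x \<in> {0..2 * pi} \<Longrightarrow>
        a x * (u * u) + b x * (u * w) + c x * (w * w) \<le> K * (\<rho> x * (u * u)) - c1 * (w * w)"
begin

definition Q :: "real \<Rightarrow> real \<Rightarrow> real \<Rightarrow> real" where
  "Q x u w = a x * (u * u) + b x * (u * w) + c x * (w * w)"

definition form :: "(real \<Rightarrow> real) \<Rightarrow> (real \<Rightarrow> real) \<Rightarrow> real" where
  "form u w = (\<integral>x. Q x (u x) (w x) \<partial>I_meas)"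

definition mass :: "(real \<Rightarrow> real) \<Rightarrow> real" where
  "mass u = (\<integral>x. \<rho> x * (u x * u x) \<partial>I_meas)"

definition Lam :: real where
  "Lam = (SUP v \<in> {v \<in> HD m. \<not> (AE z in D_meas. v z = 0)}.
     (\<integral>z. Q (fst z) (v z) (wdx v z) \<partial>D_meas) / (\<integral>z. \<rho> (fst z) * (v z)\<^sup>2 \<partial>D_meas))"

lemma Q_indep: "m = 0 \<Longrightarrow> Q x u w = Q x u w'"
  unfolding Q_def using order_zero by simp

lemma Q_bound: "x \<in> {0..2 * pi} \<Longrightarrow> Q x u w \<le> K * (\<rho> x * (u * u)) - c1 * (w * w)"
  unfolding Q_def by (rule Q_le)

lemma integrable_Q: "u \<in> L2 I_meas \<Longrightarrow> w \<in> L2 I_meas \<Longrightarrow> integrable I_meas (\<lambda>x. Q x (u x) (w x))"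
  unfolding Q_def by (intro Bochner_Integration.integrable_add L2_form bdd_meas_coeff)

lemma integrable_mass: "u \<in> L2 I_meas \<Longrightarrow> integrable I_meas (\<lambda>x. \<rho> x * (u x * u x))"
  by (intro L2_form bdd_meas_coeff)

lemma integrable_Q_D: "v \<in> L2 D_meas \<Longrightarrow> w \<in> L2 D_meas \<Longrightarrow> integrable D_meas (\<lambda>z. Q (fst z) (v z) (w z))"
  unfolding Q_def by (intro Bochner_Integration.integrable_add L2_form bdd_meas_fst bdd_meas_coeff)

lemma integrable_mass_D: "v \<in> L2 D_meas \<Longrightarrow> integrable D_meas (\<lambda>z. \<rho> (fst z) * (v z * v z))"
  by (intro L2_form bdd_meas_fst bdd_meas_coeff)

lemma rho_pos: "x \<in> {0..2 * pi} \<Longrightarrow> 0 < \<rho> x"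
  using rho_ge r0 by fastforce

lemma mass_nonneg: "0 \<le> mass u"
  unfolding mass_def using rho_pos by (intro integral_nonneg_AE AE_I2) (auto simp: less_imp_le)

lemma mass_pos: assumes u: "u \<in> L2 I_meas" and "\<not> (AE x in I_meas. u x = 0)" shows "0 < mass u"
proof (rule ccontr)
  assume "\<not> 0 < mass u"
  then have "mass u = 0" using mass_nonneg[of u] by simp
  moreover have "AE x in I_meas. 0 \<le> \<rho> x * (u x * u x)"
    using rho_pos by (intro AE_I2) (auto simp: less_imp_le)
  ultimately have "AE x in I_meas. \<rho> x * (u x * u x) = 0"
    using integral_nonneg_eq_0_iff_AE[OF integrable_mass[OF u]] unfolding mass_def by simp
  then have "AE x in I_meas. u x = 0" using AE_space by eventually_elim (use rho_pos in fastforce)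
  then show False using assms(2) by simp
qed

lemma mass_D_pos:
  assumes v: "v \<in> L2 D_meas" and "\<not> (AE z in D_meas. v z = 0)"
  shows "0 < (\<integral>z. \<rho> (fst z) * (v z * v z) \<partial>D_meas)"
proof (rule ccontr)
  have nn: "AE z in D_meas. 0 \<le> \<rho> (fst z) * (v z * v z)"
    using rho_pos by (intro AE_I2) (auto simp: less_imp_le)
  assume "\<not> 0 < (\<integral>z. \<rho> (fst z) * (v z * v z) \<partial>D_meas)"
  then have "(\<integral>z. \<rho> (fst z) * (v z * v z) \<partial>D_meas) = 0" using integral_nonneg_AE[OF nn] by simp
  then have "AE z in D_meas. \<rho> (fst z) * (v z * v z) = 0"
    using integral_nonneg_eq_0_iff_AE[OF integrable_mass_D[OF v] nn] by simp
  then have "AE z in D_meas. v z = 0" using AE_space by eventually_elim (use rho_pos in fastforce)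
  then show False using assms(2) by simp
qed

lemma form_upper:
  assumes "u \<in> L2 I_meas" "w \<in> L2 I_meas"
  shows "form u w \<le> K * mass u - c1 * (\<integral>x. w x * w x \<partial>I_meas)"
proof -
  have "form u w \<le> (\<integral>x. K * (\<rho> x * (u x * u x)) - c1 * (w x * w x) \<partial>I_meas)"
    unfolding form_def
    by (intro integral_mono integrable_Q Bochner_Integration.integrable_diff integrable_mult_right integrable_mass L2_mult assms Q_bound) simp
  also have "\<dots> = K * mass u - c1 * (\<integral>x. w x * w x \<partial>I_meas)"
    unfolding mass_def using integrable_mass[OF assms(1)] L2_mult[OF assms(2,2)] by simp
  finally show ?thesis .
qed

lemma form_cong_wd:
  assumes "m = 1 \<Longrightarrow> AE x in I_meas. w x = w' x" and "u \<in> L2 I_meas" "w \<in> L2 I_meas" "w' \<in> L2 I_meas"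
  shows "form u w = form u w'"
proof (cases "m = 0")
  case True
  show ?thesis unfolding form_def
    by (intro Bochner_Integration.integral_cong refl Q_indep True)
next
  case False
  then have "AE x in I_meas. w x = w' x" using assms(1) m01 by simp
  then show ?thesis unfolding form_def
    by (intro integral_cong_AE)
       (auto intro: borel_measurable_integrable integrable_Q assms elim!: eventually_mono)
qed

text \<open>In the order-zero case the form does not see the derivative, so any function, here zero, may
  stand in for a derivative that need not exist.\<close>

definition grad :: "(real \<times> real \<Rightarrow> real) \<Rightarrow> real \<times> real \<Rightarrow> real" where
  "grad v = (if m = 0 then (\<lambda>_. 0) else wdx v)"

lemma grad_props:
  assumes "v \<in> HD m"
  shows "grad v \<in> L2 D_meas" "m = 1 \<Longrightarrow> weak_dx v (grad v)"
proof -
  have "grad v \<in> L2 D_meas \<and> weak_dx v (grad v)" if "m = 1"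
  proof -
    obtain w where w: "w \<in> L2 D_meas" "weak_dx v w" using assms \<open>m = 1\<close> by auto
    then show ?thesis using wdx_props[OF w] that unfolding grad_def by simp
  qed
  moreover have "grad v \<in> L2 D_meas" if "m = 0"
    using that bdd_meas_L2_D[OF bdd_meas_const] unfolding grad_def by simp
  ultimately show "grad v \<in> L2 D_meas" "m = 1 \<Longrightarrow> weak_dx v (grad v)" using m01 by auto
qed

lemma Q_grad: "Q x u (wdx v z) = Q x u (grad v z)"
  unfolding grad_def using Q_indep by auto

lemma Lam_grad:
  "Lam = (SUP v \<in> {v \<in> HD m. \<not> (AE z in D_meas. v z = 0)}.
     (\<integral>z. Q (fst z) (v z) (grad v z) \<partial>D_meas) / (\<integral>z. \<rho> (fst z) * (v z * v z) \<partial>D_meas))"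
  unfolding Lam_def Q_grad[of "fst _" "_ _"] power2_eq_square ..

lemma Lam_bdd:
  "bdd_above ((\<lambda>v. (\<integral>z. Q (fst z) (v z) (grad v z) \<partial>D_meas) / (\<integral>z. \<rho> (fst z) * (v z * v z) \<partial>D_meas))
     ` {v \<in> HD m. \<not> (AE z in D_meas. v z = 0)})"
proof (rule bdd_aboveI2)
  fix v assume "v \<in> {v \<in> HD m. \<not> (AE z in D_meas. v z = 0)}"
  then have v: "v \<in> HD m" "v \<in> L2 D_meas" "\<not> (AE z in D_meas. v z = 0)" using HD_L2 by auto
  have "(\<integral>z. Q (fst z) (v z) (grad v z) \<partial>D_meas) \<le> (\<integral>z. K * (\<rho> (fst z) * (v z * v z)) \<partial>D_meas)"
  proof (intro integral_mono integrable_Q_D integrable_mult_right integrable_mass_D grad_props v)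
    fix z assume "z \<in> space D_meas"
    then show "Q (fst z) (v z) (grad v z) \<le> K * (\<rho> (fst z) * (v z * v z))"
      using Q_bound[of "fst z" "v z" "grad v z"] mult_nonneg_nonneg[OF c1_nonneg zero_le_square[of "grad v z"]]
      by force
  qed
  then show "(\<integral>z. Q (fst z) (v z) (grad v z) \<partial>D_meas) / (\<integral>z. \<rho> (fst z) * (v z * v z) \<partial>D_meas) \<le> K"
    using mass_D_pos[OF v(2,3)] by (simp add: pos_divide_le_eq)
qed

text \<open>
A function of \<open>x\<close> alone competes on the square, where both integrals gain the factor \<open>2\<pi>\<close>.
\<close>

lemma form_le_Lam:
  assumes u: "u \<in> HI (Suc m)"
  shows "form u (wd u) \<le> Lam * mass u"
proof (cases "AE x in I_meas. u x = 0")
  case True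
  have uL: "u \<in> L2 I_meas" using HI_L2[OF u] .
  have "mass u = 0" unfolding mass_def
    by (rule integral_eq_zero_AE) (use True in \<open>auto elim!: eventually_mono\<close>)
  moreover have "0 \<le> c1 * (\<integral>x. wd u x * wd u x \<partial>I_meas)" using c1_nonneg by simp
  ultimately show ?thesis using form_upper[OF uL HI_Suc_wd(1)[OF u]] by simp
next
  case False
  define v where "v z = u (fst z)" for z :: "real \<times> real"
  have uL: "u \<in> L2 I_meas" using HI_L2[OF u] .
  note w = HI_Suc_wd[OF u]
  have vL: "v \<in> L2 D_meas" unfolding v_def by (rule L2_D_fst[OF uL])
  have dx: "weak_dx v (\<lambda>z. wd u (fst z))" unfolding v_def by (rule weak_dx_fst[OF uL w])
  have z: "(\<lambda>_. 0) \<in> L2 D_meas" by (rule bdd_meas_L2_D[OF bdd_meas_const])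
  have vH: "v \<in> HD m"
    using m01 vL dx L2_D_fst[OF w(1)] weak_dy_fst[OF uL] z unfolding v_def by auto
  have eq: "(\<integral>z. Q (fst z) (v z) (grad v z) \<partial>D_meas) = (\<integral>z. Q (fst z) (u (fst z)) (wd u (fst z)) \<partial>D_meas)"
  proof (cases "m = 0")
    case True
    then show ?thesis unfolding v_def using Q_indep[OF True] by (intro Bochner_Integration.integral_cong) auto
  next
    case False
    then have "AE z in D_meas. grad v z = wd u (fst z)"
      using weak_dx_unique[OF grad_props(2)[OF vH] dx vL grad_props(1)[OF vH] L2_D_fst[OF w(1)]] m01 by simp
    moreover have "(\<lambda>z. Q (fst z) (v z) (wd u (fst z))) \<in> borel_measurable D_meas"
      using borel_measurable_integrable[OF integrable_Q_D[OF vL L2_D_fst[OF w(1)]]] .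
    ultimately show ?thesis
      using borel_measurable_integrable[OF integrable_Q_D[OF vL grad_props(1)[OF vH]]]
      by (intro integral_cong_AE) (auto simp: v_def elim!: eventually_mono)
  qed
  have form: "(\<integral>z. Q (fst z) (v z) (grad v z) \<partial>D_meas) = 2 * pi * form u (wd u)"
    unfolding eq form_def by (rule integral_D_fst[OF integrable_Q[OF uL w(1)]])
  have mass: "(\<integral>z. \<rho> (fst z) * (v z * v z) \<partial>D_meas) = 2 * pi * mass u"
    unfolding v_def mass_def by (rule integral_D_fst[OF integrable_mass[OF uL]])
  have nz: "\<not> (AE z in D_meas. v z = 0)"
  proof
    assume "AE z in D_meas. v z = 0"
    then have "(\<integral>z. \<rho> (fst z) * (v z * v z) \<partial>D_meas) = 0"
      by (intro integral_eq_zero_AE) (auto elim!: eventually_mono)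
    then show False using mass mass_pos[OF uL False] by simp
  qed
  have "2 * pi * form u (wd u) / (2 * pi * mass u) \<le> Lam"
    unfolding Lam_grad form[symmetric] mass[symmetric]
    by (rule cSUP_upper[OF _ Lam_bdd]) (use vH nz in auto)
  then show ?thesis using mass_pos[OF uL False] by (simp add: pos_divide_le_eq)
qed

lemma HD_witness: "\<exists>v. v \<in> HD m \<and> \<not> (AE z in D_meas. v z = 0)"
proof (intro exI conjI)
  let ?v = "\<lambda>_ :: real \<times> real. 1 :: real"
  have L: "(\<lambda>_. k) \<in> L2 D_meas" for k :: real by (rule bdd_meas_L2_D[OF bdd_meas_const])
  have LI: "(\<lambda>_. k) \<in> L2 I_meas" for k :: real by (rule bdd_meas_L2_I[OF bdd_meas_const])
  have "weak_deriv (\<lambda>_. 1) (\<lambda>_. 0)" by (rule weak_deriv_C1) auto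
  then show "?v \<in> HD m"
    using m01 L weak_dx_fst[OF LI LI, of 1 0] weak_dy_fst[OF LI, of 1]
    by (auto intro!: bexI[of _ "\<lambda>_. 0"])
  show "\<not> (AE z in D_meas. ?v z = 0)"
  proof
    assume "AE z in D_meas. ?v z = 0"
    then have "(\<integral>z. 1 \<partial>D_meas) = (0 :: real)" by (intro integral_eq_zero_AE) simp
    moreover have "(\<integral>z. 1 \<partial>D_meas) = 2 * pi * (\<integral>x. 1 \<partial>I_meas)"
      by (rule integral_D_fst) simp
    ultimately show False using measure_I by simp
  qed
qed

lemma form_tendsto:
  assumes r: "\<And>n. r n \<in> L2 I_meas" and s: "\<And>n. s n \<in> L2 I_meas"
    and u: "u \<in> L2 I_meas" and w: "w \<in> L2 I_meas" and "L2_lim I_meas r u" "L2_lim I_meas s w"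
  shows "(\<lambda>n. form (r n) (s n)) \<longlonglongrightarrow> form u w" "(\<lambda>n. mass (r n)) \<longlonglongrightarrow> mass u"
proof -
  have split: "form u w = (\<integral>x. a x * (u x * u x) \<partial>I_meas) + (\<integral>x. b x * (u x * w x) \<partial>I_meas)
      + (\<integral>x. c x * (w x * w x) \<partial>I_meas)" if "u \<in> L2 I_meas" "w \<in> L2 I_meas" for u w
    unfolding form_def Q_def
    using L2_form[OF bdd_meas_coeff(2) that(1,1)] L2_form[OF bdd_meas_coeff(3) that] L2_form[OF bdd_meas_coeff(4) that(2,2)]
    by simp
  show "(\<lambda>n. form (r n) (s n)) \<longlonglongrightarrow> form u w"
    unfolding split[OF u w] split[OF r s]
    by (intro tendsto_add L2_lim_form bdd_meas_coeff assms)
  show "(\<lambda>n. mass (r n)) \<longlonglongrightarrow> mass u"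
    unfolding mass_def by (intro L2_lim_form bdd_meas_coeff assms)
qed

text \<open>
If \<open>v\<close> beats \<open>Lam - \<epsilon>\<close> on the square, the excess \<open>\<integral>(Q - (Lam - \<epsilon>) \<rho> v\<^sup>2)\<close> is positive on some line on which \<open>v\<close> is
square-integrable with its weak derivative.  The excess is continuous in the Sobolev norm, so it stays
positive for a smoother function nearby.
\<close>

lemma near_maximiser:
  assumes "0 < \<epsilon>"
  obtains u where "u \<in> HI (Suc m)" "(Lam - \<epsilon>) * mass u < form u (wd u)"
proof -
  let ?A = "{v \<in> HD m. \<not> (AE z in D_meas. v z = 0)}"
  let ?R = "\<lambda>v. (\<integral>z. Q (fst z) (v z) (grad v z) \<partial>D_meas) / (\<integral>z. \<rho> (fst z) * (v z * v z) \<partial>D_meas)"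
  have "?A \<noteq> {}" using HD_witness by blast
  moreover have "Lam - \<epsilon> < (SUP v \<in> ?A. ?R v)" using assms Lam_grad by simp
  ultimately obtain v where v: "v \<in> HD m" "\<not> (AE z in D_meas. v z = 0)" "Lam - \<epsilon> < ?R v"
    using less_cSUP_iff[OF _ Lam_bdd] by blast
  have vL: "v \<in> L2 D_meas" using HD_L2[OF v(1)] .
  note g = grad_props[OF v(1)]
  let ?f = "\<lambda>z. Q (fst z) (v z) (grad v z) - (Lam - \<epsilon>) * (\<rho> (fst z) * (v z * v z))"
  have fi: "integrable D_meas ?f"
    by (intro Bochner_Integration.integrable_diff integrable_Q_D integrable_mult_right integrable_mass_D vL g)
  have "0 < (\<integral>z. ?f z \<partial>D_meas)"
    using v(3) mass_D_pos[OF vL v(2)] integrable_Q_D[OF vL g(1)] integrable_mass_D[OF vL]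
    by (simp add: pos_less_divide_eq)
  then have pos: "0 < (\<integral>y. (\<integral>x. ?f (x, y) \<partial>I_meas) \<partial>I_meas)" using integral_D_slices(1)[OF fi] by simp
  have good: "AE y in I_meas. (\<lambda>x. v (x, y)) \<in> L2 I_meas \<and> (\<lambda>x. grad v (x, y)) \<in> L2 I_meas
      \<and> (m = 1 \<longrightarrow> weak_deriv (\<lambda>x. v (x, y)) (\<lambda>x. grad v (x, y)))"
  proof (cases "m = 1")
    case True
    show ?thesis using L2_D_slice[OF vL] L2_D_slice[OF g(1)] weak_dx_slice[OF vL g(1) g(2)[OF True]]
      by eventually_elim blast
  next
    case False
    show ?thesis using L2_D_slice[OF vL] L2_D_slice[OF g(1)] by eventually_elim (use False in blast)
  qed
  have "\<exists>y. ((\<lambda>x. v (x, y)) \<in> L2 I_meas \<and> (\<lambda>x. grad v (x, y)) \<in> L2 I_meas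
      \<and> (m = 1 \<longrightarrow> weak_deriv (\<lambda>x. v (x, y)) (\<lambda>x. grad v (x, y)))) \<and> 0 < (\<integral>x. ?f (x, y) \<partial>I_meas)"
  proof (rule ccontr)
    assume "\<not> ?thesis"
    then have "(\<integral>x. ?f (x, y) \<partial>I_meas) \<le> 0" if "(\<lambda>x. v (x, y)) \<in> L2 I_meas \<and> (\<lambda>x. grad v (x, y)) \<in> L2 I_meas
      \<and> (m = 1 \<longrightarrow> weak_deriv (\<lambda>x. v (x, y)) (\<lambda>x. grad v (x, y)))" for y
      using that not_less by blast
    with good have "AE y in I_meas. (\<integral>x. ?f (x, y) \<partial>I_meas) \<le> 0"
      by (rule eventually_mono)
    then have "AE y in I_meas. 0 \<le> - (\<integral>x. ?f (x, y) \<partial>I_meas)" by eventually_elim simp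
    from integral_nonneg_AE[OF this] show False using pos by simp
  qed
  then obtain y where y: "(\<lambda>x. v (x, y)) \<in> L2 I_meas" "(\<lambda>x. grad v (x, y)) \<in> L2 I_meas"
    "m = 1 \<Longrightarrow> weak_deriv (\<lambda>x. v (x, y)) (\<lambda>x. grad v (x, y))" "0 < (\<integral>x. ?f (x, y) \<partial>I_meas)"
    by blast
  define u0 w0 where "u0 x = v (x, y)" and "w0 x = grad v (x, y)" for x
  have u0: "u0 \<in> L2 I_meas" and w0: "w0 \<in> L2 I_meas" and d0: "m = 1 \<Longrightarrow> weak_deriv u0 w0"
    using y(1,2,3) unfolding u0_def[abs_def] w0_def[abs_def] by auto
  have pos0: "0 < form u0 w0 - (Lam - \<epsilon>) * mass u0"
    using y(4) integrable_Q[OF u0 w0] integrable_mass[OF u0] unfolding form_def mass_def u0_def w0_def by simp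
  have "\<exists>r s. (\<forall>n. r n \<in> HI (Suc m) \<and> s n \<in> L2 I_meas \<and> (m = 1 \<longrightarrow> weak_deriv (r n) (s n)))
      \<and> L2_lim I_meas r u0 \<and> L2_lim I_meas s w0"
  proof (cases "m = 1")
    case True
    obtain r s where "\<And>n. r n \<in> HI 2" "\<And>n. s n \<in> HI 1" "\<And>n. weak_deriv (r n) (s n)"
      "L2_lim I_meas r u0" "L2_lim I_meas s w0" using HI1_approx_HI2[OF u0 w0 d0[OF True]] by blast
    then show ?thesis using True HI_L2 by (intro exI[of _ r] exI[of _ s]) (auto simp: numeral_2_eq_2)
  next
    case False
    obtain r where "\<And>n. r n \<in> HI 1" "L2_lim I_meas r u0" using L2_approx_HI1[OF u0] by blast
    then show ?thesis using False m01 w0 by (intro exI[of _ r] exI[of _ "\<lambda>_. w0"]) (auto simp: L2_lim_def)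
  qed
  then obtain r s where rs: "\<And>n. r n \<in> HI (Suc m)" "\<And>n. s n \<in> L2 I_meas"
      "\<And>n. m = 1 \<Longrightarrow> weak_deriv (r n) (s n)" "L2_lim I_meas r u0" "L2_lim I_meas s w0" by blast
  note t = form_tendsto[OF HI_L2[OF rs(1)] rs(2) u0 w0 rs(4,5)]
  have "(\<lambda>n. form (r n) (s n) - (Lam - \<epsilon>) * mass (r n)) \<longlonglongrightarrow> form u0 w0 - (Lam - \<epsilon>) * mass u0"
    by (intro tendsto_intros t)
  from order_tendstoD(1)[OF this pos0] obtain n where n: "0 < form (r n) (s n) - (Lam - \<epsilon>) * mass (r n)"
    using eventually_happens' sequentially_bot by blast
  have "form (r n) (wd (r n)) = form (r n) (s n)"
    by (rule form_cong_wd[OF wd_props(3)[OF rs(2,3)] HI_L2[OF rs(1)] HI_Suc_wd(1)[OF rs(1)] rs(2)])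
  then show ?thesis using n rs(1) by (intro that[of "r n"]) auto
qed

lemma near_maximiser_mass_pos:
  assumes u: "u \<in> HI (Suc m)" and "x * mass u < form u (wd u)"
  shows "0 < mass u" "\<not> (AE x in I_meas. u x = 0)"
proof -
  have uL: "u \<in> L2 I_meas" using HI_L2[OF u] .
  have "0 \<le> c1 * (\<integral>x. wd u x * wd u x \<partial>I_meas)" using c1_nonneg by simp
  then have "mass u \<noteq> 0" using form_upper[OF uL HI_Suc_wd(1)[OF u]] assms(2) by auto
  then show "0 < mass u" using mass_nonneg[of u] by simp
  then show "\<not> (AE x in I_meas. u x = 0)"
    unfolding mass_def by (metis (mono_tags, lifting) integral_eq_zero_AE eventually_mono less_irrefl mult_zero_right)
qed

lemma integrable_tension:
  assumes "m = 1 \<Longrightarrow> w \<in> L2 I_meas"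
  shows "integrable I_meas (\<lambda>x. f x * (w x * w x))"
proof (cases "m = 1")
  case True then show ?thesis using assms by (intro L2_form bdd_meas_coeff)
next
  case False then show ?thesis using order_zero m01 by simp
qed

lemma tension_nonneg: "0 \<le> (\<integral>x. f x * (w x * w x) \<partial>I_meas)"
  using f_nonneg by (intro integral_nonneg_AE AE_I2) auto

end

section \<open>The limit without compression\<close>

lemma inverse_square_tendsto: "(\<lambda>k. X / (real k)\<^sup>2) \<longlonglongrightarrow> 0"
  by (intro tendsto_divide_0[OF tendsto_const] filterlim_at_top_imp_at_infinity
      filterlim_pow_at_top filterlim_real_sequentially) simp

context variational_form
begin

lemma mass_le: obtains C where "0 < C" "\<And>w. w \<in> L2 I_meas \<Longrightarrow> mass w \<le> C * (\<integral>x. w x * w x \<partial>I_meas)"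
proof -
  obtain C where C: "0 < C" "\<And>x. x \<in> space I_meas \<Longrightarrow> \<bar>\<rho> x\<bar> \<le> C" using bdd_measE[OF bdd_meas_coeff(1)] by blast
  have "mass w \<le> C * (\<integral>x. w x * w x \<partial>I_meas)" if w: "w \<in> L2 I_meas" for w
  proof -
    have "mass w \<le> (\<integral>x. C * (w x * w x) \<partial>I_meas)"
      unfolding mass_def
    proof (intro integral_mono integrable_mass integrable_mult_right L2_mult w)
      fix x assume "x \<in> space I_meas"
      then have "\<rho> x \<le> C" using C(2)[of x] by simp
      then show "\<rho> x * (w x * w x) \<le> C * (w x * w x)" by (intro mult_right_mono) auto
    qed
    then show ?thesis by simp
  qed
  with C(1) show ?thesis by (rule that)
qed

lemma incompressible_quotient:
  assumes u: "u \<in> HI (Suc m)"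
  shows "(\<integral>x. - (f x * (- (wd (wd u) x / real k))\<^sup>2) + Q x (u x) (wd u x) \<partial>I_meas)
      = form u (wd u) - (\<integral>x. f x * (wd (wd u) x * wd (wd u) x) \<partial>I_meas) / (real k)\<^sup>2"
    and "(\<integral>x. \<rho> x * ((u x)\<^sup>2 + (wd u x)\<^sup>2 / (real k)\<^sup>2) \<partial>I_meas) = mass u + mass (wd u) / (real k)\<^sup>2"
proof -
  have "wd (wd u) \<in> L2 I_meas" if "m = 1" using HI_wd[OF u] HI_Suc_wd(1)[of "wd u" 0] that by simp
  note t = integrable_tension[OF this]
  note q = integrable_Q[OF HI_L2[OF u] HI_Suc_wd(1)[OF u]]
  have "(\<integral>x. - (f x * (- (wd (wd u) x / real k))\<^sup>2) + Q x (u x) (wd u x) \<partial>I_meas)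
      = (\<integral>x. Q x (u x) (wd u x) - (f x * (wd (wd u) x * wd (wd u) x)) / (real k)\<^sup>2 \<partial>I_meas)"
    by (intro Bochner_Integration.integral_cong) (auto simp: power2_eq_square)
  also have "\<dots> = form u (wd u) - (\<integral>x. f x * (wd (wd u) x * wd (wd u) x) \<partial>I_meas) / (real k)\<^sup>2"
    using t q by (simp add: form_def)
  finally show "(\<integral>x. - (f x * (- (wd (wd u) x / real k))\<^sup>2) + Q x (u x) (wd u x) \<partial>I_meas)
      = form u (wd u) - (\<integral>x. f x * (wd (wd u) x * wd (wd u) x) \<partial>I_meas) / (real k)\<^sup>2" .
  have "(\<integral>x. \<rho> x * ((u x)\<^sup>2 + (wd u x)\<^sup>2 / (real k)\<^sup>2) \<partial>I_meas)
      = (\<integral>x. \<rho> x * (u x * u x) + \<rho> x * (wd u x * wd u x) / (real k)\<^sup>2 \<partial>I_meas)"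
    by (intro Bochner_Integration.integral_cong) (auto simp: power2_eq_square algebra_simps)
  also have "\<dots> = mass u + mass (wd u) / (real k)\<^sup>2"
    using integrable_mass[OF HI_L2[OF u]] integrable_mass[OF HI_Suc_wd(1)[OF u]] by (simp add: mass_def)
  finally show "(\<integral>x. \<rho> x * ((u x)\<^sup>2 + (wd u x)\<^sup>2 / (real k)\<^sup>2) \<partial>I_meas) = mass u + mass (wd u) / (real k)\<^sup>2" .
qed

theorem incompressible_limit:
  assumes L: "0 \<le> Lam \<or> 0 < c1"
  shows "(\<lambda>k. SUP u \<in> {u \<in> HI (Suc m). \<not> (AE x in I_meas. u x = 0)}.
      (\<integral>x. - (f x * (- (wd (wd u) x / real k))\<^sup>2) + Q x (u x) (wd u x) \<partial>I_meas) /
      (\<integral>x. \<rho> x * ((u x)\<^sup>2 + (wd u x)\<^sup>2 / (real k)\<^sup>2) \<partial>I_meas)) \<longlonglongrightarrow> Lam"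
proof (rule SUP_tendsto)
  fix \<epsilon> :: real assume \<epsilon>: "0 < \<epsilon>"
  obtain C where C: "0 < C" "\<And>w. w \<in> L2 I_meas \<Longrightarrow> mass w \<le> C * (\<integral>x. w x * w x \<partial>I_meas)"
    using mass_le by blast
  have "\<forall>\<^sub>F k in sequentially. 0 < k" by (rule eventually_gt_at_top)
  with quotient_deficit[OF \<epsilon> less_imp_le[OF C(1)] L, of K]
  show "\<forall>\<^sub>F k in sequentially. \<forall>u \<in> {u \<in> HI (Suc m). \<not> (AE x in I_meas. u x = 0)}.
      (\<integral>x. - (f x * (- (wd (wd u) x / real k))\<^sup>2) + Q x (u x) (wd u x) \<partial>I_meas) /
      (\<integral>x. \<rho> x * ((u x)\<^sup>2 + (wd u x)\<^sup>2 / (real k)\<^sup>2) \<partial>I_meas) \<le> Lam + \<epsilon>"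
  proof eventually_elim
    case (elim k)
    show ?case
    proof
      fix u assume "u \<in> {u \<in> HI (Suc m). \<not> (AE x in I_meas. u x = 0)}"
      then have u: "u \<in> HI (Suc m)" "\<not> (AE x in I_meas. u x = 0)" by auto
      note uL = HI_L2[OF u(1)] and wL = HI_Suc_wd(1)[OF u(1)]
      let ?N = "form u (wd u) - (\<integral>x. f x * (wd (wd u) x * wd (wd u) x) \<partial>I_meas) / (real k)\<^sup>2"
      have E: "0 \<le> (\<integral>x. wd u x * wd u x \<partial>I_meas)" by simp
      have T: "0 \<le> mass (wd u) / (real k)\<^sup>2" using mass_nonneg by simp
      have N: "?N \<le> form u (wd u)" using tension_nonneg by simp
      have "(real k)\<^sup>2 * (mass (wd u) / (real k)\<^sup>2) = mass (wd u)" using elim(2) by simp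
      also have "\<dots> \<le> C * (\<integral>x. wd u x * wd u x \<partial>I_meas)" by (rule C(2)[OF wL])
      also have "\<dots> \<le> C * (mass u + (\<integral>x. wd u x * wd u x \<partial>I_meas) + 0)"
        using mass_nonneg[of u] C(1) by simp
      finally have "?N \<le> (Lam + \<epsilon>) * (mass u + mass (wd u) / (real k)\<^sup>2)"
        using elim(1)[rule_format, of "mass u" "\<integral>x. wd u x * wd u x \<partial>I_meas" 0 "mass (wd u) / (real k)\<^sup>2" ?N]
          mass_nonneg[of u] E T N form_le_Lam[OF u(1)] form_upper[OF uL wL] by auto
      then show "(\<integral>x. - (f x * (- (wd (wd u) x / real k))\<^sup>2) + Q x (u x) (wd u x) \<partial>I_meas) /
          (\<integral>x. \<rho> x * ((u x)\<^sup>2 + (wd u x)\<^sup>2 / (real k)\<^sup>2) \<partial>I_meas) \<le> Lam + \<epsilon>"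
        unfolding incompressible_quotient[OF u(1)] using mass_pos[OF uL u(2)] T
        by (simp add: pos_divide_le_eq add_pos_nonneg)
    qed
  qed
next
  fix \<epsilon> :: real assume "0 < \<epsilon>"
  then obtain u where u: "u \<in> HI (Suc m)" "(Lam - \<epsilon>) * mass u < form u (wd u)" using near_maximiser by blast
  note p = near_maximiser_mass_pos[OF u]
  let ?F = "\<integral>x. f x * (wd (wd u) x * wd (wd u) x) \<partial>I_meas"
  have "(\<lambda>k. (form u (wd u) - ?F / (real k)\<^sup>2) / (mass u + mass (wd u) / (real k)\<^sup>2))
      \<longlonglongrightarrow> (form u (wd u) - 0) / (mass u + 0)"
    using p(1) by (intro tendsto_intros inverse_square_tendsto) auto
  then have "\<forall>\<^sub>F k in sequentially. Lam - \<epsilon> < (form u (wd u) - ?F / (real k)\<^sup>2) / (mass u + mass (wd u) / (real k)\<^sup>2)"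
    by (rule order_tendstoD(1)) (use u(2) p(1) in \<open>simp add: pos_less_divide_eq\<close>)
  then show "\<forall>\<^sub>F k in sequentially. \<exists>u \<in> {u \<in> HI (Suc m). \<not> (AE x in I_meas. u x = 0)}.
      Lam - \<epsilon> < (\<integral>x. - (f x * (- (wd (wd u) x / real k))\<^sup>2) + Q x (u x) (wd u x) \<partial>I_meas) /
      (\<integral>x. \<rho> x * ((u x)\<^sup>2 + (wd u x)\<^sup>2 / (real k)\<^sup>2) \<partial>I_meas)"
  proof eventually_elim
    case (elim k)
    then show ?case using u(1) p(2) incompressible_quotient[OF u(1), of k] by (intro bexI[of _ u]) auto
  qed
qed

end

section \<open>The limit with compression\<close>

text \<open>
The compression term is \<open>G\<^sub>k = \<sigma> (\<alpha> u\<^sub>1\<^sub>x + \<beta> u\<^sub>1 + k u\<^sub>2)\<^sup>2\<close>.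
\<close>

locale compressible_form = variational_form +
  fixes \<sigma> \<alpha> \<beta> :: "real \<Rightarrow> real" and s0 :: real
  assumes bdd_meas_gap: "bdd_meas I_meas \<sigma>" "bdd_meas I_meas \<alpha>" "bdd_meas I_meas \<beta>"
    and s0: "0 < s0" and sigma_ge: "\<And>x. x \<in> {0..2 * pi} \<Longrightarrow> s0 \<le> \<sigma> x"
begin

definition div_k :: "nat \<Rightarrow> (real \<Rightarrow> real) \<Rightarrow> (real \<Rightarrow> real) \<Rightarrow> real \<Rightarrow> real" where
  "div_k k u1 u2 x = \<alpha> x * wd u1 x + \<beta> x * u1 x + real k * u2 x"

definition gap :: "nat \<Rightarrow> (real \<Rightarrow> real) \<Rightarrow> (real \<Rightarrow> real) \<Rightarrow> real" where
  "gap k u1 u2 = (\<integral>x. \<sigma> x * (div_k k u1 u2 x * div_k k u1 u2 x) \<partial>I_meas)"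

definition numer :: "nat \<Rightarrow> (real \<Rightarrow> real) \<Rightarrow> (real \<Rightarrow> real) \<Rightarrow> real" where
  "numer k u1 u2 = (\<integral>x. - (f x * (wd u2 x)\<^sup>2) - \<sigma> x * (\<alpha> x * wd u1 x + \<beta> x * u1 x + real k * u2 x)\<^sup>2
      + Q x (u1 x) (wd u1 x) \<partial>I_meas)"

definition denom :: "(real \<Rightarrow> real) \<Rightarrow> (real \<Rightarrow> real) \<Rightarrow> real" where
  "denom u1 u2 = (\<integral>x. \<rho> x * ((u1 x)\<^sup>2 + (u2 x)\<^sup>2) \<partial>I_meas)"

lemma div_k_L2: "u1 \<in> HI (Suc m) \<Longrightarrow> u2 \<in> L2 I_meas \<Longrightarrow> div_k k u1 u2 \<in> L2 I_meas"
  unfolding div_k_def[abs_def] by (intro L2_add L2_bdd_meas_mult bdd_meas_gap bdd_meas_const HI_Suc_wd(1)) (auto intro: HI_L2)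

lemma gap_nonneg: "0 \<le> gap k u1 u2"
  unfolding gap_def
proof (intro integral_nonneg_AE AE_I2)
  fix x assume "x \<in> space I_meas"
  then have "0 \<le> \<sigma> x" using sigma_ge[of x] s0 by simp
  then show "0 \<le> \<sigma> x * (div_k k u1 u2 x * div_k k u1 u2 x)" by simp
qed

lemma numer_eq:
  assumes u1: "u1 \<in> HI (Suc m)" and u2: "u2 \<in> HI m"
  shows "numer k u1 u2 = form u1 (wd u1) - gap k u1 u2 - (\<integral>x. f x * (wd u2 x * wd u2 x) \<partial>I_meas)"
proof -
  have "wd u2 \<in> L2 I_meas" if "m = 1" using HI_Suc_wd(1)[of u2 0] u2 that by simp
  note t = integrable_tension[OF this]
  note q = integrable_Q[OF HI_L2[OF u1] HI_Suc_wd(1)[OF u1]]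
  note d = div_k_L2[OF u1 HI_L2[OF u2], of k]
  have "numer k u1 u2 = (\<integral>x. (Q x (u1 x) (wd u1 x) - \<sigma> x * (div_k k u1 u2 x * div_k k u1 u2 x))
      - f x * (wd u2 x * wd u2 x) \<partial>I_meas)"
    unfolding numer_def div_k_def
    by (intro Bochner_Integration.integral_cong) (auto simp: power2_eq_square)
  also have "\<dots> = form u1 (wd u1) - gap k u1 u2 - (\<integral>x. f x * (wd u2 x * wd u2 x) \<partial>I_meas)"
    using q t L2_form[OF bdd_meas_gap(1) d d] by (simp add: form_def gap_def)
  finally show ?thesis .
qed

lemma denom_eq: "u1 \<in> L2 I_meas \<Longrightarrow> u2 \<in> L2 I_meas \<Longrightarrow> denom u1 u2 = mass u1 + mass u2"
  using integrable_mass[of u1] integrable_mass[of u2]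
  by (simp add: denom_def mass_def power2_eq_square distrib_left)

text \<open>
Solving \<open>\<alpha> u\<^sub>1\<^sub>x + \<beta> u\<^sub>1 + k u\<^sub>2 = r\<close> for \<open>k u\<^sub>2\<close> bounds \<open>k\<^sup>2 u\<^sub>2\<^sup>2\<close> by the squares of the three other terms: \<open>u\<^sub>2\<close> can only
be large at the price of a large \<open>G\<^sub>k\<close>.
\<close>

lemma mass_le_gap:
  obtains C where "0 < C"
    "\<And>k u1 u2. u1 \<in> HI (Suc m) \<Longrightarrow> u2 \<in> L2 I_meas \<Longrightarrow>
      (real k)\<^sup>2 * mass u2 \<le> C * (mass u1 + (\<integral>x. wd u1 x * wd u1 x \<partial>I_meas) + gap k u1 u2)"
proof -
  obtain R where R: "0 < R" "\<And>x. x \<in> space I_meas \<Longrightarrow> \<bar>\<rho> x\<bar> \<le> R" using bdd_measE[OF bdd_meas_coeff(1)] by blast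
  obtain A where A: "0 < A" "\<And>x. x \<in> space I_meas \<Longrightarrow> \<bar>\<alpha> x\<bar> \<le> A" using bdd_measE[OF bdd_meas_gap(2)] by blast
  obtain B where B: "0 < B" "\<And>x. x \<in> space I_meas \<Longrightarrow> \<bar>\<beta> x\<bar> \<le> B" using bdd_measE[OF bdd_meas_gap(3)] by blast
  \<comment> \<open>The constant 3 comes from \<open>(r - q - p)\<^sup>2 \<le> 3 (p\<^sup>2 + q\<^sup>2 + r\<^sup>2)\<close>.\<close>
  define C where "C = 3 * R * (B\<^sup>2 / r0 + A\<^sup>2 + 1 / s0)"
  have "0 < C" unfolding C_def using R A B r0 s0 by (intro mult_pos_pos add_pos_pos) auto
  moreover have "(real k)\<^sup>2 * mass u2 \<le> C * (mass u1 + (\<integral>x. wd u1 x * wd u1 x \<partial>I_meas) + gap k u1 u2)"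
    if u1: "u1 \<in> HI (Suc m)" and u2: "u2 \<in> L2 I_meas" for k u1 u2
  proof -
    note d = div_k_L2[OF u1 u2, of k]
    note i = integrable_mass[OF HI_L2[OF u1]] L2_mult[OF HI_Suc_wd(1)[OF u1] HI_Suc_wd(1)[OF u1]]
      L2_form[OF bdd_meas_gap(1) d d]
    have "(real k)\<^sup>2 * mass u2 = (\<integral>x. (real k)\<^sup>2 * (\<rho> x * (u2 x * u2 x)) \<partial>I_meas)"
      unfolding mass_def by simp
    also have "\<dots> \<le> (\<integral>x. C * ((\<rho> x * (u1 x * u1 x) + wd u1 x * wd u1 x) + \<sigma> x * (div_k k u1 u2 x * div_k k u1 u2 x)) \<partial>I_meas)"
    proof (intro integral_mono integrable_mult_right Bochner_Integration.integrable_add i integrable_mass[OF u2])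
      fix x assume x: "x \<in> space I_meas"
      define p q r where "p = \<beta> x * u1 x" and "q = \<alpha> x * wd u1 x" and "r = div_k k u1 u2 x"
      have ku: "real k * u2 x = r - q - p" by (simp add: p_def q_def r_def div_k_def)
      have "(r - q - p)\<^sup>2 \<le> 3 * (p\<^sup>2 + q\<^sup>2 + r\<^sup>2)"
      proof -
        have "0 \<le> (r + q)\<^sup>2 + (r + p)\<^sup>2 + (q - p)\<^sup>2" by simp
        then show ?thesis by (simp add: power2_eq_square algebra_simps)
      qed
      moreover have "p\<^sup>2 \<le> B\<^sup>2 / r0 * (\<rho> x * (u1 x * u1 x))"
      proof -
        have "p\<^sup>2 = (\<beta> x)\<^sup>2 * (u1 x)\<^sup>2" by (simp add: p_def power_mult_distrib)
        also have "\<dots> \<le> B\<^sup>2 * (u1 x)\<^sup>2"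
          using B x by (intro mult_right_mono) (auto simp: abs_le_square_iff[symmetric])
        also have "\<dots> \<le> B\<^sup>2 * (\<rho> x / r0 * (u1 x)\<^sup>2)"
        proof (intro mult_left_mono)
          have "1 \<le> \<rho> x / r0" using rho_ge x r0 by simp
          from mult_right_mono[OF this, of "(u1 x)\<^sup>2"] show "(u1 x)\<^sup>2 \<le> \<rho> x / r0 * (u1 x)\<^sup>2" by simp
        qed simp
        finally show ?thesis by (simp add: power2_eq_square)
      qed
      moreover have "q\<^sup>2 \<le> A\<^sup>2 * (wd u1 x * wd u1 x)"
      proof -
        have "q\<^sup>2 = (\<alpha> x)\<^sup>2 * (wd u1 x)\<^sup>2" by (simp add: q_def power_mult_distrib)
        also have "\<dots> \<le> A\<^sup>2 * (wd u1 x)\<^sup>2"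
          using A x by (intro mult_right_mono) (auto simp: abs_le_square_iff[symmetric])
        finally show ?thesis by (simp add: power2_eq_square)
      qed
      moreover have "r\<^sup>2 \<le> 1 / s0 * (\<sigma> x * (r * r))"
      proof -
        have "1 \<le> \<sigma> x / s0" using sigma_ge x s0 by simp
        from mult_right_mono[OF this, of "r\<^sup>2"] show ?thesis by (simp add: power2_eq_square)
      qed
      ultimately have "(real k * u2 x)\<^sup>2 \<le> 3 * (B\<^sup>2 / r0 * (\<rho> x * (u1 x * u1 x)) + A\<^sup>2 * (wd u1 x * wd u1 x)
          + 1 / s0 * (\<sigma> x * (r * r)))"
        unfolding ku by (elim order_trans) (intro mult_left_mono add_mono; simp)
      also have "\<dots> \<le> 3 * ((B\<^sup>2 / r0 + A\<^sup>2 + 1 / s0) * (\<rho> x * (u1 x * u1 x) + wd u1 x * wd u1 x + \<sigma> x * (r * r)))"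
      proof -
        have le: "P * X + P' * Y + P'' * Z \<le> (P + P' + P'') * (X + Y + Z)"
          if "0 \<le> P" "0 \<le> P'" "0 \<le> P''" "0 \<le> X" "0 \<le> Y" "0 \<le> Z" for P P' P'' X Y Z :: real
        proof -
          have "0 \<le> P * Y + P * Z + P' * X + P' * Z + P'' * X + P'' * Y" using that by simp
          then show ?thesis by (simp add: algebra_simps)
        qed
        have "0 \<le> \<rho> x * (u1 x * u1 x)" "0 \<le> \<sigma> x * (r * r)"
          using x rho_pos[of x] sigma_ge[of x] s0 by auto
        then show ?thesis by (intro mult_left_mono le) (use r0 s0 in auto)
      qed
      finally have kk: "(real k * u2 x)\<^sup>2 \<le> \<dots>" .
      have "(real k)\<^sup>2 * (\<rho> x * (u2 x * u2 x)) = \<rho> x * (real k * u2 x)\<^sup>2" by (simp add: power2_eq_square)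
      also have "\<dots> \<le> R * (real k * u2 x)\<^sup>2" using R(2)[OF x] by (intro mult_right_mono) auto
      also have "\<dots> \<le> R * (3 * ((B\<^sup>2 / r0 + A\<^sup>2 + 1 / s0) * (\<rho> x * (u1 x * u1 x) + wd u1 x * wd u1 x + \<sigma> x * (r * r))))"
        using kk R(1) by (intro mult_left_mono) auto
      finally show "(real k)\<^sup>2 * (\<rho> x * (u2 x * u2 x))
          \<le> C * ((\<rho> x * (u1 x * u1 x) + wd u1 x * wd u1 x) + \<sigma> x * (div_k k u1 u2 x * div_k k u1 u2 x))"
        unfolding C_def r_def by (simp only: mult_ac)
    qed
    also have "\<dots> = C * (mass u1 + (\<integral>x. wd u1 x * wd u1 x \<partial>I_meas) + gap k u1 u2)"
      unfolding integral_mult_right_zero mass_def gap_def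
        Bochner_Integration.integral_add[OF Bochner_Integration.integrable_add[OF i(1,2)] i(3)]
        Bochner_Integration.integral_add[OF i(1,2)] ..
    finally show ?thesis .
  qed
  ultimately show ?thesis by (rule that)
qed

text \<open>
The function \<open>\<alpha> u\<^sub>x + \<beta> u\<close> need not be periodic, so it is replaced by an \<open>H\<^sup>1\<close> function \<open>s\<close>
close to it in \<open>L\<^sup>2\<close>.  With \<open>u\<^sub>2 = - s/k\<close> the compression integral does not depend on \<open>k\<close>.
\<close>

lemma competitor:
  assumes u: "u \<in> HI (Suc m)" and "0 < \<epsilon>"
  obtains s where "s \<in> HI 1" "\<And>k. 0 < k \<Longrightarrow> gap k u (\<lambda>x. - 1 / real k * s x) < \<epsilon>"
proof -
  define h where "h x = \<alpha> x * wd u x + \<beta> x * u x" for x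
  have h: "h \<in> L2 I_meas" unfolding h_def[abs_def]
    by (intro L2_add L2_bdd_meas_mult bdd_meas_gap HI_L2[OF u] HI_Suc_wd(1)[OF u])
  obtain s where s: "\<And>n. s n \<in> HI 1" "L2_lim I_meas s h" using L2_approx_HI1[OF h] by blast
  have d: "(\<lambda>x. s n x - h x) \<in> L2 I_meas" for n by (rule L2_diff[OF HI_L2[OF s(1)] h])
  have l: "L2_lim I_meas (\<lambda>n x. s n x - h x) (\<lambda>_. 0)" using s(2) by (simp add: L2_lim_def)
  have z: "(\<lambda>_. 0) \<in> L2 I_meas" by (rule bdd_meas_L2_I[OF bdd_meas_const])
  have "(\<lambda>n. \<integral>x. \<sigma> x * ((s n x - h x) * (s n x - h x)) \<partial>I_meas) \<longlonglongrightarrow> 0"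
    using L2_lim_form[OF bdd_meas_gap(1) d d z z l l] by simp
  from order_tendstoD(2)[OF this \<open>0 < \<epsilon>\<close>] obtain n where n: "(\<integral>x. \<sigma> x * ((s n x - h x) * (s n x - h x)) \<partial>I_meas) < \<epsilon>"
    using eventually_happens' sequentially_bot by blast
  have "gap k u (\<lambda>x. - 1 / real k * s n x) = (\<integral>x. \<sigma> x * ((s n x - h x) * (s n x - h x)) \<partial>I_meas)" if "0 < k" for k
    unfolding gap_def div_k_def h_def using that
    by (intro Bochner_Integration.integral_cong) (auto simp: algebra_simps)
  then show ?thesis using n s(1) by (intro that[of "s n"]) auto
qed

lemma HI_1_le: "s \<in> HI 1 \<Longrightarrow> s \<in> HI m"
  using m01 HI_antimono[of 0] by auto

theorem compressible_limit:
  assumes L: "0 \<le> Lam \<or> 0 < c1"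
  shows "(\<lambda>k. SUP (u1, u2) \<in> {(u1, u2). u1 \<in> HI (Suc m) \<and> u2 \<in> HI m \<and>
      \<not> (AE x in I_meas. u1 x = 0 \<and> u2 x = 0)}. numer k u1 u2 / denom u1 u2) \<longlonglongrightarrow> Lam"
proof (rule SUP_tendsto)
  fix \<epsilon> :: real assume \<epsilon>: "0 < \<epsilon>"
  obtain C where C: "0 < C" "\<And>k u1 u2. u1 \<in> HI (Suc m) \<Longrightarrow> u2 \<in> L2 I_meas \<Longrightarrow>
      (real k)\<^sup>2 * mass u2 \<le> C * (mass u1 + (\<integral>x. wd u1 x * wd u1 x \<partial>I_meas) + gap k u1 u2)"
    using mass_le_gap by blast
  from quotient_deficit[OF \<epsilon> less_imp_le[OF C(1)] L, of K]
  show "\<forall>\<^sub>F k in sequentially. \<forall>u \<in> {(u1, u2). u1 \<in> HI (Suc m) \<and> u2 \<in> HI m \<and>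
      \<not> (AE x in I_meas. u1 x = 0 \<and> u2 x = 0)}.
      (case u of (u1, u2) \<Rightarrow> numer k u1 u2 / denom u1 u2) \<le> Lam + \<epsilon>"
  proof eventually_elim
    case (elim k)
    show ?case
    proof (clarify)
      fix u1 u2 assume u: "u1 \<in> HI (Suc m)" "u2 \<in> HI m" "\<not> (AE x in I_meas. u1 x = 0 \<and> u2 x = 0)"
      note L2 = HI_L2[OF u(1)] HI_L2[OF u(2)] and wL = HI_Suc_wd(1)[OF u(1)]
      have E: "0 \<le> (\<integral>x. wd u1 x * wd u1 x \<partial>I_meas)" by simp
      have N: "numer k u1 u2 \<le> form u1 (wd u1) - gap k u1 u2"
        using numer_eq[OF u(1,2), of k] tension_nonneg[of "wd u2"] by simp
      have "numer k u1 u2 \<le> (Lam + \<epsilon>) * (mass u1 + mass u2)"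
        using elim[rule_format, of "mass u1" "\<integral>x. wd u1 x * wd u1 x \<partial>I_meas" "gap k u1 u2" "mass u2" "numer k u1 u2"]
          mass_nonneg[of u1] mass_nonneg[of u2] gap_nonneg[of k u1 u2] E N form_le_Lam[OF u(1)]
          form_upper[OF L2(1) wL] C(2)[OF u(1) L2(2), of k] by auto
      moreover have "0 < mass u1 + mass u2"
      proof (cases "AE x in I_meas. u1 x = 0")
        case True
        have "\<not> (AE x in I_meas. u2 x = 0)"
        proof
          assume "AE x in I_meas. u2 x = 0"
          with True have "AE x in I_meas. u1 x = 0 \<and> u2 x = 0" by eventually_elim simp
          then show False using u(3) by simp
        qed
        then show ?thesis using mass_pos[OF L2(2)] mass_nonneg[of u1] by simp
      next
        case False
        then show ?thesis using mass_pos[OF L2(1)] mass_nonneg[of u2] by simp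
      qed
      ultimately show "numer k u1 u2 / denom u1 u2 \<le> Lam + \<epsilon>"
        unfolding denom_eq[OF L2] by (simp add: pos_divide_le_eq)
    qed
  qed
next
  fix \<epsilon> :: real assume "0 < \<epsilon>"
  then obtain u where u: "u \<in> HI (Suc m)" "(Lam - \<epsilon>) * mass u < form u (wd u)" using near_maximiser by blast
  note p = near_maximiser_mass_pos[OF u]
  \<comment> \<open>Half of the excess may be lost to \<open>\<integral>G\<^sub>k\<close>; the other half absorbs the terms of order \<open>k\<^bsup>-2\<^esup>\<close>.\<close>
  define \<delta> where "\<delta> = (form u (wd u) - (Lam - \<epsilon>) * mass u) / 2"
  have "0 < \<delta>" using u(2) by (simp add: \<delta>_def)
  from competitor[OF u(1) this] obtain s where s: "s \<in> HI 1"
    "\<And>k. 0 < k \<Longrightarrow> gap k u (\<lambda>x. - 1 / real k * s x) < \<delta>" by blast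
  let ?F = "\<integral>x. f x * (wd s x * wd s x) \<partial>I_meas"
  have wds: "wd s \<in> L2 I_meas" using HI_Suc_wd(1)[of s 0] s(1) by simp
  have sL: "s \<in> L2 I_meas" using HI_L2[OF s(1)] .
  have "(\<lambda>k. (form u (wd u) - \<delta> - ?F / (real k)\<^sup>2) - (Lam - \<epsilon>) * (mass u + mass s / (real k)\<^sup>2))
      \<longlonglongrightarrow> (form u (wd u) - \<delta> - 0) - (Lam - \<epsilon>) * (mass u + 0)"
    by (intro tendsto_intros inverse_square_tendsto)
  then have "\<forall>\<^sub>F k in sequentially. 0 < (form u (wd u) - \<delta> - ?F / (real k)\<^sup>2) - (Lam - \<epsilon>) * (mass u + mass s / (real k)\<^sup>2)"
    by (rule order_tendstoD(1)) (use \<open>0 < \<delta>\<close> in \<open>simp add: \<delta>_def field_simps\<close>)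
  moreover have "\<forall>\<^sub>F k in sequentially. 0 < k" by (rule eventually_gt_at_top)
  ultimately show "\<forall>\<^sub>F k in sequentially. \<exists>u \<in> {(u1, u2). u1 \<in> HI (Suc m) \<and> u2 \<in> HI m \<and>
      \<not> (AE x in I_meas. u1 x = 0 \<and> u2 x = 0)}.
      Lam - \<epsilon> < (case u of (u1, u2) \<Rightarrow> numer k u1 u2 / denom u1 u2)"
  proof eventually_elim
    case (elim k)
    define u2 where "u2 x = - 1 / real k * s x" for x
    have u2: "u2 \<in> HI m" unfolding u2_def[abs_def] by (intro HI_cmult HI_1_le s(1))
    have "AE x in I_meas. wd u2 x = - 1 / real k * wd s x"
      unfolding u2_def[abs_def] using wd_cmult[of s 0 "- 1 / real k"] s(1) by simp
    then have wd2: "(\<integral>x. f x * (wd u2 x * wd u2 x) \<partial>I_meas) = ?F / (real k)\<^sup>2"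
    proof (cases "m = 0")
      case True
      then show ?thesis using order_zero by simp
    next
      case False
      assume ae: "AE x in I_meas. wd u2 x = - 1 / real k * wd s x"
      have w2: "wd u2 \<in> L2 I_meas" using HI_Suc_wd(1)[of u2 0] u2 False m01 by simp
      have "(\<integral>x. f x * (wd u2 x * wd u2 x) \<partial>I_meas) = (\<integral>x. f x * (wd s x * wd s x) / (real k)\<^sup>2 \<partial>I_meas)"
      proof (rule integral_cong_AE)
        show "(\<lambda>x. f x * (wd u2 x * wd u2 x)) \<in> borel_measurable I_meas"
          "(\<lambda>x. f x * (wd s x * wd s x) / (real k)\<^sup>2) \<in> borel_measurable I_meas"
          using borel_measurable_integrable[OF integrable_tension[of "wd u2"]]
            borel_measurable_integrable[OF integrable_tension[of "wd s"]] w2 wds by auto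
        show "AE x in I_meas. f x * (wd u2 x * wd u2 x) = f x * (wd s x * wd s x) / (real k)\<^sup>2"
          using ae by eventually_elim (simp add: power2_eq_square)
      qed
      then show ?thesis by simp
    qed
    have m2: "mass u2 = mass s / (real k)\<^sup>2"
      unfolding mass_def u2_def by (simp add: power2_eq_square mult_ac)
    have nz: "\<not> (AE x in I_meas. u x = 0 \<and> u2 x = 0)"
      using p(2) by (auto elim: eventually_mono)
    have "form u (wd u) - \<delta> - ?F / (real k)\<^sup>2 < numer k u u2"
      using numer_eq[OF u(1) u2, of k] wd2 s(2)[OF elim(2)] unfolding u2_def[abs_def] by simp
    then have "(Lam - \<epsilon>) * (mass u + mass u2) < numer k u u2" using elim(1) m2 by simp
    then have "Lam - \<epsilon> < numer k u u2 / denom u u2"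
      unfolding denom_eq[OF HI_L2[OF u(1)] HI_L2[OF u2]] using p(1) mass_nonneg[of u2]
      by (simp add: pos_less_divide_eq add_pos_nonneg)
    then show ?case using u(1) u2 nz by (intro bexI[of _ "(u, u2)"]) auto
  qed
qed

end

section \<open>Steady states\<close>

lemma deriv_unique_I:
  fixes f :: "real \<Rightarrow> real"
  assumes "(f has_real_derivative p) (at x within {0..2 * pi})" "(f has_real_derivative q) (at x within {0..2 * pi})"
    and "x \<in> {0..2 * pi}"
  shows "p = q"
  using vector_derivative_unique_within_closed_interval[of 0 "2 * pi" x f p q] assms
  by (simp add: has_real_derivative_iff_has_vector_derivative)

lemma steady_rho:
  assumes "steady_state \<tau> S"
  shows "x \<in> {0..2 * pi} \<Longrightarrow> (rho S has_real_derivative rho_x S x) (at x within {0..2 * pi})"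
    and "continuous_on {0..2 * pi} (rho S)" and "continuous_on {0..2 * pi} (rho_x S)"
proof -
  obtain d :: "nat \<Rightarrow> real \<Rightarrow> real" where d: "d 0 = rho S"
    "\<And>n x. x \<in> {0..2 * pi} \<Longrightarrow> (d n has_real_derivative d (Suc n) x) (at x within {0..2 * pi})"
    using assms unfolding steady_state_def smooth_on_I_def by blast
  have eq: "rho_x S x = d 1 x" if "x \<in> {0..2 * pi}" for x
    unfolding rho_x_def using d(2)[OF that, of 0] d(1) that
    by (intro vector_derivative_within_closed_interval)
       (auto simp: has_real_derivative_iff_has_vector_derivative)
  show "(rho S has_real_derivative rho_x S x) (at x within {0..2 * pi})" if "x \<in> {0..2 * pi}" for x
    using d(2)[OF that, of 0] d(1) eq[OF that] by simp
  show "continuous_on {0..2 * pi} (rho S)" using DERIV_continuous_on[OF d(2), of 0] d(1) by simp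
  show "continuous_on {0..2 * pi} (rho_x S)"
    by (rule continuous_on_eq[OF DERIV_continuous_on[OF d(2)] eq[symmetric]])
qed

lemma steady_rho_ge:
  assumes "steady_state \<tau> S"
  obtains r0 where "0 < r0" "\<And>x. x \<in> {0..2 * pi} \<Longrightarrow> r0 \<le> rho S x"
  using assms unfolding steady_state_def by blast

lemma norm_magnetic_field: "(norm (magnetic_field \<tau> S x))\<^sup>2 = (bmag S x)\<^sup>2"
  by (simp add: magnetic_field_def norm_vec_def L2_set_def sum_3)

lemma steady_balance:
  assumes "steady_state \<tau> S" "x \<in> {0..2 * pi}"
  shows "((\<lambda>x. press S x + (bmag S x)\<^sup>2 / 2) has_real_derivative rho S x * grav S) (at x within {0..2 * pi})"
  using assms unfolding steady_state_def norm_magnetic_field by blast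

lemma steady_pressure:
  assumes st: "steady_state \<tau> S" and c: "compressible \<tau>"
  shows "0 < adiab S" and "x \<in> {0..2 * pi} \<Longrightarrow> 0 < press S x"
    and "x \<in> {0..2 * pi} \<Longrightarrow>
      (press S has_real_derivative adiab S * press S x * rho_x S x / rho S x) (at x within {0..2 * pi})"
    and "continuous_on {0..2 * pi} (press S)"
proof -
  obtain C where g: "0 < adiab S" and C: "0 < C" "\<And>x. x \<in> {0..2 * pi} \<Longrightarrow> press S x = C * rho S x powr adiab S"
    using st c unfolding steady_state_def by blast
  obtain r0 where r0: "0 < r0" "\<And>x. x \<in> {0..2 * pi} \<Longrightarrow> r0 \<le> rho S x" using steady_rho_ge[OF st] by blast
  have rpos: "0 < rho S x" if "x \<in> {0..2 * pi}" for x using r0 that by fastforce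
  show "0 < adiab S" by (rule g)
  show "0 < press S x" if "x \<in> {0..2 * pi}" for x using C rpos[OF that] that by simp
  show D: "(press S has_real_derivative adiab S * press S x * rho_x S x / rho S x) (at x within {0..2 * pi})"
    if x: "x \<in> {0..2 * pi}" for x
  proof -
    have "((\<lambda>t. t powr adiab S) has_real_derivative adiab S * rho S x powr (adiab S - 1)) (at (rho S x))"
      by (rule has_real_derivative_powr[OF rpos[OF x]])
    from DERIV_chain2[OF this steady_rho(1)[OF st x]]
    have "((\<lambda>x. C * rho S x powr adiab S) has_real_derivative
        C * (adiab S * rho S x powr (adiab S - 1) * rho_x S x)) (at x within {0..2 * pi})"
      by (rule DERIV_cmult)
    moreover have "C * (adiab S * rho S x powr (adiab S - 1) * rho_x S x) = adiab S * press S x * rho_x S x / rho S x"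
      using C(2)[OF x] rpos[OF x] by (simp add: powr_diff)
    ultimately have "((\<lambda>x. C * rho S x powr adiab S) has_real_derivative
        adiab S * press S x * rho_x S x / rho S x) (at x within {0..2 * pi})" by simp
    then show ?thesis
      by (rule has_field_derivative_transform_within[OF _ zero_less_one x]) (simp add: C(2))
  qed
  show "continuous_on {0..2 * pi} (press S)" by (rule DERIV_continuous_on[OF D])
qed

text \<open>
Only the total pressure and, through the density, \<open>p\<^sub>0\<close> are known to be differentiable; their
difference makes \<open>B\<^sub>0\<^sup>2\<close> continuous, though \<open>B\<^sub>0\<close> itself may change sign discontinuously.
\<close>

lemma steady_stiffness:
  assumes st: "steady_state \<tau> S" and c: "compressible \<tau>"
  shows "continuous_on {0..2 * pi} (stiffness S)"
    and "\<exists>s0 > 0. \<forall>x \<in> {0..2 * pi}. s0 \<le> stiffness S x"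
proof -
  note p = steady_pressure[OF st c]
  have t: "continuous_on {0..2 * pi} (\<lambda>x. press S x + (bmag S x)\<^sup>2 / 2)"
    by (rule DERIV_continuous_on[OF steady_balance[OF st]])
  have "continuous_on {0..2 * pi} (\<lambda>x. adiab S * press S x + 2 * ((press S x + (bmag S x)\<^sup>2 / 2) - press S x))"
    by (intro continuous_on_add continuous_on_diff continuous_on_mult continuous_on_const p(4) t)
  then show cs: "continuous_on {0..2 * pi} (stiffness S)" unfolding stiffness_def[abs_def] by simp
  obtain y where y: "y \<in> {0..2 * pi}" "\<forall>x \<in> {0..2 * pi}. stiffness S y \<le> stiffness S x"
    using continuous_attains_inf[OF _ _ cs] by auto
  have "0 < stiffness S y" unfolding stiffness_def using p(1,2) y(1) by (intro add_pos_nonneg) auto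
  then show "\<exists>s0 > 0. \<forall>x \<in> {0..2 * pi}. s0 \<le> stiffness S x" using y(2) by blast
qed

lemma bounded_quotient:
  assumes "continuous_on {0..2 * pi} a" "0 < r0" "\<And>x. x \<in> {0..2 * pi} \<Longrightarrow> r0 \<le> \<rho> x"
  obtains K :: real where "\<And>x u :: real. x \<in> {0..2 * pi} \<Longrightarrow> a x * (u * u) \<le> K * (\<rho> x * (u * u))"
proof -
  obtain A where A: "0 < A" "\<And>x. x \<in> space I_meas \<Longrightarrow> \<bar>a x\<bar> \<le> A" using bdd_measE[OF bdd_meas_continuous[OF assms(1)]] by blast
  have "a x * (u * u) \<le> A / r0 * (\<rho> x * (u * u))" if x: "x \<in> {0..2 * pi}" for x u :: real
  proof -
    have "a x \<le> A" using A(2)[of x] x by simp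
    also have "A \<le> A / r0 * \<rho> x" using assms(2) assms(3)[OF x] A(1) by (simp add: field_simps)
    finally have "a x * (u * u) \<le> A / r0 * \<rho> x * (u * u)" by (rule mult_right_mono) simp
    then show ?thesis by (simp only: mult.assoc)
  qed
  then show ?thesis by (rule that)
qed

section \<open>The four types\<close>

lemma Lambda_sq_eq_Lam:
  assumes "variational_form m (rho S) a b c f r0 K c1" "kappa \<tau> - 1 = m"
    and H: "\<And>x u w. x \<in> {0..2 * pi} \<Longrightarrow> H_fun \<tau> S x u w = variational_form.Q a b c x u w"
  shows "Lambda_sq \<tau> S = variational_form.Lam m (rho S) a b c"
proof -
  interpret V: variational_form m "rho S" a b c f r0 K c1 by fact
  have "(\<integral>z. H_fun \<tau> S (fst z) (v z) (w z) \<partial>D_meas) = (\<integral>z. V.Q (fst z) (v z) (w z) \<partial>D_meas)" for v w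
    by (intro Bochner_Integration.integral_cong refl H) auto
  then show ?thesis unfolding Lambda_sq_def V.Lam_def assms(2) by simp
qed

lemma incompressible_case:
  assumes V: "variational_form m (rho S) a b c f r0 K c1" and k: "kappa \<tau> = Suc m" and i: "\<not> compressible \<tau>"
    and H: "\<And>x u w. x \<in> {0..2 * pi} \<Longrightarrow> H_fun \<tau> S x u w = variational_form.Q a b c x u w"
    and F: "\<And>x w. x \<in> {0..2 * pi} \<Longrightarrow> F_fun \<tau> S x w = f x * w\<^sup>2"
    and L: "0 \<le> Lambda_sq \<tau> S \<or> 0 < c1"
  shows "(\<lambda>k. lambda_sq \<tau> S k) \<longlonglongrightarrow> Lambda_sq \<tau> S"
proof -
  interpret V: variational_form m "rho S" a b c f r0 K c1 by (rule V)
  have Lam: "Lambda_sq \<tau> S = V.Lam" using Lambda_sq_eq_Lam[OF V _ H] k by simp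
  have "(\<integral>x. - F_fun \<tau> S x (- (wd (wd u) x / real k)) + H_fun \<tau> S x (u x) (wd u x) \<partial>I_meas)
      = (\<integral>x. - (f x * (- (wd (wd u) x / real k))\<^sup>2) + V.Q x (u x) (wd u x) \<partial>I_meas)" for u k
    by (intro Bochner_Integration.integral_cong refl) (simp add: F H)
  then show ?thesis
    using V.incompressible_limit L i unfolding Lam lambda_sq_def lambda_sq_incompressible_def k by simp
qed

lemma compressible_case:
  assumes V: "compressible_form m (rho S) a b c f r0 K c1 \<sigma> \<alpha> \<beta> s0" and k: "kappa \<tau> = Suc m" and i: "compressible \<tau>"
    and H: "\<And>x u w. x \<in> {0..2 * pi} \<Longrightarrow> H_fun \<tau> S x u w = variational_form.Q a b c x u w"
    and F: "\<And>x w. x \<in> {0..2 * pi} \<Longrightarrow> F_fun \<tau> S x w = f x * w\<^sup>2"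
    and G: "\<And>k x u1 w u2. x \<in> {0..2 * pi} \<Longrightarrow>
      G_fun \<tau> S k x u1 w u2 = \<sigma> x * (\<alpha> x * w + \<beta> x * u1 + real k * u2)\<^sup>2"
    and L: "0 \<le> Lambda_sq \<tau> S \<or> 0 < c1"
  shows "(\<lambda>k. lambda_sq \<tau> S k) \<longlonglongrightarrow> Lambda_sq \<tau> S"
proof -
  interpret V: compressible_form m "rho S" a b c f r0 K c1 \<sigma> \<alpha> \<beta> s0 by (rule V)
  have Lam: "Lambda_sq \<tau> S = V.Lam" using Lambda_sq_eq_Lam[OF V.variational_form_axioms _ H] k by simp
  have "(\<integral>x. - F_fun \<tau> S x (wd u2 x) - G_fun \<tau> S k x (u1 x) (wd u1 x) (u2 x)
      + H_fun \<tau> S x (u1 x) (wd u1 x) \<partial>I_meas) = V.numer k u1 u2" for u1 u2 k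
    unfolding V.numer_def by (intro Bochner_Integration.integral_cong refl) (simp add: F G H)
  then show ?thesis
    using V.compressible_limit L i unfolding Lam lambda_sq_def lambda_sq_compressible_def k V.denom_def by simp
qed

lemma limit_incompressible_transverse:
  assumes st: "steady_state Incompressible_Transverse S" and L: "0 \<le> Lambda_sq Incompressible_Transverse S"
  shows "(\<lambda>k. lambda_sq Incompressible_Transverse S k) \<longlonglongrightarrow> Lambda_sq Incompressible_Transverse S"
proof -
  obtain r0 where r0: "0 < r0" "\<And>x. x \<in> {0..2 * pi} \<Longrightarrow> r0 \<le> rho S x" using steady_rho_ge[OF st] by blast
  define a where "a x = - grav S * rho_x S x" for x
  have a: "continuous_on {0..2 * pi} a" unfolding a_def by (intro continuous_intros steady_rho[OF st])
  obtain K where K: "\<And>x u :: real. x \<in> {0..2 * pi} \<Longrightarrow> a x * (u * u) \<le> K * (rho S x * (u * u))"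
    using bounded_quotient[where \<rho> = "rho S", OF a r0] by blast
  interpret V: variational_form 0 "rho S" a "\<lambda>_. 0" "\<lambda>_. 0" "\<lambda>_. 0" r0 K 0
    by unfold_locales (use r0 K in \<open>auto intro!: bdd_meas_const bdd_meas_continuous a steady_rho[OF st]\<close>)
  show ?thesis
    by (rule incompressible_case[OF V.variational_form_axioms])
       (use L in \<open>auto simp: compressible_def V.Q_def a_def power2_eq_square\<close>)
qed

lemma limit_incompressible_parallel:
  assumes st: "steady_state Incompressible_Parallel S"
    and L: "\<forall>x \<in> {0..2 * pi}. bmag S x = 0 \<Longrightarrow> 0 \<le> Lambda_sq Incompressible_Parallel S"
  shows "(\<lambda>k. lambda_sq Incompressible_Parallel S k) \<longlonglongrightarrow> Lambda_sq Incompressible_Parallel S"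
proof -
  obtain r0 where r0: "0 < r0" "\<And>x. x \<in> {0..2 * pi} \<Longrightarrow> r0 \<le> rho S x" using steady_rho_ge[OF st] by blast
  obtain b0 where b0: "\<And>x. x \<in> {0..2 * pi} \<Longrightarrow> bmag S x = b0"
    using st unfolding steady_state_def parallel_def by blast
  define a where "a x = - grav S * rho_x S x" for x
  have a: "continuous_on {0..2 * pi} a" unfolding a_def by (intro continuous_intros steady_rho[OF st])
  obtain K where K: "\<And>x u :: real. x \<in> {0..2 * pi} \<Longrightarrow> a x * (u * u) \<le> K * (rho S x * (u * u))"
    using bounded_quotient[where \<rho> = "rho S", OF a r0] by blast
  interpret V: variational_form 1 "rho S" a "\<lambda>_. 0" "\<lambda>_. - b0\<^sup>2" "\<lambda>_. b0\<^sup>2" r0 K "b0\<^sup>2"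
    by unfold_locales (use r0 K in \<open>auto intro!: bdd_meas_const bdd_meas_continuous a steady_rho[OF st]\<close>)
  show ?thesis
  proof (rule incompressible_case[OF V.variational_form_axioms])
    show "H_fun Incompressible_Parallel S x u w = V.Q x u w" if "x \<in> {0..2 * pi}" for x u w
      unfolding V.Q_def by (simp add: a_def power2_eq_square b0[OF that])
    show "0 \<le> Lambda_sq Incompressible_Parallel S \<or> 0 < b0\<^sup>2" using L b0 by (cases "b0 = 0") auto
  qed (simp_all add: compressible_def b0)
qed

lemma limit_compressible_transverse:
  assumes st: "steady_state Compressible_Transverse S" and L: "0 \<le> Lambda_sq Compressible_Transverse S"
  shows "(\<lambda>k. lambda_sq Compressible_Transverse S k) \<longlonglongrightarrow> Lambda_sq Compressible_Transverse S"
proof -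
  have c: "compressible Compressible_Transverse" by (simp add: compressible_def)
  obtain r0 where r0: "0 < r0" "\<And>x. x \<in> {0..2 * pi} \<Longrightarrow> r0 \<le> rho S x" using steady_rho_ge[OF st] by blast
  obtain s0 where s0: "0 < s0" "\<And>x. x \<in> {0..2 * pi} \<Longrightarrow> s0 \<le> stiffness S x"
    using steady_stiffness(2)[OF st c] by blast
  note cont = steady_rho(2,3)[OF st] steady_stiffness(1)[OF st c]
  have spos: "stiffness S x \<noteq> 0" if "x \<in> {0..2 * pi}" for x using s0 that by fastforce
  define a where "a x = (grav S)\<^sup>2 * (rho S x)\<^sup>2 / stiffness S x - grav S * rho_x S x" for x
  define \<beta> where "\<beta> x = grav S * rho S x / stiffness S x" for x
  have a: "continuous_on {0..2 * pi} a" unfolding a_def using spos by (intro continuous_intros cont) auto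
  have \<beta>: "continuous_on {0..2 * pi} \<beta>" unfolding \<beta>_def using spos by (intro continuous_intros cont) auto
  obtain K where K: "\<And>x u :: real. x \<in> {0..2 * pi} \<Longrightarrow> a x * (u * u) \<le> K * (rho S x * (u * u))"
    using bounded_quotient[where \<rho> = "rho S", OF a r0] by blast
  interpret V: compressible_form 0 "rho S" a "\<lambda>_. 0" "\<lambda>_. 0" "\<lambda>_. 0" r0 K 0 "stiffness S" "\<lambda>_. 1" \<beta> s0
    by unfold_locales (use r0 K s0 in \<open>auto intro!: bdd_meas_const bdd_meas_continuous a \<beta> cont\<close>)
  show ?thesis
    by (rule compressible_case[OF V.compressible_form_axioms])
       (use L in \<open>auto simp: compressible_def V.Q_def a_def \<beta>_def power2_eq_square algebra_simps\<close>)
qed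

lemma parallel_form_completed_square:
  fixes P B g r :: real
  assumes "P \<noteq> 0" "P + B \<noteq> 0"
  shows "1 / (P + B) * (g * r * u - B * w)\<^sup>2 - g\<^sup>2 * r\<^sup>2 / P * u\<^sup>2 - B * w\<^sup>2
    = - (B / ((P + B) * P)) * (g * r * u + P * w)\<^sup>2"
proof -
  have "((P + B) * P) * (1 / (P + B) * (g * r * u - B * w)\<^sup>2 - g\<^sup>2 * r\<^sup>2 / P * u\<^sup>2 - B * w\<^sup>2)
    = P * (g * r * u - B * w)\<^sup>2 - (P + B) * (g\<^sup>2 * r\<^sup>2 * u\<^sup>2) - (P + B) * P * (B * w\<^sup>2)"
  proof -
    have "(T * P) * (1 / T * X - Y / P * Z - W) = P * X - T * (Y * Z) - T * P * W"
      if "T \<noteq> 0" for T X Y Z W :: real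
      using that assms(1) by (simp add: field_simps)
    then show ?thesis using assms(2) by blast
  qed
  also have "\<dots> = - B * (g * r * u + P * w)\<^sup>2" by (simp add: power2_eq_square algebra_simps)
  also have "\<dots> = ((P + B) * P) * (- (B / ((P + B) * P)) * (g * r * u + P * w)\<^sup>2)"
    using assms by simp
  finally show ?thesis using assms by (simp only: mult_cancel_left mult_eq_0_iff) simp
qed

text \<open>
The balance \<open>p\<^sub>0' = \<rho>\<^sub>0 g\<close>, where the constant magnetic pressure drops out, and \<open>p\<^sub>0 = C \<rho>\<^sub>0\<^sup>\<gamma>\<close> turn \<open>H\<close> into the completed square.
Since \<open>(X + Y)\<^sup>2 \<ge> Y\<^sup>2/2 - X\<^sup>2\<close>, it controls \<open>u\<^sub>x\<^sup>2\<close> unless \<open>B\<^sub>0 = 0\<close>; then \<open>H\<close> vanishes, and the constant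
function shows \<open>\<Lambda>\<^sup>2 \<ge> 0\<close>.
\<close>

lemma limit_compressible_parallel:
  assumes st: "steady_state Compressible_Parallel S"
  shows "(\<lambda>k. lambda_sq Compressible_Parallel S k) \<longlonglongrightarrow> Lambda_sq Compressible_Parallel S"
proof -
  have c: "compressible Compressible_Parallel" by (simp add: compressible_def)
  obtain r0 where r0: "0 < r0" "\<And>x. x \<in> {0..2 * pi} \<Longrightarrow> r0 \<le> rho S x" using steady_rho_ge[OF st] by blast
  obtain s0 where s0: "0 < s0" "\<And>x. x \<in> {0..2 * pi} \<Longrightarrow> s0 \<le> stiffness S x"
    using steady_stiffness(2)[OF st c] by blast
  obtain b0 where b0: "\<And>x. x \<in> {0..2 * pi} \<Longrightarrow> bmag S x = b0"
    using st unfolding steady_state_def parallel_def by blast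
  note p = steady_pressure[OF st c]
  note cont = steady_rho(2,3)[OF st] steady_stiffness(1)[OF st c] p(4)
  have rpos: "0 < rho S x" if "x \<in> {0..2 * pi}" for x using r0 that by fastforce
  have spos: "0 < stiffness S x" if "x \<in> {0..2 * pi}" for x using s0 that by fastforce
  define P where "P x = adiab S * press S x" for x
  have Ppos: "0 < P x" if "x \<in> {0..2 * pi}" for x unfolding P_def using p(1) p(2)[OF that] by simp
  have Pc: "continuous_on {0..2 * pi} P" unfolding P_def by (intro continuous_intros cont)
  have stiff: "stiffness S x = P x + b0\<^sup>2" if "x \<in> {0..2 * pi}" for x
    using b0[OF that] by (simp add: stiffness_def P_def)
  have hydro: "grav S * rho_x S x = (grav S)\<^sup>2 * (rho S x)\<^sup>2 / P x" if x: "x \<in> {0..2 * pi}" for x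
  proof -
    have "((\<lambda>x. (press S x + (bmag S x)\<^sup>2 / 2) - b0\<^sup>2 / 2) has_real_derivative rho S x * grav S - 0) (at x within {0..2 * pi})"
      by (intro DERIV_diff steady_balance[OF st x] DERIV_const)
    then have "(press S has_real_derivative rho S x * grav S - 0) (at x within {0..2 * pi})"
      by (rule has_field_derivative_transform_within[OF _ zero_less_one x]) (simp add: b0)
    from deriv_unique_I[OF this p(3)[OF x] x] have "rho S x * grav S = P x * rho_x S x / rho S x"
      by (simp add: P_def)
    then have "P x * rho_x S x = grav S * (rho S x)\<^sup>2" using rpos[OF x] by (simp add: field_simps power2_eq_square)
    then show ?thesis using Ppos[OF x] by (simp add: field_simps power2_eq_square)
  qed
  define a where "a x = (grav S)\<^sup>2 * (rho S x)\<^sup>2 / stiffness S x - grav S * rho_x S x" for x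
  define b where "b x = - 2 * (grav S * rho S x * b0\<^sup>2) / stiffness S x" for x
  define c' where "c' x = b0\<^sup>2 * b0\<^sup>2 / stiffness S x - b0\<^sup>2" for x
  define \<alpha> where "\<alpha> x = P x / stiffness S x" for x
  define \<beta> where "\<beta> x = grav S * rho S x / stiffness S x" for x
  have nz: "stiffness S x \<noteq> 0" "P x \<noteq> 0" if "x \<in> {0..2 * pi}" for x
    using spos[OF that] Ppos[OF that] by auto
  have cs: "continuous_on {0..2 * pi} a" "continuous_on {0..2 * pi} b" "continuous_on {0..2 * pi} c'"
    "continuous_on {0..2 * pi} \<alpha>" "continuous_on {0..2 * pi} \<beta>"
    unfolding a_def b_def c'_def \<alpha>_def \<beta>_def using nz by (intro continuous_intros cont Pc; auto)+
  have H: "a x * (u * u) + b x * (u * w) + c' x * (w * w)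
      = 1 / stiffness S x * (grav S * rho S x * u - b0\<^sup>2 * w)\<^sup>2 - grav S * rho_x S x * u\<^sup>2 - b0\<^sup>2 * w\<^sup>2" for x u w
    unfolding a_def b_def c'_def by (simp add: power2_eq_square algebra_simps diff_divide_distrib add_divide_distrib)
  have sq: "a x * (u * u) + b x * (u * w) + c' x * (w * w)
      = - (b0\<^sup>2 / (stiffness S x * P x)) * (grav S * rho S x * u + P x * w)\<^sup>2" if x: "x \<in> {0..2 * pi}" for x u w
    unfolding H hydro[OF x] using parallel_form_completed_square[of "P x" "b0\<^sup>2" "grav S" "rho S x" u w] nz[OF x]
    by (simp add: stiff[OF x])
  define e where "e x = b0\<^sup>2 * (grav S)\<^sup>2 * (rho S x)\<^sup>2 / (stiffness S x * P x)" for x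
  have ec: "continuous_on {0..2 * pi} e" unfolding e_def using nz by (intro continuous_intros cont Pc) auto
  obtain K where K: "\<And>x u :: real. x \<in> {0..2 * pi} \<Longrightarrow> e x * (u * u) \<le> K * (rho S x * (u * u))"
    using bounded_quotient[where \<rho> = "rho S", OF ec r0] by blast
  obtain y where y: "y \<in> {0..2 * pi}" "\<forall>x \<in> {0..2 * pi}. \<alpha> y \<le> \<alpha> x"
    using continuous_attains_inf[OF _ _ cs(4)] by auto
  \<comment> \<open>The minimum of \<open>\<alpha> = \<gamma>p\<^sub>0 / (\<gamma>p\<^sub>0 + B\<^sub>0\<^sup>2)\<close> makes the coefficient of \<open>u\<^sub>x\<^sup>2\<close> uniform.\<close>
  define c1 where "c1 = b0\<^sup>2 * \<alpha> y / 2"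
  have \<alpha>y: "0 < \<alpha> y" using Ppos[OF y(1)] spos[OF y(1)] by (simp add: \<alpha>_def)
  have bound: "a x * (u * u) + b x * (u * w) + c' x * (w * w) \<le> K * (rho S x * (u * u)) - c1 * (w * w)"
    if x: "x \<in> {0..2 * pi}" for x u w
  proof -
    have two: "Y\<^sup>2 / 2 - X\<^sup>2 \<le> (X + Y)\<^sup>2" for X Y :: real
    proof -
      have "0 \<le> (2 * X + Y)\<^sup>2" by simp
      then show ?thesis by (simp add: power2_eq_square algebra_simps)
    qed
    have "0 \<le> b0\<^sup>2 / (stiffness S x * P x)" using spos[OF x] Ppos[OF x] by simp
    from mult_left_mono[OF two[of "P x * w" "grav S * rho S x * u"] this]
    have "a x * (u * u) + b x * (u * w) + c' x * (w * w)
      \<le> b0\<^sup>2 / (stiffness S x * P x) * (grav S * rho S x * u)\<^sup>2 - b0\<^sup>2 / (stiffness S x * P x) * ((P x * w)\<^sup>2 / 2)"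
      unfolding sq[OF x] by (simp add: right_diff_distrib)
    also have "\<dots> = e x * (u * u) - b0\<^sup>2 * \<alpha> x / 2 * (w * w)"
      unfolding e_def \<alpha>_def using nz[OF x] by (simp add: power2_eq_square field_simps)
    also have "\<dots> \<le> K * (rho S x * (u * u)) - c1 * (w * w)"
    proof (intro diff_mono K x mult_right_mono)
      show "c1 \<le> b0\<^sup>2 * \<alpha> x / 2" unfolding c1_def using y(2) x by (intro divide_right_mono mult_left_mono) auto
    qed simp
    finally show ?thesis .
  qed
  have c1: "0 \<le> c1" unfolding c1_def using \<alpha>y by simp
  interpret V: compressible_form 1 "rho S" a b c' "\<lambda>_. b0\<^sup>2" r0 K c1 "stiffness S" \<alpha> \<beta> s0
    by unfold_locales (use r0 bound s0 c1 in \<open>auto intro!: bdd_meas_const bdd_meas_continuous cs cont\<close>)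
  have HQ: "H_fun Compressible_Parallel S x u w = V.Q x u w" if "x \<in> {0..2 * pi}" for x u w
    unfolding V.Q_def H by (simp add: b0[OF that])
  have Lam: "Lambda_sq Compressible_Parallel S = V.Lam"
    by (rule Lambda_sq_eq_Lam[OF V.variational_form_axioms _ HQ]) simp_all
  have L: "0 \<le> Lambda_sq Compressible_Parallel S \<or> 0 < c1"
  proof (cases "b0 = 0")
    case False
    then show ?thesis using \<alpha>y by (simp add: c1_def)
  next
    case True
    have one: "(\<lambda>_. 1) \<in> HI (Suc 1)"
    proof -
      have "(\<lambda>_. k) \<in> L2 I_meas" for k :: real by (rule bdd_meas_L2_I[OF bdd_meas_const])
      moreover have "weak_deriv (\<lambda>_. k) (\<lambda>_. 0)" for k by (rule weak_deriv_C1) auto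
      ultimately show ?thesis by auto
    qed
    have "V.form (\<lambda>_. 1) (wd (\<lambda>_. 1)) = 0"
    proof -
      have "V.Q x u w = 0" if "x \<in> {0..2 * pi}" for x u w
        unfolding V.Q_def sq[OF that] using True by simp
      then have "V.form (\<lambda>_. 1) (wd (\<lambda>_. 1)) = (\<integral>x. 0 \<partial>I_meas)"
        unfolding V.form_def by (intro Bochner_Integration.integral_cong) auto
      then show ?thesis by simp
    qed
    then have "0 \<le> V.Lam * V.mass (\<lambda>_. 1)" using V.form_le_Lam[OF one] by simp
    moreover have "0 < V.mass (\<lambda>_. 1)"
    proof (rule V.mass_pos)
      show "(\<lambda>_. 1) \<in> L2 I_meas" by (rule bdd_meas_L2_I[OF bdd_meas_const])
      show "\<not> (AE x in I_meas. (1 :: real) = 0)"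
      proof
        assume "AE x in I_meas. (1 :: real) = 0"
        then have "(\<integral>x. 1 \<partial>I_meas) = (0 :: real)" by (intro integral_eq_zero_AE) simp
        then show False using measure_I by simp
      qed
    qed
    ultimately show ?thesis unfolding Lam by (simp add: zero_le_mult_iff)
  qed
  show ?thesis
  proof (rule compressible_case[OF V.compressible_form_axioms _ c HQ _ _ L])
    show "G_fun Compressible_Parallel S k x u1 w u2 = stiffness S x * (\<alpha> x * w + \<beta> x * u1 + real k * u2)\<^sup>2"
      for k x u1 w u2
      by (simp add: \<alpha>_def \<beta>_def P_def)
  qed (simp_all add: b0)
qed


(* The notation Lambda^2 presupposes a nonnegative supremum.  This is imposed only where H does
   not control u_x: there, highly oscillating u (with G_k = 0 in the compressible case) give
   lambda_k^2 >= 0 for every k >= 1, while the supremum defining Lambda^2 can be negative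
   (for instance -1 for incompressible transverse rho_0 = exp x, g = 1). *)
theorem lemma1:
  fixes \<tau> :: mhd_type and S :: mhd_state
  assumes "steady_state \<tau> S"
    and "\<tau> \<in> {Incompressible_Transverse, Compressible_Transverse} \<or>
         (\<tau> = Incompressible_Parallel \<and> (\<forall>x \<in> {0..2 * pi}. bmag S x = 0))
           \<Longrightarrow> 0 \<le> Lambda_sq \<tau> S"
  shows "(\<lambda>k. lambda_sq \<tau> S k) \<longlonglongrightarrow> Lambda_sq \<tau> S"
proof (cases \<tau>)
  case Incompressible_Transverse
  then show ?thesis using assms limit_incompressible_transverse by simp
next
  case Compressible_Transverse
  then show ?thesis using assms limit_compressible_transverse by simp
next
  case Incompressible_Parallel
  then show ?thesis using assms limit_incompressible_parallel by simp
next
  case Compressible_Parallel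
  then show ?thesis using assms(1) limit_compressible_parallel by simp
qed

end
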